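(* Let $r \ge 2$ be an integer and let $\varepsilon > 0$. Then there exist a constant $\gamma > 0$ and a function $\omega$ with $\omega(n) \to \infty$ as $n \to \infty$ such that the following holds for all sufficiently small $\delta > 0$. For every $n$, if $m \ge (1+\varepsilon)m_r$, then \[ |\mathcal{F}_{n,m}^*(K_{r+1}; \delta, \gamma, \Pi)| \le \frac{1}{\omega(n)} \binom{e(\Pi)}{m} \quad \text{for every } \Pi \in \mathcal{P}_{n,r}(\gamma). \]
   Context: All graphs have vertex set $[n]=\{1,\dots,n\}$. $\mathcal{F}_{n,m}(K_{r+1})$ is the family of all $K_{r+1}$-free graphs on $[n]$ with exactly $m$ edges. For $\gamma>0$, $\mathcal{P}_{n,r}(\gamma)$ is the family of partitions $\Pi=\{V_1,\dots,V_r\}$ of $[n]$ into $r$ parts with $(\frac1r-\gamma)n \le |V_i| \le (\frac1r+\gamma)n$ for all $i$; a partition $\Pi$ is identified with the complete $r$-partite graph on $[n]$ with parts $V_1,\dots,V_r$, and $e(\Pi)$ is its number of edges. For a graph $G$ and a partition $\Pi=\{V_1,\dots,V_r\}$ of $[n]$ consider the conditions (A) $\sum_{i=1}^r e_G(V_i) \le \delta m$, where $e_G(V_i)$ is the number of edges of $G$ inside $V_i$; (B) $\deg_G(v,V_i) \le \min_{j \ne i} \deg_G(v,V_j)$ for all $i\in[r]$ and all $v \in V_i$, where $\deg_G(v,A)$ is the number of neighbours of $v$ in $A$. $\mathcal{F}_{n,m}(K_{r+1};\delta,\gamma)$ is the set of $G \in \mathcal{F}_{n,m}(K_{r+1})$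 such that (A) holds for some partition $\Pi \in \mathcal{P}_{n,r}(\gamma)$ and for no $r$-part partition $\Pi \notin \mathcal{P}_{n,r}(\gamma)$. For $\Pi \in \mathcal{P}_{n,r}(\gamma)$, $\mathcal{F}^*_{n,m}(K_{r+1};\delta,\gamma,\Pi)$ is the set of $G \in \mathcal{F}_{n,m}(K_{r+1};\delta,\gamma)$ such that $(G,\Pi)$ satisfy (A) and (B) and $\sum_{i=1}^r e_G(V_i) > 0$. Finally, \[ m_r = \theta_r n^{2-\frac{2}{r+2}} (\log n)^{\frac{1}{\binom{r+1}{2}-1}}, \quad \theta_r = \frac{r-1}{2r}\left[ r\left(\frac{2r+2}{r+2}\right)^{\frac{1}{r-1}}\right]^{\frac{2}{r+2}}, \] with $\log$ the natural logarithm. *)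

theory Defs
  imports Complex_Main
begin

definition graphs_on :: "nat \<Rightarrow> nat set set set" where
  "graphs_on n = {G. \<forall>e\<in>G. e \<subseteq> {1..n} \<and> card e = 2}"

definition clique_free :: "nat \<Rightarrow> nat \<Rightarrow> nat set set \<Rightarrow> bool" where
  "clique_free n k G \<longleftrightarrow>
     \<not> (\<exists>S. S \<subseteq> {1..n} \<and> card S = k \<and>
            (\<forall>u\<in>S. \<forall>v\<in>S. u \<noteq> v \<longrightarrow> {u, v} \<in> G))"

definition Kfree_graphs :: "nat \<Rightarrow> nat \<Rightarrow> nat \<Rightarrow> nat set set set" where
  "Kfree_graphs n m r = {G \<in> graphs_on n. card G = m \<and> clique_free n (r + 1) G}"

definition r_partitions :: "nat \<Rightarrow> nat \<Rightarrow> nat set set set" where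
  "r_partitions n r = {P. card P = r \<and> (\<forall>V\<in>P. V \<noteq> {}) \<and> \<Union>P = {1..n} \<and>
      (\<forall>V\<in>P. \<forall>W\<in>P. V \<noteq> W \<longrightarrow> V \<inter> W = {})}"

definition balanced_partitions :: "nat \<Rightarrow> nat \<Rightarrow> real \<Rightarrow> nat set set set" where
  "balanced_partitions n r \<gamma> = {P \<in> r_partitions n r.
      \<forall>V\<in>P. (1 / real r - \<gamma>) * real n \<le> real (card V) \<and>
             real (card V) \<le> (1 / real r + \<gamma>) * real n}"

definition partition_graph :: "nat set set \<Rightarrow> nat set set" where
  "partition_graph P = {e. e \<subseteq> \<Union>P \<and> card e = 2 \<and> (\<forall>V\<in>P. \<not> e \<subseteq> V)}"

definition e_part :: "nat set set \<Rightarrow> nat" where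
  "e_part P = card (partition_graph P)"

definition e_inside :: "nat set set \<Rightarrow> nat set \<Rightarrow> nat" where
  "e_inside G A = card {e\<in>G. e \<subseteq> A}"

definition deg_in :: "nat set set \<Rightarrow> nat \<Rightarrow> nat set \<Rightarrow> nat" where
  "deg_in G v A = card {u\<in>A. {v, u} \<in> G}"

definition condA :: "real \<Rightarrow> nat \<Rightarrow> nat set set \<Rightarrow> nat set set \<Rightarrow> bool" where
  "condA \<delta> m G P \<longleftrightarrow> real (\<Sum>V\<in>P. e_inside G V) \<le> \<delta> * real m"

definition condB :: "nat set set \<Rightarrow> nat set set \<Rightarrow> bool" where
  "condB G P \<longleftrightarrow> (\<forall>V\<in>P. \<forall>v\<in>V. \<forall>W\<in>P. W \<noteq> V \<longrightarrow> deg_in G v V \<le> deg_in G v W)"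

definition F_delta_gamma :: "nat \<Rightarrow> nat \<Rightarrow> nat \<Rightarrow> real \<Rightarrow> real \<Rightarrow> nat set set set" where
  "F_delta_gamma n m r \<delta> \<gamma> = {G \<in> Kfree_graphs n m r.
      (\<exists>P\<in>balanced_partitions n r \<gamma>. condA \<delta> m G P) \<and>
      (\<forall>P\<in>r_partitions n r. P \<notin> balanced_partitions n r \<gamma> \<longrightarrow> \<not> condA \<delta> m G P)}"

definition F_star :: "nat \<Rightarrow> nat \<Rightarrow> nat \<Rightarrow> real \<Rightarrow> real \<Rightarrow> nat set set \<Rightarrow> nat set set set" where
  "F_star n m r \<delta> \<gamma> P = {G \<in> F_delta_gamma n m r \<delta> \<gamma>.
      condA \<delta> m G P \<and> condB G P \<and> (\<Sum>V\<in>P. e_inside G V) > 0}"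

definition theta :: "nat \<Rightarrow> real" where
  "theta r = (real r - 1) / (2 * real r) *
     (real r * ((2 * real r + 2) / (real r + 2)) powr (1 / (real r - 1))) powr (2 / (real r + 2))"

definition m_r :: "nat \<Rightarrow> nat \<Rightarrow> real" where
  "m_r r n = theta r * real n powr (2 - 2 / (real r + 2)) *
     ln (real n) powr (1 / (real ((r + 1) choose 2) - 1))"

end

theory Submission
  imports Defs "HOL-Library.Ramsey" "HOL-Probability.Probability" "HOL-Real_Asymp.Real_Asymp"
begin

text \<open>
  Every graph \<open>G\<close> in question splits into its nonempty set \<open>T\<close> of edges
  inside the parts and its crossing edges, and by the absence of a clique no set of crossing pairs
  completing an edge of \<open>T\<close> to a clique lies in \<open>G\<close>. A uniform set of
  crossing pairs satisfies such a decreasing event no more often, up to a constant factor, than a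
  binomial set of slightly smaller density \<open>p\<close>, so Janson's inequality bounds the number
  of crossing parts for a given \<open>T\<close>. This must beat the number of choices of
  \<open>T\<close>, weighted by the loss of about \<open>p\<close> per inner edge in the choice of the
  crossing edges.

  Peel \<open>T\<close> into stars in order of decreasing degree. Let \<open>M\<close> be about the
  expected number of cliques completing one inner edge. For an edge in a star of degree
  \<open>b \<le> d\<close>, where \<open>d\<close> is about \<open>\<beta> p n\<close>, the Janson
  family is thinned to an expected \<open>min M (sqrt (p n / b))\<close> cliques: then the correlations
  are negligible, yet the star still costs \<open>exp (- b min M (sqrt (p n / b)))\<close>. The choice
  of \<open>m_r\<close> makes \<open>n^2 p exp (- M)\<close> a negative power of \<open>n\<close>, so
  these stars contribute little.

  At a vertex of higher degree, condition (B) provides a box of \<open>d\<close> neighbours in every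
  part spanning no transversal clique. For several such vertices a family of transversals is chosen
  greedily so that no set of \<open>j\<close> vertices is in too many of them; this fails only for the
  few boxes in which the saturated sets are dense, so Janson's inequality gives a factor
  \<open>exp (- K p n)\<close> per vertex for any prescribed constant \<open>K\<close>.

  When \<open>m\<close> is very close to the number of all crossing pairs, each inner edge instead
  forces linearly many missing crossing pairs, and a direct count suffices.
\<close>

section \<open>Random subsets and Janson's inequality\<close>

definition random_subset :: "'a set \<Rightarrow> ('a \<Rightarrow> real) \<Rightarrow> 'a set pmf" where
  "random_subset \<Omega> p = map_pmf (\<lambda>f. {x\<in>\<Omega>. f x}) (Pi_pmf \<Omega> False (\<lambda>x. bernoulli_pmf (p x)))"

lemma random_subset_subset: "R \<in> set_pmf (random_subset \<Omega> p) \<Longrightarrow> R \<subseteq> \<Omega>"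
  by (auto simp: random_subset_def)

lemma finite_set_random_subset: "finite \<Omega> \<Longrightarrow> finite (set_pmf (random_subset \<Omega> p))"
  by (rule finite_subset[of _ "Pow \<Omega>"]) (auto dest: random_subset_subset)

lemma prob_random_subset_mono:
  assumes "\<And>R. R \<subseteq> \<Omega> \<Longrightarrow> Q R \<Longrightarrow> Q' R"
  shows "\<P>(R in random_subset \<Omega> p. Q R) \<le> \<P>(R in random_subset \<Omega> p. Q' R)"
  using assms by (intro measure_pmf.finite_measure_mono_AE)
    (auto simp: AE_measure_pmf_iff dest: random_subset_subset)

lemma random_subset_Un:
  assumes "finite A" "finite B" "A \<inter> B = {}"
  shows "random_subset (A \<union> B) p
    = map_pmf (\<lambda>(R, S). R \<union> S) (pair_pmf (random_subset A p) (random_subset B p))"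
  unfolding random_subset_def Pi_pmf_union[OF assms] map_pair[symmetric] map_pmf_comp
  using assms(3) by (intro map_pmf_cong) auto

lemma prob_all_in_random_subset:
  assumes "finite \<Omega>" "B \<subseteq> \<Omega>" "\<forall>x\<in>\<Omega>. 0 \<le> p x \<and> p x \<le> 1"
  shows "\<P>(R in random_subset \<Omega> p. B \<subseteq> R) = (\<Prod>x\<in>B. p x)"
proof -
  let ?C = "\<lambda>x. if x \<in> B then {True} else UNIV"
  have "\<P>(R in random_subset \<Omega> p. B \<subseteq> R)
      = measure_pmf.prob (Pi_pmf \<Omega> False (\<lambda>x. bernoulli_pmf (p x))) (Pi \<Omega> ?C)"
    using assms(2) unfolding random_subset_def
    by (auto simp: Pi_def split: if_splits intro!: arg_cong[of _ _ "measure_pmf.prob _"])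
  also have "\<dots> = (\<Prod>x\<in>\<Omega>. measure_pmf.prob (bernoulli_pmf (p x)) (?C x))"
    by (rule measure_Pi_pmf_Pi[OF assms(1)])
  also have "\<dots> = (\<Prod>x\<in>\<Omega>. if x \<in> B then p x else 1)"
    using assms(3) by (intro prod.cong) (auto simp: measure_pmf_single)
  also have "\<dots> = (\<Prod>x\<in>B. p x)"
    using assms(1,2) by (simp add: prod.inter_restrict[symmetric] Int_absorb1)
  finally show ?thesis .
qed

lemma prob_random_subset_Un_fixed:
  assumes "finite \<Omega>" "B \<subseteq> \<Omega>"
  shows "\<P>(R in random_subset \<Omega> p. Q (R \<union> B)) = \<P>(R in random_subset (\<Omega> - B) p. Q (R \<union> B))"
proof -
  have \<Omega>: "\<Omega> = B \<union> (\<Omega> - B)" "finite B" "finite (\<Omega> - B)" "B \<inter> (\<Omega> - B) = {}"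
    using assms finite_subset by auto
  have "random_subset \<Omega> p
      = map_pmf (\<lambda>(R, S). R \<union> S) (pair_pmf (random_subset B p) (random_subset (\<Omega> - B) p))"
    using random_subset_Un[OF \<Omega>(2-4), of p] \<Omega>(1) by simp
  then have "map_pmf (\<lambda>R. R \<union> B) (random_subset \<Omega> p)
      = map_pmf ((\<lambda>R. R \<union> B) \<circ> snd) (pair_pmf (random_subset B p) (random_subset (\<Omega> - B) p))"
    by (auto simp: map_pmf_comp intro!: map_pmf_cong dest!: random_subset_subset)
  also have "\<dots> = map_pmf (\<lambda>R. R \<union> B) (random_subset (\<Omega> - B) p)"
    by (simp add: map_snd_pair_pmf flip: pmf.map_comp)
  finally have "measure_pmf.prob (map_pmf (\<lambda>R. R \<union> B) (random_subset \<Omega> p)) {R. Q R}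
      = measure_pmf.prob (map_pmf (\<lambda>R. R \<union> B) (random_subset (\<Omega> - B) p)) {R. Q R}"
    by simp
  then show ?thesis by (simp add: vimage_def)
qed

lemma prob_random_subset_superset:
  assumes "finite \<Omega>" "B \<subseteq> \<Omega>" "\<forall>x\<in>\<Omega>. 0 \<le> p x \<and> p x \<le> 1"
  shows "\<P>(R in random_subset \<Omega> p. B \<subseteq> R \<and> Q R)
    = (\<Prod>x\<in>B. p x) * \<P>(R in random_subset \<Omega> p. Q (R \<union> B))"
proof -
  have \<Omega>: "\<Omega> = B \<union> (\<Omega> - B)" "finite B" "finite (\<Omega> - B)" "B \<inter> (\<Omega> - B) = {}"
    using assms finite_subset by auto
  let ?pair = "pair_pmf (random_subset B p) (random_subset (\<Omega> - B) p)"
  have split: "random_subset \<Omega> p = map_pmf (\<lambda>(R, S). R \<union> S) ?pair"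
    using random_subset_Un[OF \<Omega>(2-4), of p] \<Omega>(1) by simp
  have iff: "B \<subseteq> R \<union> S \<and> Q (R \<union> S) \<longleftrightarrow> B \<subseteq> R \<and> Q (S \<union> B)" if "R \<subseteq> B" "S \<subseteq> \<Omega> - B" for R S
  proof -
    have "R = B" if "B \<subseteq> R \<union> S" using that \<open>R \<subseteq> B\<close> \<open>S \<subseteq> \<Omega> - B\<close> by blast
    then show ?thesis by (auto simp: Un_commute)
  qed
  have "\<P>(R in random_subset \<Omega> p. B \<subseteq> R \<and> Q R)
      = measure_pmf.prob ?pair ({R\<in>Pow B. B \<subseteq> R} \<times> {S\<in>Pow (\<Omega> - B). Q (S \<union> B)})"
    unfolding split measure_map_pmf
    by (intro measure_pmf.finite_measure_eq_AE)
      (use iff in \<open>auto simp: AE_measure_pmf_iff dest!: random_subset_subset\<close>)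
  also have "\<dots> = measure_pmf.prob (random_subset B p) {R\<in>Pow B. B \<subseteq> R}
      * measure_pmf.prob (random_subset (\<Omega> - B) p) {S\<in>Pow (\<Omega> - B). Q (S \<union> B)}"
    using \<Omega>(2,3) by (intro measure_pmf_prob_product countable_finite) auto
  also have "\<dots> = \<P>(R in random_subset B p. B \<subseteq> R) * \<P>(R in random_subset (\<Omega> - B) p. Q (R \<union> B))"
    by (intro arg_cong2[of _ _ _ _ "(*)"] measure_pmf.finite_measure_eq_AE)
      (auto simp: AE_measure_pmf_iff dest: random_subset_subset)
  also have "\<P>(R in random_subset B p. B \<subseteq> R) = (\<Prod>x\<in>B. p x)"
    using assms(2,3) \<Omega>(2) by (intro prob_all_in_random_subset) auto
  finally show ?thesis
    by (simp only: prob_random_subset_Un_fixed[OF assms(1,2)])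
qed

lemma expectation_sum_random_subset:
  fixes g :: "'a \<Rightarrow> real"
  assumes "finite \<Omega>" "\<forall>x\<in>\<Omega>. 0 \<le> p x \<and> p x \<le> 1"
  shows "measure_pmf.expectation (random_subset \<Omega> p) (\<lambda>R. \<Sum>x\<in>R. g x) = (\<Sum>x\<in>\<Omega>. p x * g x)"
proof -
  have "measure_pmf.expectation (random_subset \<Omega> p) (\<lambda>R. \<Sum>x\<in>R. g x)
      = measure_pmf.expectation (random_subset \<Omega> p) (\<lambda>R. \<Sum>x\<in>\<Omega>. g x * indicator {R. x \<in> R} R)"
    using assms(1) by (intro integral_cong_AE) (auto simp: AE_measure_pmf_iff indicator_def
      sum.inter_restrict[symmetric] Int_absorb1 dest!: random_subset_subset)
  also have "\<dots> = (\<Sum>x\<in>\<Omega>. g x * \<P>(R in random_subset \<Omega> p. x \<in> R))"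
    by (subst Bochner_Integration.integral_sum) (simp_all add: measure_pmf.emeasure_eq_measure)
  also have "\<dots> = (\<Sum>x\<in>\<Omega>. p x * g x)"
    using prob_all_in_random_subset[OF assms(1) _ assms(2), of "{_}"] by (intro sum.cong) auto
  finally show ?thesis .
qed

lemma expectation_sum_pairs_random_subset:
  fixes g :: "'a \<Rightarrow> 'a \<Rightarrow> real"
  assumes "finite \<Omega>" "\<forall>x\<in>\<Omega>. 0 \<le> p x \<and> p x \<le> 1"
  shows "measure_pmf.expectation (random_subset \<Omega> p) (\<lambda>R. \<Sum>x\<in>R. \<Sum>y\<in>R - {x}. g x y)
    = (\<Sum>x\<in>\<Omega>. \<Sum>y\<in>\<Omega> - {x}. p x * p y * g x y)"
proof -
  have "(\<Sum>x\<in>R. \<Sum>y\<in>R - {x}. g x y)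
      = (\<Sum>x\<in>\<Omega>. \<Sum>y\<in>\<Omega> - {x}. g x y * indicator {R. x \<in> R \<and> y \<in> R} R)" if "R \<subseteq> \<Omega>" for R
  proof -
    have "(\<Sum>x\<in>\<Omega>. \<Sum>y\<in>\<Omega> - {x}. g x y * indicator {R. x \<in> R \<and> y \<in> R} R)
        = (\<Sum>x\<in>R. \<Sum>y\<in>\<Omega> - {x}. g x y * indicator {R. x \<in> R \<and> y \<in> R} R)"
      using assms(1) that by (intro sum.mono_neutral_right) auto
    also have "\<dots> = (\<Sum>x\<in>R. \<Sum>y\<in>R - {x}. g x y)"
      by (rule sum.cong[OF refl], rule sum.mono_neutral_cong_right)
        (use assms(1) that in \<open>auto simp: indicator_def\<close>)
    finally show ?thesis by simp
  qed
  then have "measure_pmf.expectation (random_subset \<Omega> p) (\<lambda>R. \<Sum>x\<in>R. \<Sum>y\<in>R - {x}. g x y)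
      = measure_pmf.expectation (random_subset \<Omega> p)
          (\<lambda>R. \<Sum>x\<in>\<Omega>. \<Sum>y\<in>\<Omega> - {x}. g x y * indicator {R. x \<in> R \<and> y \<in> R} R)"
    by (intro integral_cong_AE) (auto simp: AE_measure_pmf_iff dest!: random_subset_subset)
  also have "\<dots> = (\<Sum>x\<in>\<Omega>. \<Sum>y\<in>\<Omega> - {x}. g x y * \<P>(R in random_subset \<Omega> p. x \<in> R \<and> y \<in> R))"
    by (subst Bochner_Integration.integral_sum;
        (subst Bochner_Integration.integral_sum)?; simp add: measure_pmf.emeasure_eq_measure)
  also have "\<dots> = (\<Sum>x\<in>\<Omega>. \<Sum>y\<in>\<Omega> - {x}. p x * p y * g x y)"
    using prob_all_in_random_subset[OF assms(1) _ assms(2), of "{_, _}"] by (intro sum.cong) auto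
  finally show ?thesis .
qed

lemma prob_superset_avoiding_ge:
  fixes p :: "'a \<Rightarrow> real"
  assumes \<Omega>: "finite \<Omega>" and p: "\<forall>x\<in>\<Omega>. 0 \<le> p x \<and> p x \<le> 1" and I: "finite I"
    and A: "A \<subseteq> \<Omega>" and B: "\<forall>j\<in>I. B j \<subseteq> \<Omega>"
  shows "((\<Prod>x\<in>A. p x) - (\<Sum>j | j \<in> I \<and> A \<inter> B j \<noteq> {}. \<Prod>x\<in>A \<union> B j. p x))
      * \<P>(R in random_subset \<Omega> p. \<forall>j\<in>{j\<in>I. A \<inter> B j = {}}. \<not> B j \<subseteq> R)
    \<le> \<P>(R in random_subset \<Omega> p. A \<subseteq> R \<and> (\<forall>j\<in>I. \<not> B j \<subseteq> R))"
proof -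
  let ?M = "random_subset \<Omega> p"
  define J where "J = {j \<in> I. A \<inter> B j \<noteq> {}}"
  define far where "far R \<longleftrightarrow> (\<forall>j\<in>{j\<in>I. A \<inter> B j = {}}. \<not> B j \<subseteq> R)" for R
  have independent: "\<P>(R in ?M. A \<subseteq> R \<and> far R) = (\<Prod>x\<in>A. p x) * \<P>(R in ?M. far R)"
  proof -
    have "far (R \<union> A) = far R" for R
      unfolding far_def by blast
    then show ?thesis using prob_random_subset_superset[OF \<Omega> A p, of far] by simp
  qed
  have harris: "\<P>(R in ?M. A \<union> B j \<subseteq> R \<and> far R) \<le> (\<Prod>x\<in>A \<union> B j. p x) * \<P>(R in ?M. far R)"
    if "j \<in> J" for j
  proof -
    have sub: "A \<union> B j \<subseteq> \<Omega>" using A B that J_def by auto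
    have "\<P>(R in ?M. far (R \<union> (A \<union> B j))) \<le> \<P>(R in ?M. far R)"
      by (rule prob_random_subset_mono) (auto simp: far_def)
    moreover have "0 \<le> (\<Prod>x\<in>A \<union> B j. p x)" using sub p by (intro prod_nonneg) auto
    ultimately show ?thesis
      using prob_random_subset_superset[OF \<Omega> sub p, of far] by (simp add: mult_left_mono)
  qed
  have "\<P>(R in ?M. A \<subseteq> R \<and> far R) \<le> measure_pmf.prob ?M
      ({R. A \<subseteq> R \<and> (\<forall>j\<in>I. \<not> B j \<subseteq> R)} \<union> (\<Union>j\<in>J. {R. A \<union> B j \<subseteq> R \<and> far R}))"
    by (intro measure_pmf.finite_measure_mono) (auto simp: far_def J_def)
  also have "\<dots> \<le> measure_pmf.prob ?M {R. A \<subseteq> R \<and> (\<forall>j\<in>I. \<not> B j \<subseteq> R)}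
      + (\<Sum>j\<in>J. measure_pmf.prob ?M {R. A \<union> B j \<subseteq> R \<and> far R})"
    using I by (intro order_trans[OF measure_Un_le] add_left_mono measure_UNION_le) (auto simp: J_def)
  also have "(\<Sum>j\<in>J. measure_pmf.prob ?M {R. A \<union> B j \<subseteq> R \<and> far R})
      \<le> (\<Sum>j\<in>J. (\<Prod>x\<in>A \<union> B j. p x) * \<P>(R in ?M. far R))"
    using harris by (intro sum_mono) simp
  finally show ?thesis
    unfolding independent unfolding J_def far_def by (simp add: left_diff_distrib sum_distrib_right)
qed

text \<open>The inductive step of the Boppana--Spencer proof of Janson's inequality: the event at \<open>i\<close> is
  independent of the events disjoint from it, and Harris' inequality is only needed against an
  event of the form \<open>B \<subseteq> R\<close>.\<close>

lemma janson_step: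
  fixes p :: "'a \<Rightarrow> real"
  assumes \<Omega>: "finite \<Omega>" and p: "\<forall>x\<in>\<Omega>. 0 \<le> p x \<and> p x \<le> 1" and I: "finite I"
    and B: "\<forall>j\<in>insert i I. B j \<subseteq> \<Omega>"
  shows "\<P>(R in random_subset \<Omega> p. \<forall>j\<in>insert i I. \<not> B j \<subseteq> R)
    \<le> exp (- (\<Prod>x\<in>B i. p x) + (\<Sum>j | j \<in> I \<and> B i \<inter> B j \<noteq> {}. \<Prod>x\<in>B i \<union> B j. p x))
      * \<P>(R in random_subset \<Omega> p. \<forall>j\<in>I. \<not> B j \<subseteq> R)"
proof -
  let ?M = "random_subset \<Omega> p"
  let ?far = "\<P>(R in ?M. \<forall>j\<in>{j\<in>I. B i \<inter> B j = {}}. \<not> B j \<subseteq> R)"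
  define avoid where "avoid R \<longleftrightarrow> (\<forall>j\<in>I. \<not> B j \<subseteq> R)" for R
  define drop where
    "drop = (\<Prod>x\<in>B i. p x) - (\<Sum>j | j \<in> I \<and> B i \<inter> B j \<noteq> {}. \<Prod>x\<in>B i \<union> B j. p x)"
  have "drop * \<P>(R in ?M. avoid R) \<le> \<P>(R in ?M. B i \<subseteq> R \<and> avoid R)"
  proof (cases "drop \<ge> 0")
    case True
    have "\<P>(R in ?M. avoid R) \<le> ?far"
      by (rule prob_random_subset_mono) (auto simp: avoid_def)
    then have "drop * \<P>(R in ?M. avoid R) \<le> drop * ?far" using True by (rule mult_left_mono)
    also have "\<dots> \<le> \<P>(R in ?M. B i \<subseteq> R \<and> avoid R)"
      unfolding drop_def avoid_def using prob_superset_avoiding_ge[OF \<Omega> p I, of "B i" B] B by simp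
    finally show ?thesis .
  next
    case False
    then have "drop * \<P>(R in ?M. avoid R) \<le> 0" by (simp add: mult_nonpos_nonneg)
    then show ?thesis using measure_nonneg by (rule order_trans)
  qed
  moreover have "\<P>(R in ?M. avoid R)
      = \<P>(R in ?M. B i \<subseteq> R \<and> avoid R) + \<P>(R in ?M. \<forall>j\<in>insert i I. \<not> B j \<subseteq> R)"
    by (subst measure_pmf.finite_measure_Union[symmetric])
      (auto simp: avoid_def intro!: arg_cong[of _ _ "measure_pmf.prob _"])
  ultimately have "\<P>(R in ?M. \<forall>j\<in>insert i I. \<not> B j \<subseteq> R) \<le> (1 - drop) * \<P>(R in ?M. avoid R)"
    by (simp add: algebra_simps)
  also have "\<dots> \<le> exp (- drop) * \<P>(R in ?M. avoid R)"
    using exp_ge_add_one_self[of "- drop"] by (intro mult_right_mono) auto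
  finally show ?thesis unfolding avoid_def drop_def by simp
qed

lemma sum_pairs_insert:
  fixes g :: "'a \<Rightarrow> 'a \<Rightarrow> real"
  assumes "finite I" "i \<notin> I" and sym: "\<And>a b. g a b = g b a"
  shows "(\<Sum>a\<in>insert i I. \<Sum>b\<in>insert i I - {a}. g a b)
    = (\<Sum>a\<in>I. \<Sum>b\<in>I - {a}. g a b) + 2 * (\<Sum>b\<in>I. g i b)"
proof -
  have "(\<Sum>b\<in>insert i I - {a}. g a b) = g i a + (\<Sum>b\<in>I - {a}. g a b)" if "a \<in> I" for a
  proof -
    have "insert i I - {a} = insert i (I - {a})" using that assms(2) by auto
    then show ?thesis using assms(1,2) sym[of a i] by simp
  qed
  then have "(\<Sum>a\<in>I. \<Sum>b\<in>insert i I - {a}. g a b) = (\<Sum>a\<in>I. g i a) + (\<Sum>a\<in>I. \<Sum>b\<in>I - {a}. g a b)"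
    by (simp add: sum.distrib)
  then show ?thesis using assms(1,2) by (simp add: insert_Diff_if)
qed

theorem janson:
  fixes p :: "'a \<Rightarrow> real"
  assumes "finite \<Omega>" "\<forall>x\<in>\<Omega>. 0 \<le> p x \<and> p x \<le> 1" "finite I" "\<forall>j\<in>I. B j \<subseteq> \<Omega>"
  shows "\<P>(R in random_subset \<Omega> p. \<forall>j\<in>I. \<not> B j \<subseteq> R)
    \<le> exp (- (\<Sum>i\<in>I. \<Prod>x\<in>B i. p x)
      + (\<Sum>i\<in>I. \<Sum>j\<in>I - {i}. if B i \<inter> B j \<noteq> {} then \<Prod>x\<in>B i \<union> B j. p x else 0) / 2)"
  using assms(3,4)
proof (induction I rule: finite_induct)
  case empty
  then show ?case by simp
next
  case (insert i I)
  let ?g = "\<lambda>i j. if B i \<inter> B j \<noteq> {} then \<Prod>x\<in>B i \<union> B j. p x else 0"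
  have g: "(\<Sum>j | j \<in> I \<and> B i \<inter> B j \<noteq> {}. \<Prod>x\<in>B i \<union> B j. p x) = (\<Sum>j\<in>I. ?g i j)"
    using insert(1) by (subst sum.inter_filter) auto
  have pairs: "(\<Sum>a\<in>insert i I. \<Sum>j\<in>insert i I - {a}. ?g a j)
      = (\<Sum>a\<in>I. \<Sum>j\<in>I - {a}. ?g a j) + 2 * (\<Sum>j\<in>I. ?g i j)"
    by (rule sum_pairs_insert[OF insert(1,2)]) (simp add: Un_commute Int_commute)
  have "\<P>(R in random_subset \<Omega> p. \<forall>j\<in>insert i I. \<not> B j \<subseteq> R)
      \<le> exp (- (\<Prod>x\<in>B i. p x) + (\<Sum>j\<in>I. ?g i j)) * \<P>(R in random_subset \<Omega> p. \<forall>j\<in>I. \<not> B j \<subseteq> R)"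
    using janson_step[OF assms(1,2) insert(1,4)] unfolding g .
  also have "\<dots> \<le> exp (- (\<Prod>x\<in>B i. p x) + (\<Sum>j\<in>I. ?g i j))
      * exp (- (\<Sum>i\<in>I. \<Prod>x\<in>B i. p x) + (\<Sum>i\<in>I. \<Sum>j\<in>I - {i}. ?g i j) / 2)"
    using insert by (intro mult_left_mono) auto
  finally show ?case
    unfolding exp_add[symmetric] pairs using insert(1,2) by (simp add: algebra_simps add_divide_distrib)
qed

lemma ex_ge_expectation:
  fixes f :: "'a \<Rightarrow> real"
  assumes "finite (set_pmf M)"
  shows "\<exists>x\<in>set_pmf M. measure_pmf.expectation M f \<le> f x"
proof (rule ccontr)
  assume "\<not> ?thesis"
  then have "measure_pmf.expectation M f < measure_pmf.expectation M f"
    using assms by (intro measure_pmf.expectation_less integrable_measure_pmf_finite)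
      (auto simp: AE_measure_pmf_iff not_le)
  then show False by simp
qed

lemma ex_subset_ge_thinned:
  fixes q a :: "'i \<Rightarrow> real" and g :: "'i \<Rightarrow> 'i \<Rightarrow> real"
  assumes I: "finite I" and q: "\<forall>i\<in>I. 0 \<le> q i \<and> q i \<le> 1"
  shows "\<exists>I'\<subseteq>I. (\<Sum>i\<in>I. q i * a i) - (\<Sum>i\<in>I. \<Sum>j\<in>I - {i}. q i * q j * g i j) / 2
    \<le> (\<Sum>i\<in>I'. a i) - (\<Sum>i\<in>I'. \<Sum>j\<in>I' - {i}. g i j) / 2"
proof -
  let ?M = "random_subset I q"
  let ?f = "\<lambda>I'. (\<Sum>i\<in>I'. a i) - (\<Sum>i\<in>I'. \<Sum>j\<in>I' - {i}. g i j) / 2"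
  have fin: "finite (set_pmf ?M)" using I by (rule finite_set_random_subset)
  have "measure_pmf.expectation ?M ?f
      = (\<Sum>i\<in>I. q i * a i) - (\<Sum>i\<in>I. \<Sum>j\<in>I - {i}. q i * q j * g i j) / 2"
    using fin expectation_sum_random_subset[OF I q, of a] expectation_sum_pairs_random_subset[OF I q, of g]
    by (simp add: integrable_measure_pmf_finite)
  then show ?thesis
    using ex_ge_expectation[OF fin, of ?f] by (auto dest!: random_subset_subset)
qed

lemma janson_thinned:
  fixes p :: real
  assumes \<Omega>: "finite \<Omega>" and p: "0 \<le> p" "p \<le> 1" and I: "finite I" and B: "\<forall>j\<in>I. B j \<subseteq> \<Omega>"
    and q: "\<forall>i\<in>I. 0 \<le> q i \<and> q i \<le> 1"
    and correlation: "\<And>i. i \<in> I \<Longrightarrow>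
      (\<Sum>j\<in>I - {i}. if B i \<inter> B j \<noteq> {} then q j * p ^ card (B j - B i) else 0) \<le> 2 * c"
  shows "\<P>(R in random_subset \<Omega> (\<lambda>_. p). \<forall>j\<in>I. \<not> B j \<subseteq> R)
    \<le> exp (- ((1 - c) * (\<Sum>i\<in>I. q i * p ^ card (B i))))"
proof -
  let ?g = "\<lambda>i j. if B i \<inter> B j \<noteq> {} then p ^ card (B i \<union> B j) else 0"
  let ?\<mu> = "\<lambda>I'. \<Sum>i\<in>I'. p ^ card (B i)" and ?\<Delta> = "\<lambda>I'. \<Sum>i\<in>I'. \<Sum>j\<in>I' - {i}. ?g i j"
  let ?S = "\<Sum>i\<in>I. q i * p ^ card (B i)"
  have "(\<Sum>j\<in>I - {i}. q i * q j * ?g i j) \<le> 2 * c * (q i * p ^ card (B i))" if i: "i \<in> I" for i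
  proof -
    have "q i * q j * ?g i j
        = q i * p ^ card (B i) * (if B i \<inter> B j \<noteq> {} then q j * p ^ card (B j - B i) else 0)"
      if "j \<in> I - {i}" for j
    proof -
      have "finite (B i)" "finite (B j)" using \<Omega> B that i by (meson Diff_iff finite_subset)+
      then have "card (B i \<union> B j) = card (B i) + card (B j - B i)"
        by (subst card_Un_disjoint[symmetric]) auto
      then show ?thesis by (simp add: power_add)
    qed
    then have "(\<Sum>j\<in>I - {i}. q i * q j * ?g i j) = q i * p ^ card (B i)
        * (\<Sum>j\<in>I - {i}. if B i \<inter> B j \<noteq> {} then q j * p ^ card (B j - B i) else 0)"
      unfolding sum_distrib_left by (intro sum.cong) auto
    also have "\<dots> \<le> q i * p ^ card (B i) * (2 * c)"
      using correlation[OF i] q i p by (intro mult_left_mono) auto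
    finally show ?thesis by (simp add: algebra_simps)
  qed
  then have "(\<Sum>i\<in>I. \<Sum>j\<in>I - {i}. q i * q j * ?g i j) \<le> 2 * c * ?S"
    unfolding sum_distrib_left by (intro sum_mono) auto
  then obtain I' where I': "I' \<subseteq> I" "(1 - c) * ?S \<le> ?\<mu> I' - ?\<Delta> I' / 2"
    using ex_subset_ge_thinned[OF I q, of "\<lambda>i. p ^ card (B i)" ?g] by (auto simp: algebra_simps)
  have "\<P>(R in random_subset \<Omega> (\<lambda>_. p). \<forall>j\<in>I. \<not> B j \<subseteq> R)
      \<le> \<P>(R in random_subset \<Omega> (\<lambda>_. p). \<forall>j\<in>I'. \<not> B j \<subseteq> R)"
    using I' by (intro prob_random_subset_mono) auto
  also have "\<dots> \<le> exp (- ?\<mu> I' + ?\<Delta> I' / 2)"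
    using janson[of \<Omega> "\<lambda>_. p" I' B] \<Omega> p B I'(1) finite_subset[OF I'(1) I]
    by (simp only: prod_constant) blast
  also have "\<dots> \<le> exp (- ((1 - c) * ?S))" unfolding exp_le_cancel_iff using I'(2) by linarith
  finally show ?thesis .
qed

lemma card_supersets_le:
  assumes "finite \<Omega>" "F \<subseteq> \<Omega>"
  shows "card {R. F \<subseteq> R \<and> R \<subseteq> \<Omega> \<and> card R = M} \<le> (card \<Omega> - card F) choose (M - card F)"
proof -
  have F: "finite F" using assms finite_subset by auto
  have "card {R. F \<subseteq> R \<and> R \<subseteq> \<Omega> \<and> card R = M} \<le> card {R. R \<subseteq> \<Omega> - F \<and> card R = M - card F}"
    using F assms(1) by (intro card_inj_on_le[where f = "\<lambda>R. R - F"]) (auto simp: inj_on_def card_Diff_subset)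
  also have "\<dots> = (card \<Omega> - card F) choose (M - card F)"
    using assms F by (simp add: n_subsets card_Diff_subset)
  finally show ?thesis .
qed

lemma local_LYM:
  assumes \<Omega>: "finite \<Omega>" and Q: "antimono Q" and sM: "s \<le> M" "M \<le> card \<Omega>"
  shows "card {R. R \<subseteq> \<Omega> \<and> card R = M \<and> Q R} * (card \<Omega> choose s)
    \<le> card {R. R \<subseteq> \<Omega> \<and> card R = s \<and> Q R} * (card \<Omega> choose M)"
proof -
  let ?\<A> = "\<lambda>k. {R. R \<subseteq> \<Omega> \<and> card R = k \<and> Q R}"
  let ?up = "(card \<Omega> - s) choose (M - s)"
  have fin: "finite (?\<A> k)" for k using \<Omega> by auto
  have "card (?\<A> M) * (M choose s) = (\<Sum>R\<in>?\<A> M. card {R'. R' \<subseteq> R \<and> card R' = s})"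
    using n_subsets[OF finite_subset[OF _ \<Omega>]] by simp
  also have "\<dots> = card (SIGMA R:?\<A> M. {R'. R' \<subseteq> R \<and> card R' = s})"
    using fin finite_subset[OF _ \<Omega>] by (subst card_SigmaI) auto
  also have "\<dots> \<le> card (SIGMA R':?\<A> s. {R. R' \<subseteq> R \<and> R \<subseteq> \<Omega> \<and> card R = M})"
  proof (rule card_inj_on_le[where f = prod.swap])
    show "prod.swap ` (SIGMA R:?\<A> M. {R'. R' \<subseteq> R \<and> card R' = s})
        \<subseteq> (SIGMA R':?\<A> s. {R. R' \<subseteq> R \<and> R \<subseteq> \<Omega> \<and> card R = M})"
      using antimonoD[OF Q] by fastforce
    show "finite (SIGMA R':?\<A> s. {R. R' \<subseteq> R \<and> R \<subseteq> \<Omega> \<and> card R = M})"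
      using fin \<Omega> by (intro finite_SigmaI) auto
  qed auto
  also have "\<dots> = (\<Sum>R'\<in>?\<A> s. card {R. R' \<subseteq> R \<and> R \<subseteq> \<Omega> \<and> card R = M})"
    using fin \<Omega> by (subst card_SigmaI) auto
  also have "\<dots> \<le> (\<Sum>R'\<in>?\<A> s. ?up)"
    using card_supersets_le[OF \<Omega>] by (intro sum_mono) fastforce
  finally have count: "card (?\<A> M) * (M choose s) \<le> card (?\<A> s) * ?up" by simp
  have "card (?\<A> M) * (card \<Omega> choose s) * ?up = (card (?\<A> M) * (M choose s)) * (card \<Omega> choose M)"
    using choose_mult[OF sM] by (simp add: algebra_simps)
  also have "\<dots> \<le> card (?\<A> s) * (card \<Omega> choose M) * ?up"
    using mult_right_mono[OF count, of "card \<Omega> choose M"] by (simp add: algebra_simps)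
  finally show ?thesis using sM by simp
qed

lemma pmf_random_subset_const:
  assumes "finite \<Omega>" "0 \<le> p" "p \<le> 1" "R \<subseteq> \<Omega>"
  shows "pmf (random_subset \<Omega> (\<lambda>_. p)) R = p ^ card R * (1 - p) ^ (card \<Omega> - card R)"
proof -
  let ?Pi = "Pi_pmf \<Omega> False (\<lambda>_. bernoulli_pmf p)"
  have "pmf (random_subset \<Omega> (\<lambda>_. p)) R = measure_pmf.prob ?Pi {f. {x\<in>\<Omega>. f x} = R}"
    by (simp add: random_subset_def pmf_map vimage_def)
  also have "\<dots> = measure_pmf.prob ?Pi {\<lambda>x. x \<in> R}"
    using assms(1,4) set_Pi_pmf_subset[OF assms(1), of False "\<lambda>_. bernoulli_pmf p"]
    by (intro measure_pmf.finite_measure_eq_AE) (auto simp: AE_measure_pmf_iff fun_eq_iff)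
  also have "\<dots> = (\<Prod>x\<in>\<Omega>. if x \<in> R then p else 1 - p)"
    using assms by (subst measure_pmf_single, subst pmf_Pi') (auto intro!: prod.cong)
  also have "\<dots> = p ^ card R * (1 - p) ^ (card \<Omega> - card R)"
    using assms by (simp add: prod.If_cases Int_absorb1 Collect_neg_eq[symmetric] Diff_eq[symmetric]
        card_Diff_subset finite_subset)
  finally show ?thesis .
qed

lemma prob_random_subset_by_card:
  assumes \<Omega>: "finite \<Omega>" and p: "0 \<le> p" "p \<le> 1"
  shows "\<P>(R in random_subset \<Omega> (\<lambda>_. p). Q R)
    = (\<Sum>s\<le>card \<Omega>. p ^ s * (1 - p) ^ (card \<Omega> - s) * card {R. R \<subseteq> \<Omega> \<and> card R = s \<and> Q R})"
proof -
  let ?\<A> = "{R\<in>Pow \<Omega>. Q R}" and ?w = "\<lambda>s. p ^ s * (1 - p) ^ (card \<Omega> - s)"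
  have "\<P>(R in random_subset \<Omega> (\<lambda>_. p). Q R) = measure_pmf.prob (random_subset \<Omega> (\<lambda>_. p)) ?\<A>"
    by (intro measure_pmf.finite_measure_eq_AE) (auto simp: AE_measure_pmf_iff dest: random_subset_subset)
  also have "\<dots> = (\<Sum>R\<in>?\<A>. ?w (card R))"
    using \<Omega> by (subst measure_measure_pmf_finite) (auto intro!: sum.cong pmf_random_subset_const p)
  also have "\<dots> = (\<Sum>s\<le>card \<Omega>. \<Sum>R\<in>{R\<in>?\<A>. card R = s}. ?w (card R))"
    using \<Omega> by (intro sum.group[symmetric]) (auto intro: card_mono)
  also have "\<dots> = (\<Sum>s\<le>card \<Omega>. ?w s * card {R. R \<subseteq> \<Omega> \<and> card R = s \<and> Q R})"
    by (intro sum.cong) (auto intro!: arg_cong[of _ _ card])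
  finally show ?thesis .
qed

lemma prob_card_random_subset_ge:
  assumes \<Omega>: "finite \<Omega>" and p: "0 \<le> p" "p \<le> 1"
    and mean: "real (card \<Omega>) * p \<le> (1 - \<eta>) * real M" and \<eta>: "\<eta> \<le> 1"
  shows "\<eta> \<le> \<P>(R in random_subset \<Omega> (\<lambda>_. p). card R \<le> M)"
proof -
  let ?M = "random_subset \<Omega> (\<lambda>_. p)"
  have "\<P>(R in ?M. real M + 1 \<le> real (card R)) \<le> measure_pmf.expectation ?M (\<lambda>R. real (card R)) / (real M + 1)"
    using finite_set_random_subset[OF \<Omega>]
    by (intro integral_Markov_inequality_measure[where A = UNIV, simplified])
      (auto intro: integrable_measure_pmf_finite)
  also have "measure_pmf.expectation ?M (\<lambda>R. real (card R)) = real (card \<Omega>) * p"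
    using expectation_sum_random_subset[OF \<Omega>, of "\<lambda>_. p" "\<lambda>_. 1"] p by simp
  also have "real (card \<Omega>) * p / (real M + 1) \<le> 1 - \<eta>"
  proof -
    have "(1 - \<eta>) * real M \<le> (1 - \<eta>) * (real M + 1)" using \<eta> by (intro mult_left_mono) auto
    then have "real (card \<Omega>) * p \<le> (1 - \<eta>) * (real M + 1)" using mean by (rule order_trans[rotated])
    then show ?thesis by (simp add: pos_divide_le_eq)
  qed
  finally have "\<P>(R in ?M. real M + 1 \<le> real (card R)) \<le> 1 - \<eta>" .
  moreover have "real M + 1 \<le> real c \<longleftrightarrow> \<not> c \<le> M" for c by linarith
  ultimately have "\<P>(R in ?M. \<not> card R \<le> M) \<le> 1 - \<eta>" by simp
  then show ?thesis using measure_pmf.prob_neg[of ?M "\<lambda>R. card R \<le> M"] by simp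
qed

lemma uniform_le_random_subset:
  assumes \<Omega>: "finite \<Omega>" and p: "0 \<le> p" "p \<le> 1" and Q: "antimono Q"
    and mean: "real (card \<Omega>) * p \<le> (1 - \<eta>) * real M" and \<eta>: "\<eta> \<le> 1"
  shows "\<eta> * real (card {R. R \<subseteq> \<Omega> \<and> card R = M \<and> Q R})
    \<le> real (card \<Omega> choose M) * \<P>(R in random_subset \<Omega> (\<lambda>_. p). Q R)"
proof (cases "M \<le> card \<Omega>")
  case False
  then have "{R. R \<subseteq> \<Omega> \<and> card R = M \<and> Q R} = {}" using \<Omega> by (auto dest: card_mono[rotated])
  then show ?thesis using False by (simp add: binomial_eq_0 del: Collect_empty_eq)
next
  case True
  let ?N = "card \<Omega>" and ?w = "\<lambda>s. p ^ s * (1 - p) ^ (card \<Omega> - s)"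
  let ?count = "\<lambda>Q s. real (card {R. R \<subseteq> \<Omega> \<and> card R = s \<and> Q R})"
  have "\<eta> * ?count Q M \<le> ?count Q M * \<P>(R in random_subset \<Omega> (\<lambda>_. p). card R \<le> M)"
    using prob_card_random_subset_ge[OF \<Omega> p mean \<eta>] by (simp add: mult.commute mult_right_mono)
  also have "\<dots> = (\<Sum>s\<le>?N. ?w s * (?count Q M * ?count (\<lambda>R. card R \<le> M) s))"
    unfolding prob_random_subset_by_card[OF \<Omega> p] sum_distrib_left by (intro sum.cong) auto
  also have "\<dots> \<le> (\<Sum>s\<le>?N. ?w s * (?count Q s * real (?N choose M)))"
  proof (intro sum_mono mult_left_mono)
    fix s
    show "?count Q M * ?count (\<lambda>R. card R \<le> M) s \<le> ?count Q s * real (?N choose M)"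
    proof (cases "s \<le> M")
      case s: True
      then have "{R. R \<subseteq> \<Omega> \<and> card R = s \<and> card R \<le> M} = {R. R \<subseteq> \<Omega> \<and> card R = s}" by auto
      then have "?count (\<lambda>R. card R \<le> M) s = real (?N choose s)" by (simp only: n_subsets[OF \<Omega>])
      then show ?thesis
        using local_LYM[OF \<Omega> Q s True] by (simp only: of_nat_mult[symmetric] of_nat_le_iff)
    next
      case False
      then have "{R. R \<subseteq> \<Omega> \<and> card R = s \<and> card R \<le> M} = {}" by auto
      then show ?thesis by (simp only: card.empty) simp
    qed
  qed (use p in simp)
  also have "\<dots> = real (?N choose M) * \<P>(R in random_subset \<Omega> (\<lambda>_. p). Q R)"
    unfolding prob_random_subset_by_card[OF \<Omega> p] sum_distrib_left by (intro sum.cong) auto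
  finally show ?thesis .
qed

section \<open>Transversals and crossing pairs\<close>

definition transversals :: "'i set \<Rightarrow> ('i \<Rightarrow> 'a set) \<Rightarrow> 'a set set" where
  "transversals I W = {S. S \<subseteq> (\<Union>i\<in>I. W i) \<and> (\<forall>i\<in>I. card (S \<inter> W i) = 1)}"

lemma transversals_empty: "transversals {} W = {{}}"
  by (auto simp: transversals_def)

lemma transversals_cong: "(\<And>i. i \<in> I \<Longrightarrow> W i = W' i) \<Longrightarrow> transversals I W = transversals I W'"
  by (auto simp: transversals_def)

lemma disjoint_family_on_subset:
  assumes "disjoint_family_on W' I" "\<And>i. i \<in> I \<Longrightarrow> W i \<subseteq> W' i"
  shows "disjoint_family_on W I"
  unfolding disjoint_family_on_def
proof (intro ballI impI)
  fix i j assume ij: "i \<in> I" "j \<in> I" "i \<noteq> j"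
  have "W i \<inter> W j \<subseteq> W' i \<inter> W' j" using assms(2) ij by blast
  then show "W i \<inter> W j = {}" using assms(1) ij unfolding disjoint_family_on_def by blast
qed

lemma transversals_mono:
  assumes dis: "disjoint_family_on W' I" and sub: "\<And>i. i \<in> I \<Longrightarrow> W i \<subseteq> W' i"
  shows "transversals I W \<subseteq> transversals I W'"
proof
  fix S assume S: "S \<in> transversals I W"
  have "S \<inter> W' i = S \<inter> W i" if i: "i \<in> I" for i
  proof -
    have "x \<in> W i" if x: "x \<in> S" "x \<in> W' i" for x
    proof -
      obtain j where j: "j \<in> I" "x \<in> W j" using S x by (auto simp: transversals_def)
      then have "x \<in> W' j \<inter> W' i" using sub x by auto
      then have "j = i" using dis i j(1) unfolding disjoint_family_on_def by (metis empty_iff)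
      then show ?thesis using j by simp
    qed
    then show ?thesis using sub[OF i] by blast
  qed
  moreover have "S \<subseteq> (\<Union>i\<in>I. W' i)" using S sub unfolding transversals_def by blast
  ultimately show "S \<in> transversals I W'" using S by (simp add: transversals_def)
qed

lemma transversals_insert:
  assumes dis: "\<forall>i\<in>I. W a \<inter> W i = {}"
  shows "transversals (insert a I) W = (\<lambda>(u, S). insert u S) ` (W a \<times> transversals I W)"
proof (intro equalityI subsetI)
  fix S assume S: "S \<in> transversals (insert a I) W"
  define S' where "S' = S \<inter> (\<Union>i\<in>I. W i)"
  obtain u where u: "S \<inter> W a = {u}" using S by (auto simp: transversals_def card_1_singleton_iff)
  have "S' \<inter> W i = S \<inter> W i" if "i \<in> I" for i using that unfolding S'_def by blast
  then have "S' \<in> transversals I W" using S by (auto simp: transversals_def S'_def)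
  moreover have "S = insert u S'" using u S by (auto simp: transversals_def S'_def)
  ultimately show "S \<in> (\<lambda>(u, S). insert u S) ` (W a \<times> transversals I W)" using u by auto
next
  fix S assume "S \<in> (\<lambda>(u, S). insert u S) ` (W a \<times> transversals I W)"
  then obtain u S' where S: "S = insert u S'" "u \<in> W a" "S' \<in> transversals I W" by auto
  have sub: "S' \<subseteq> (\<Union>i\<in>I. W i)" using S(3) by (auto simp: transversals_def)
  have "S \<inter> W a = {u}" using S sub dis by blast
  moreover have "S \<inter> W i = S' \<inter> W i" if "i \<in> I" for i using S dis that by blast
  moreover have "\<forall>i\<in>I. card (S' \<inter> W i) = 1" using S(3) by (simp add: transversals_def)
  moreover have "S \<subseteq> (\<Union>i\<in>insert a I. W i)" using S sub by blast
  ultimately show "S \<in> transversals (insert a I) W"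
    unfolding transversals_def by simp
qed

lemma inj_on_insert_transversals:
  assumes "\<forall>i\<in>I. W a \<inter> W i = {}"
  shows "inj_on (\<lambda>(u, S). insert u S) (W a \<times> transversals I W)"
proof (intro inj_onI, clarify)
  fix u S v S'
  assume uS: "u \<in> W a" "S \<in> transversals I W" and vS': "v \<in> W a" "S' \<in> transversals I W"
    and eq: "insert u S = insert v S'"
  have notin: "u \<notin> S" "v \<notin> S" "u \<notin> S'" "v \<notin> S'"
    using uS vS' assms unfolding transversals_def by blast+
  then have "u = v" using eq by blast
  then show "u = v \<and> S = S'" using eq notin by (metis insert_ident)
qed

lemma transversals_count:
  assumes "finite I" "disjoint_family_on W I" "\<forall>i\<in>I. finite (W i)"
  shows finite_transversals: "finite (transversals I W)"
    and card_transversals: "card (transversals I W) = (\<Prod>i\<in>I. card (W i))"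
proof -
  have "finite (transversals I W) \<and> card (transversals I W) = (\<Prod>i\<in>I. card (W i))"
    using assms
  proof (induction I rule: finite_induct)
    case empty
    then show ?case by (simp add: transversals_empty)
  next
    case (insert a I)
    have dis: "\<forall>i\<in>I. W a \<inter> W i = {}" using insert by (auto simp: disjoint_family_on_def)
    have "finite (transversals I W)" "card (transversals I W) = (\<Prod>i\<in>I. card (W i))"
      using insert by (auto simp: disjoint_family_on_def)
    then show ?case
      unfolding transversals_insert[OF dis] card_image[OF inj_on_insert_transversals[OF dis]]
      using insert by (simp add: card_cartesian_product)
  qed
  then show "finite (transversals I W)" "card (transversals I W) = (\<Prod>i\<in>I. card (W i))" by auto
qed

lemma transversal_finite_card:
  assumes I: "finite I" and dis: "disjoint_family_on W I" and S: "S \<in> transversals I W"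
  shows "finite S" and card_transversal: "card S = card I"
proof -
  have S_eq: "S = (\<Union>i\<in>I. S \<inter> W i)" and single: "\<forall>i\<in>I. card (S \<inter> W i) = 1"
    using S by (auto simp: transversals_def)
  then have fin: "\<forall>i\<in>I. finite (S \<inter> W i)" by (metis card_eq_0_iff zero_neq_one)
  then show "finite S" using I by (subst S_eq, intro finite_UN_I) auto
  have "card (\<Union>i\<in>I. S \<inter> W i) = (\<Sum>i\<in>I. card (S \<inter> W i))"
    by (rule card_UN_disjoint) (use I dis fin in \<open>auto simp: disjoint_family_on_def\<close>)
  then show "card S = card I" using single S_eq by simp
qed

lemma transversal_Int_eq:
  assumes "S \<in> transversals I W" "J \<subseteq> S" "i \<in> I" "W i \<inter> J \<noteq> {}"
  shows "S \<inter> W i = W i \<inter> J" "card (W i \<inter> J) = 1"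
proof -
  have "card (S \<inter> W i) = 1" "W i \<inter> J \<subseteq> S \<inter> W i" using assms by (auto simp: transversals_def)
  then show "S \<inter> W i = W i \<inter> J" "card (W i \<inter> J) = 1"
    using assms(4) by (metis card_1_singletonE subset_singleton_iff)+
qed

lemma card_subset_transversal:
  assumes "finite I" "disjoint_family_on W I" "S \<in> transversals I W" "J \<subseteq> S"
  shows "card J = card {i\<in>I. W i \<inter> J \<noteq> {}}"
proof (rule card_transversal[OF _ disjoint_family_on_mono[OF _ assms(2)]])
  have "card (J \<inter> W i) = 1" if "i \<in> I" "W i \<inter> J \<noteq> {}" for i
    using transversal_Int_eq(2)[OF assms(3,4) that] by (simp add: Int_commute)
  moreover have "J \<subseteq> (\<Union>i\<in>{i\<in>I. W i \<inter> J \<noteq> {}}. W i)" using assms(3,4) unfolding transversals_def by blast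
  ultimately show "J \<in> transversals {i\<in>I. W i \<inter> J \<noteq> {}} W" by (simp add: transversals_def)
qed (use assms(1) in auto)

lemma transversals_containing_subset:
  "{S \<in> transversals I W. J \<subseteq> S} \<subseteq> transversals I (\<lambda>i. if W i \<inter> J = {} then W i else W i \<inter> J)"
  (is "_ \<subseteq> transversals I ?W'")
proof clarify
  fix S assume S: "S \<in> transversals I W" "J \<subseteq> S"
  have same: "S \<inter> ?W' i = S \<inter> W i" if "i \<in> I" for i
    using transversal_Int_eq(1)[OF S that] S(2) by (cases "W i \<inter> J = {}") (simp_all add: Int_absorb1 le_infI2)
  have "x \<in> (\<Union>i\<in>I. ?W' i)" if "x \<in> S" for x
  proof -
    obtain i where "i \<in> I" "x \<in> S \<inter> W i" using S(1) \<open>x \<in> S\<close> unfolding transversals_def by blast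
    then show ?thesis using same by blast
  qed
  then show "S \<in> transversals I ?W'" using S(1) same by (simp add: transversals_def subset_iff)
qed

lemma card_transversals_containing:
  assumes I: "finite I" and dis: "disjoint_family_on W I" and fin: "\<forall>i\<in>I. finite (W i)"
    and l: "\<forall>i\<in>I. l \<le> real (card (W i))" "0 \<le> l"
  shows "real (card {S \<in> transversals I W. J \<subseteq> S}) * l ^ card J \<le> (\<Prod>i\<in>I. real (card (W i)))"
proof (cases "{S \<in> transversals I W. J \<subseteq> S} = {}")
  case True
  then show ?thesis by (simp only: card.empty) (simp add: prod_nonneg)
next
  case False
  then obtain S where S: "S \<in> transversals I W" "J \<subseteq> S" by auto
  define W' where "W' i = (if W i \<inter> J = {} then W i else W i \<inter> J)" for i
  have dis': "disjoint_family_on W' I"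
    by (rule disjoint_family_on_subset[OF dis]) (simp add: W'_def)
  have fin': "\<forall>i\<in>I. finite (W' i)" using fin by (simp add: W'_def)
  have "real (card {S \<in> transversals I W. J \<subseteq> S}) \<le> (\<Prod>i\<in>I. real (card (W' i)))"
    using card_mono[OF finite_transversals[OF I dis' fin'] transversals_containing_subset[of I W J, folded W'_def]]
      card_transversals[OF I dis' fin'] by (simp flip: of_nat_prod)
  then have "real (card {S \<in> transversals I W. J \<subseteq> S}) * l ^ card J
      \<le> (\<Prod>i\<in>I. real (card (W' i))) * (\<Prod>i\<in>I. if W i \<inter> J \<noteq> {} then l else 1)"
    using l(2) I card_subset_transversal[OF I dis S]
    by (simp add: prod.If_cases Int_def conj_commute mult_right_mono)
  also have "\<dots> = (\<Prod>i\<in>I. real (card (W' i)) * (if W i \<inter> J \<noteq> {} then l else 1))"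
    by (rule prod.distrib[symmetric])
  also have "\<dots> \<le> (\<Prod>i\<in>I. real (card (W i)))"
    using l transversal_Int_eq(2)[OF S] by (intro prod_mono) (simp add: W'_def)
  finally show ?thesis .
qed

lemma ex_transversal_avoiding_pairs:
  assumes I: "finite I" and dis: "disjoint_family_on W I" and fin: "\<forall>i\<in>I. finite (W i)"
    and l: "\<forall>i\<in>I. l \<le> real (card (W i))" "0 < l" and Q: "finite Q" "\<forall>f\<in>Q. card f = 2"
    and few: "real (card Q) < l ^ 2"
  shows "\<exists>S\<in>transversals I W. \<forall>f\<in>Q. \<not> f \<subseteq> S"
proof (rule ccontr)
  assume "\<not> ?thesis"
  then have sub: "transversals I W \<subseteq> (\<Union>f\<in>Q. {S \<in> transversals I W. f \<subseteq> S})" by auto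
  let ?total = "\<Prod>i\<in>I. real (card (W i))"
  have total: "?total = real (card (transversals I W))" using card_transversals[OF I dis fin] by simp
  have "0 < ?total" using l by (intro prod_pos) force
  have "card (transversals I W) \<le> card (\<Union>f\<in>Q. {S \<in> transversals I W. f \<subseteq> S})"
    using finite_transversals[OF I dis fin] Q by (intro card_mono[OF _ sub]) auto
  also have "\<dots> \<le> (\<Sum>f\<in>Q. card {S \<in> transversals I W. f \<subseteq> S})" using Q by (intro card_UN_le)
  finally have "?total * l ^ 2 \<le> (\<Sum>f\<in>Q. real (card {S \<in> transversals I W. f \<subseteq> S}) * l ^ 2)"
    unfolding total sum_distrib_right[symmetric] of_nat_sum[symmetric]
    by (intro mult_right_mono of_nat_mono) auto
  also have "\<dots> \<le> (\<Sum>f\<in>Q. ?total)"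
    using card_transversals_containing[OF I dis fin l(1)] l Q by (intro sum_mono) (metis less_imp_le)
  also have "\<dots> = real (card Q) * ?total" by simp
  also have "\<dots> < l ^ 2 * ?total" using few \<open>0 < ?total\<close> by simp
  finally show False by (simp add: mult.commute)
qed

definition cross_pairs :: "'a set set \<Rightarrow> 'a set \<Rightarrow> 'a set set" where
  "cross_pairs P A = {f \<in> nsets A 2. \<forall>V\<in>P. \<not> f \<subseteq> V}"

lemma partition_graph_eq: "partition_graph P = cross_pairs P (\<Union>P)"
  by (auto simp: partition_graph_def cross_pairs_def nsets_def card_ge_0_finite)

lemma cross_pairs_Int: "cross_pairs P A \<inter> cross_pairs P B = cross_pairs P (A \<inter> B)"
  by (auto simp: cross_pairs_def nsets_def)

lemma cross_pairs_mono: "A \<subseteq> B \<Longrightarrow> cross_pairs P A \<subseteq> cross_pairs P B"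
  by (auto simp: cross_pairs_def nsets_def)

lemma finite_cross_pairs: "finite A \<Longrightarrow> finite (cross_pairs P A)"
  by (simp add: cross_pairs_def finite_imp_finite_nsets)

lemma card_cross_pairs_le: "finite A \<Longrightarrow> card (cross_pairs P A) \<le> card A choose 2"
  using card_mono[of "nsets A 2" "cross_pairs P A"] by (simp add: cross_pairs_def finite_imp_finite_nsets)

lemma card_le_1_of_subset_transversal:
  assumes "S \<in> transversals I W" "i \<in> I" "f \<subseteq> S" "f \<subseteq> W i"
  shows "card f \<le> 1"
proof -
  have "card (S \<inter> W i) = 1" using assms by (auto simp: transversals_def)
  then show ?thesis using assms(3,4) card_mono[of "S \<inter> W i" f]
    by (metis Int_subset_iff card.infinite zero_neq_one)
qed

locale multipartite =
  fixes P :: "'a set set" and r :: nat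
  assumes finite_P: "finite P" and disjoint_P: "disjoint P" and card_P: "card P = r"
    and finite_part: "V \<in> P \<Longrightarrow> finite V" and parts_ge_2: "2 \<le> r"
begin

lemma disjoint_parts: "I \<subseteq> P \<Longrightarrow> disjoint_family_on (\<lambda>V. V) I"
  using disjoint_P by (auto simp: disjoint_def disjoint_family_on_def)

lemma same_part: "V \<in> P \<Longrightarrow> W \<in> P \<Longrightarrow> x \<in> V \<Longrightarrow> x \<in> W \<Longrightarrow> V = W"
  using disjoint_P unfolding disjoint_def by blast

lemma finite_cross_edges: "finite (cross_pairs P (\<Union>P))"
  using finite_P finite_part by (intro finite_cross_pairs) auto

lemma cross_pairs_transversal:
  assumes "S \<in> transversals P (\<lambda>V. V)" "J \<subseteq> S"
  shows "cross_pairs P J = nsets J 2"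
proof -
  have "\<not> f \<subseteq> V" if "f \<in> nsets J 2" "V \<in> P" for f V
    using card_le_1_of_subset_transversal[OF assms(1) that(2), of f] assms(2) that(1)
    by (auto simp: nsets_def)
  then show ?thesis by (auto simp: cross_pairs_def)
qed

lemma disjoint_transversal_part:
  assumes "V \<in> P" "S \<in> transversals (P - {V}) (\<lambda>V. V)"
  shows "S \<inter> V = {}"
proof -
  have "\<Union>(P - {V}) \<inter> V = {}" using disjoint_P assms(1) unfolding disjoint_def by blast
  then show ?thesis using assms(2) unfolding transversals_def by blast
qed

lemma cross_pairs_extended_transversal:
  assumes V: "V \<in> P" "e \<in> nsets V 2" and S: "S \<in> transversals (P - {V}) (\<lambda>V. V)" and J: "J \<subseteq> e \<union> S"
  shows "cross_pairs P J = nsets J 2 - {e}"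
proof -
  have e: "e \<subseteq> V" "card e = 2" "finite e" using V(2) by (auto simp: nsets_def)
  note SV = disjoint_transversal_part[OF V(1) S]
  have "f = e" if f: "f \<subseteq> J" "card f = 2" "W \<in> P" "f \<subseteq> W" for f W
  proof (cases "W = V")
    case True
    then have "f \<subseteq> e" using f J SV by blast
    then show ?thesis using f e by (simp add: card_subset_eq)
  next
    case False
    then have "W \<inter> V = {}" using f V disjoint_P by (simp add: disjoint_def)
    then have "f \<subseteq> S" using f J e by blast
    then show ?thesis using card_le_1_of_subset_transversal[OF S, of W f] f False by auto
  qed
  then show ?thesis using V(1) e by (auto simp: cross_pairs_def nsets_def)
qed

lemma card_cross_pairs_extended_transversal:
  assumes "V \<in> P" "e \<in> nsets V 2" "S \<in> transversals (P - {V}) (\<lambda>V. V)" "J \<subseteq> e \<union> S" "finite J" "e \<subseteq> J"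
  shows "card (cross_pairs P J) = (card J choose 2) - 1"
proof -
  have "e \<in> nsets J 2" using assms(2,6) by (auto simp: nsets_def)
  then show ?thesis
    using cross_pairs_extended_transversal[OF assms(1-4)] by (simp add: finite_imp_finite_nsets assms(5))
qed

lemma extended_transversal:
  assumes "V \<in> P" "e \<in> nsets V 2" "S \<in> transversals (P - {V}) (\<lambda>V. V)"
  shows "finite (e \<union> S)" "card (e \<union> S) = Suc r" "e \<union> S \<subseteq> \<Union>P"
proof -
  have e: "finite e" "card e = 2" "e \<subseteq> V" using assms(2) by (auto simp: nsets_def)
  have S: "finite S" "card S = r - 1"
    using transversal_finite_card[OF _ disjoint_parts assms(3)] finite_P card_P assms(1) by auto
  show "finite (e \<union> S)" using e S by simp
  have "e \<inter> S = {}" using disjoint_transversal_part[OF assms(1,3)] e by blast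
  then show "card (e \<union> S) = Suc r" using e S parts_ge_2 by (simp add: card_Un_disjoint)
  show "e \<union> S \<subseteq> \<Union>P" using assms(1,3) e unfolding transversals_def by blast
qed

definition inner_pairs :: "'a set set" where
  "inner_pairs = (\<Union>V\<in>P. nsets V 2)"

definition edge_clique_free :: "'a set set \<Rightarrow> 'a set set \<Rightarrow> bool" where
  "edge_clique_free T R \<longleftrightarrow>
    (\<forall>e\<in>T. \<forall>V\<in>P. e \<subseteq> V \<longrightarrow> (\<forall>S\<in>transversals (P - {V}) (\<lambda>V. V). \<not> cross_pairs P (e \<union> S) \<subseteq> R))"

definition box_clique_free :: "('a set \<Rightarrow> 'a set) \<Rightarrow> 'a set set \<Rightarrow> bool" where
  "box_clique_free W R \<longleftrightarrow> (\<forall>S\<in>transversals P W. \<not> cross_pairs P S \<subseteq> R)"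

lemma antimono_edge_clique_free: "antimono (edge_clique_free T)"
  unfolding edge_clique_free_def by (intro antimonoI) (simp, meson order_trans)

lemma antimono_box_clique_free: "antimono (box_clique_free W)"
  unfolding box_clique_free_def by (intro antimonoI) (simp, meson order_trans)

lemma overlap_le_sum_common_subsets:
  fixes A :: "'i \<Rightarrow> 'a set" and p :: real
  assumes A: "\<And>i. i \<in> I \<Longrightarrow> finite (A i) \<and> card (A i) = a \<and> card (cross_pairs P (A i)) = k"
    and inj: "inj_on A I" and p: "0 < p" and ij: "i \<in> I" "j \<in> I" "i \<noteq> j" and q: "0 \<le> q j"
  shows "(if cross_pairs P (A i) \<inter> cross_pairs P (A j) \<noteq> {}
      then q j * p ^ card (cross_pairs P (A j) - cross_pairs P (A i)) else 0)
    \<le> (\<Sum>J | J \<subset> A i \<and> cross_pairs P J \<noteq> {}. if J \<subseteq> A j then q j * p ^ k / p ^ card (cross_pairs P J) else 0)"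
    (is "_ \<le> (\<Sum>J\<in>?\<J>. ?t J)")
proof (cases "cross_pairs P (A i) \<inter> cross_pairs P (A j) = {}")
  case True
  then show ?thesis using p q by (simp add: sum_nonneg)
next
  case False
  define J where "J = A i \<inter> A j"
  have cross_J: "cross_pairs P (A i) \<inter> cross_pairs P (A j) = cross_pairs P J"
    by (simp add: cross_pairs_Int J_def)
  have "J \<noteq> A i"
  proof
    assume "J = A i"
    then have "A i = A j" using A[OF ij(1)] A[OF ij(2)] by (intro card_subset_eq) (auto simp: J_def)
    then show False using inj ij by (auto dest: inj_onD)
  qed
  then have J: "J \<in> ?\<J>" using False cross_J by (auto simp: J_def)
  have fin: "finite (cross_pairs P (A j))" using A[OF ij(2)] by (simp add: finite_cross_pairs)
  have sub: "cross_pairs P J \<subseteq> cross_pairs P (A j)" using cross_J by auto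
  have "cross_pairs P (A j) - cross_pairs P (A i) = cross_pairs P (A j) - cross_pairs P J"
    using cross_J by auto
  then have "card (cross_pairs P (A j) - cross_pairs P (A i)) = k - card (cross_pairs P J)"
    using A[OF ij(2)] sub fin by (simp add: card_Diff_subset finite_subset)
  moreover have "card (cross_pairs P J) \<le> k" using card_mono[OF fin sub] A[OF ij(2)] by simp
  ultimately have "q j * p ^ card (cross_pairs P (A j) - cross_pairs P (A i)) = ?t J"
    using p by (simp add: power_diff J_def)
  also have "\<dots> \<le> (\<Sum>J\<in>?\<J>. ?t J)"
    using J A[OF ij(1)] p q by (intro member_le_sum) (auto intro: finite_subset[of _ "Pow (A i)"])
  finally show ?thesis using False by simp
qed

lemma janson_cliques:
  fixes A :: "'i \<Rightarrow> 'a set" and p b :: real and q :: "'i \<Rightarrow> real"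
  assumes I: "finite I" and p: "0 < p" "p \<le> 1" and q: "\<And>i. i \<in> I \<Longrightarrow> 0 \<le> q i \<and> q i \<le> 1"
    and A: "\<And>i. i \<in> I \<Longrightarrow> A i \<subseteq> \<Union>P \<and> card (A i) = a \<and> card (cross_pairs P (A i)) = k"
    and inj: "inj_on A I" and b: "0 \<le> b"
    and common: "\<And>i J. i \<in> I \<Longrightarrow> J \<subset> A i \<Longrightarrow> cross_pairs P J \<noteq> {} \<Longrightarrow>
      (\<Sum>j\<in>{j\<in>I - {i}. J \<subseteq> A j}. q j * p ^ k / p ^ card (cross_pairs P J)) \<le> b"
  shows "\<P>(R in random_subset (cross_pairs P (\<Union>P)) (\<lambda>_. p). \<forall>i\<in>I. \<not> cross_pairs P (A i) \<subseteq> R)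
    \<le> exp (- ((1 - 2 ^ a * b / 2) * (sum q I * p ^ k)))"
proof -
  have fin: "finite (A i) \<and> card (A i) = a \<and> card (cross_pairs P (A i)) = k" if "i \<in> I" for i
    using A[OF that] finite_subset[of "A i" "\<Union>P"] finite_P finite_part by auto
  have "(\<Sum>j\<in>I - {i}. if cross_pairs P (A i) \<inter> cross_pairs P (A j) \<noteq> {}
      then q j * p ^ card (cross_pairs P (A j) - cross_pairs P (A i)) else 0) \<le> 2 * (2 ^ a * b / 2)"
    if i: "i \<in> I" for i
  proof -
    let ?\<J> = "{J. J \<subset> A i \<and> cross_pairs P J \<noteq> {}}"
    let ?t = "\<lambda>j J. if J \<subseteq> A j then q j * p ^ k / p ^ card (cross_pairs P J) else 0"
    have "(\<Sum>j\<in>I - {i}. if cross_pairs P (A i) \<inter> cross_pairs P (A j) \<noteq> {}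
        then q j * p ^ card (cross_pairs P (A j) - cross_pairs P (A i)) else 0)
        \<le> (\<Sum>j\<in>I - {i}. \<Sum>J\<in>?\<J>. ?t j J)"
      using q by (intro sum_mono overlap_le_sum_common_subsets[OF fin inj p(1) i]) auto
    also have "\<dots> = (\<Sum>J\<in>?\<J>. \<Sum>j\<in>I - {i}. ?t j J)" by (rule sum.swap)
    also have "\<dots> = (\<Sum>J\<in>?\<J>. \<Sum>j\<in>{j\<in>I - {i}. J \<subseteq> A j}. q j * p ^ k / p ^ card (cross_pairs P J))"
      using I by (intro sum.cong refl sum.inter_filter[symmetric]) simp
    also have "\<dots> \<le> (\<Sum>J\<in>?\<J>. b)" using common[OF i] by (intro sum_mono) auto
    also have "\<dots> \<le> 2 ^ a * b"
    proof -
      have "card ?\<J> \<le> card (Pow (A i))" using fin[OF i] by (intro card_mono) auto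
      then have "real (card ?\<J>) \<le> 2 ^ a" using fin[OF i] by (simp add: card_Pow)
      then show ?thesis using b by (simp add: mult_right_mono)
    qed
    finally show ?thesis by simp
  qed
  then have "\<P>(R in random_subset (cross_pairs P (\<Union>P)) (\<lambda>_. p). \<forall>i\<in>I. \<not> cross_pairs P (A i) \<subseteq> R)
    \<le> exp (- ((1 - 2 ^ a * b / 2) * (\<Sum>i\<in>I. q i * p ^ card (cross_pairs P (A i)))))"
    using p q A cross_pairs_mono[of "A _" "\<Union>P" P]
    by (intro janson_thinned[OF finite_cross_edges _ p(2) I]) auto
  also have "(\<Sum>i\<in>I. q i * p ^ card (cross_pairs P (A i))) = sum q I * p ^ k"
    unfolding sum_distrib_right using A by (intro sum.cong) auto
  finally show ?thesis .
qed

end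

section \<open>Inner pairs at vertices of small inner degree\<close>

text \<open>Up to constants, the expected number of cliques on \<open>j\<close> vertices that contain a given pair.\<close>

definition cliques_per_pair :: "real \<Rightarrow> real \<Rightarrow> nat \<Rightarrow> real" where
  "cliques_per_pair n p j = n ^ (j - 2) * p ^ ((j choose 2) - 1)"

lemma power_mult_cliques_per_pair:
  assumes "2 \<le> j"
  shows "n ^ j * p ^ (j choose 2) = n\<^sup>2 * p * cliques_per_pair n p j"
    and "n ^ (j - 1) * p ^ (j choose 2) = n * p * cliques_per_pair n p j"
proof -
  obtain i where j: "j = i + 2" using assms by (metis add.commute le_Suc_ex)
  have "0 < j choose 2" using assms by simp
  then have "p ^ (j choose 2) = p * p ^ ((j choose 2) - 1)" by (simp flip: power_Suc)
  moreover have "n ^ j = n\<^sup>2 * n ^ (j - 2)" "n ^ (j - 1) = n * n ^ (j - 2)"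
    unfolding j by (simp_all add: power_add power2_eq_square)
  ultimately show "n ^ j * p ^ (j choose 2) = n\<^sup>2 * p * cliques_per_pair n p j"
    "n ^ (j - 1) * p ^ (j choose 2) = n * p * cliques_per_pair n p j"
    by (simp_all add: cliques_per_pair_def)
qed

lemma inverse_scaled_power_le:
  fixes n p D c :: real
  assumes n: "0 < n" and p: "0 < p" "p \<le> 1" and c: "1 \<le> c" and i: "i \<le> r" and k: "k \<le> k'"
    and D: "0 < D" "D \<le> n ^ i * p ^ k'"
  shows "1 / ((n / c) ^ i * p ^ k) \<le> c ^ r / D"
proof -
  have "D / c ^ r \<le> n ^ i * p ^ k' / c ^ i"
    using n p c i D by (intro frac_le power_increasing) auto
  also have "\<dots> \<le> (n / c) ^ i * p ^ k"
    using n p c k by (simp add: power_divide divide_right_mono power_decreasing)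
  finally have "1 / ((n / c) ^ i * p ^ k) \<le> 1 / (D / c ^ r)"
    using n p c D by (intro divide_left_mono) auto
  then show ?thesis by simp
qed

lemma intersection_bound_le_sum:
  fixes c :: "'a set \<Rightarrow> real"
  assumes e: "finite e" "card e = 2" and J: "finite J"
    and nonneg: "0 \<le> c0" "0 \<le> c1" "0 \<le> c2"
    and disjoint: "card (J \<inter> e) = 0 \<Longrightarrow> c e \<le> c0"
    and one: "card (J \<inter> e) = 1 \<Longrightarrow> c e \<le> c1"
    and two: "e \<subseteq> J \<Longrightarrow> c e \<le> c2"
  shows "c e \<le> c0 + (\<Sum>x\<in>J. if x \<in> e then c1 else 0) + (if e \<subseteq> J then c2 else 0)"
proof -
  have rest: "0 \<le> (\<Sum>x\<in>J. if x \<in> e then c1 else 0)" "0 \<le> (if e \<subseteq> J then c2 else 0)"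
    using nonneg by (auto intro!: sum_nonneg)
  have "card (J \<inter> e) \<le> 2" using e by (metis Int_lower2 card_mono)
  then consider "card (J \<inter> e) = 0" | "card (J \<inter> e) = 1" | "card (J \<inter> e) = 2" by linarith
  then show ?thesis
  proof cases
    assume "card (J \<inter> e) = 0"
    then show ?thesis using disjoint rest by linarith
  next
    assume "card (J \<inter> e) = 1"
    then obtain x where x: "x \<in> J" "x \<in> e" by (metis IntE card_1_singletonE singletonI)
    have "c e \<le> (if x \<in> e then c1 else 0)" using one[OF \<open>card (J \<inter> e) = 1\<close>] x by simp
    also have "\<dots> \<le> (\<Sum>x\<in>J. if x \<in> e then c1 else 0)" using x J nonneg by (intro member_le_sum) auto
    finally show ?thesis using nonneg(1) rest by linarith
  next
    assume "card (J \<inter> e) = 2"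
    then have "J \<inter> e = e" using e by (metis Int_lower2 card_subset_eq)
    then have "e \<subseteq> J" by auto
    then show ?thesis using two nonneg(1) rest by simp
  qed
qed

lemma sum_weights_by_intersection:
  fixes w c :: "'a set \<Rightarrow> real"
  assumes T: "finite T" "\<forall>e\<in>T. finite e \<and> card e = 2" and w: "\<forall>e\<in>T. 0 \<le> w e" and J: "finite J"
    and total: "sum w T \<le> D0" and vertex: "\<And>x. (\<Sum>e\<in>{e\<in>T. x \<in> e}. w e) \<le> D1"
    and edge: "e0 \<in> T" "w e0 \<le> D2"
    and nonneg: "0 \<le> c0" "0 \<le> c1" "0 \<le> c2"
    and disjoint: "\<And>e. e \<in> T \<Longrightarrow> card (J \<inter> e) = 0 \<Longrightarrow> c e \<le> c0"
    and one: "\<And>e. e \<in> T \<Longrightarrow> card (J \<inter> e) = 1 \<Longrightarrow> c e \<le> c1"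
    and two: "\<And>e. e \<in> T \<Longrightarrow> e \<subseteq> J \<Longrightarrow> e = e0 \<and> c e \<le> c2"
  shows "(\<Sum>e\<in>T. w e * c e) \<le> c0 * D0 + real (card J) * (c1 * D1) + c2 * D2"
proof -
  have "w e * c e \<le> w e * c0 + (\<Sum>x\<in>J. if x \<in> e then w e * c1 else 0) + (if e = e0 then w e0 * c2 else 0)"
    if e: "e \<in> T" for e
  proof -
    have "w e * c e \<le> w e * (c0 + (\<Sum>x\<in>J. if x \<in> e then c1 else 0) + (if e \<subseteq> J then c2 else 0))"
      using T(2) w e J nonneg disjoint[OF e] one[OF e] two[OF e]
      by (intro mult_left_mono intersection_bound_le_sum) auto
    moreover have "w e * (\<Sum>x\<in>J. if x \<in> e then c1 else 0) = (\<Sum>x\<in>J. if x \<in> e then w e * c1 else 0)"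
      unfolding sum_distrib_left by (intro sum.cong) auto
    moreover have "w e * (if e \<subseteq> J then c2 else 0) \<le> (if e = e0 then w e0 * c2 else 0)"
      using w edge(1) two[OF e] nonneg(3) by (cases "e \<subseteq> J") auto
    ultimately show ?thesis by (simp only: distrib_left)
  qed
  then have "(\<Sum>e\<in>T. w e * c e) \<le> (\<Sum>e\<in>T. w e * c0)
      + (\<Sum>e\<in>T. \<Sum>x\<in>J. if x \<in> e then w e * c1 else 0) + (\<Sum>e\<in>T. if e = e0 then w e0 * c2 else 0)"
    unfolding sum.distrib[symmetric] by (rule sum_mono)
  also have "(\<Sum>e\<in>T. w e * c0) \<le> c0 * D0"
    using mult_left_mono[OF total nonneg(1)] by (simp add: sum_distrib_left mult.commute)
  also have "(\<Sum>e\<in>T. \<Sum>x\<in>J. if x \<in> e then w e * c1 else 0) \<le> real (card J) * (c1 * D1)"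
  proof -
    have "(\<Sum>e\<in>T. \<Sum>x\<in>J. if x \<in> e then w e * c1 else 0) = (\<Sum>x\<in>J. \<Sum>e\<in>T. if x \<in> e then w e * c1 else 0)"
      by (rule sum.swap)
    also have "\<dots> = (\<Sum>x\<in>J. (\<Sum>e\<in>{e\<in>T. x \<in> e}. w e) * c1)"
      unfolding sum_distrib_right using T(1) by (intro sum.cong refl sum.inter_filter[symmetric])
    also have "\<dots> \<le> (\<Sum>x\<in>J. D1 * c1)"
      using vertex nonneg by (intro sum_mono mult_right_mono) auto
    finally show ?thesis by (simp add: mult.commute)
  qed
  also have "(\<Sum>e\<in>T. if e = e0 then w e0 * c2 else 0) \<le> c2 * D2"
    using mult_left_mono[OF edge(2) nonneg(3)] T(1) edge(1) by (simp add: mult.commute)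
  finally show ?thesis by simp
qed

definition (in multipartite) expected_completions :: "real \<Rightarrow> 'a set \<Rightarrow> real" where
  "expected_completions p V = (\<Prod>W\<in>P - {V}. real (card W)) * p ^ ((Suc r choose 2) - 1)"

text \<open>The weight of an inner pair is the expected number of its completions to a clique that survive
  the thinning.\<close>

locale weighted_inner_pairs = multipartite P r for P :: "'a set set" and r +
  fixes n p \<tau> \<Lambda> :: real and T :: "'a set set" and w :: "'a set \<Rightarrow> real"
  assumes n0: "0 < n" and p01: "0 < p" "p \<le> 1" and \<Lambda>0: "0 < \<Lambda>" and \<tau>0: "0 \<le> \<tau>"
    and part_size: "V \<in> P \<Longrightarrow> n / (2 * real r) \<le> real (card V)"
    and cliques_ge_1: "2 \<le> j \<Longrightarrow> j \<le> r \<Longrightarrow> 1 \<le> cliques_per_pair n p j"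
    and cliques_ge_\<Lambda>: "3 \<le> j \<Longrightarrow> j \<le> r \<Longrightarrow> \<Lambda> \<le> cliques_per_pair n p j"
    and finite_T: "finite T" and T_inner: "T \<subseteq> inner_pairs"
    and w_nonneg: "e \<in> T \<Longrightarrow> 0 \<le> w e"
    and w_le_completions: "e \<in> T \<Longrightarrow> V \<in> P \<Longrightarrow> w e \<le> expected_completions p V"
    and total_weight: "sum w T \<le> \<tau> * (n\<^sup>2 * p)"
    and vertex_weight: "(\<Sum>e\<in>{e\<in>T. x \<in> e}. w e) \<le> \<tau> * (n * p)"
    and edge_weight: "e \<in> T \<Longrightarrow> w e \<le> \<tau> * \<Lambda>"
begin

definition part :: "'a set \<Rightarrow> 'a set" where
  "part e = (SOME V. V \<in> P \<and> e \<in> nsets V 2)"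

definition completions :: "'a set \<Rightarrow> 'a set set" where
  "completions e = transversals (P - {part e}) (\<lambda>V. V)"

definition completed_pairs :: "('a set \<times> 'a set) set" where
  "completed_pairs = (SIGMA e:T. completions e)"

definition clique :: "'a set \<times> 'a set \<Rightarrow> 'a set" where
  "clique = (\<lambda>(e, S). e \<union> S)"

definition thinning :: "'a set \<times> 'a set \<Rightarrow> real" where
  "thinning = (\<lambda>(e, S). w e / expected_completions p (part e))"

lemma part: "e \<in> T \<Longrightarrow> part e \<in> P \<and> e \<in> nsets (part e) 2"
  unfolding part_def using T_inner by (intro someI_ex[of "\<lambda>V. V \<in> P \<and> e \<in> nsets V 2"])
      (auto simp: inner_pairs_def)

lemma pair_finite: "e \<in> T \<Longrightarrow> finite e \<and> card e = 2"
  using part[of e] by (auto simp: nsets_def)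

lemma scale_pos: "0 < n / (2 * real r)"
  using n0 parts_ge_2 by simp

lemma expected_completions_pos: "0 < expected_completions p V"
  unfolding expected_completions_def using part_size scale_pos p01
  by (intro mult_pos_pos prod_pos) (force intro: less_le_trans)+

lemma finite_completions: "finite (completions e)"
  unfolding completions_def using finite_P finite_part
  by (intro finite_transversals disjoint_parts) auto

lemma card_completions: "real (card (completions e)) * p ^ ((Suc r choose 2) - 1)
    = expected_completions p (part e)"
  unfolding completions_def expected_completions_def using finite_P finite_part
  by (subst card_transversals) (auto intro: disjoint_parts)

lemma finite_completed_pairs: "finite completed_pairs"
  unfolding completed_pairs_def using finite_T finite_completions by auto

lemma clique_finite_card:
  assumes "e \<in> T" "S \<in> completions e"
  shows "finite (e \<union> S)" "card (e \<union> S) = Suc r" "e \<union> S \<subseteq> \<Union>P"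
    "card (cross_pairs P (e \<union> S)) = (Suc r choose 2) - 1"
proof -
  note S = assms(2)[unfolded completions_def]
  show c: "finite (e \<union> S)" "card (e \<union> S) = Suc r" "e \<union> S \<subseteq> \<Union>P"
    using extended_transversal[OF _ _ S] part[OF assms(1)] by blast+
  show "card (cross_pairs P (e \<union> S)) = (Suc r choose 2) - 1"
    using card_cross_pairs_extended_transversal[OF _ _ S order_refl c(1)] part[OF assms(1)] c(2) by auto
qed

lemma unique_pair_in_clique:
  assumes "e \<in> T" "S \<in> completions e" "e' \<in> T" "e' \<subseteq> e \<union> S"
  shows "e' = e"
proof (rule ccontr)
  assume "e' \<noteq> e"
  then have "e' \<in> cross_pairs P (e \<union> S)"
    using cross_pairs_extended_transversal[OF _ _ assms(2)[unfolded completions_def] order_refl]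
      part[OF assms(1)] pair_finite[OF assms(3)] assms(4) by (auto simp: nsets_def)
  then show False using part[OF assms(3)] by (auto simp: cross_pairs_def nsets_def)
qed

lemma inj_on_clique: "inj_on clique completed_pairs"
proof (intro inj_onI, clarify)
  fix e S e' S'
  assume "(e, S) \<in> completed_pairs" "(e', S') \<in> completed_pairs" "clique (e, S) = clique (e', S')"
  then have mem: "e \<in> T" "S \<in> completions e" "e' \<in> T" "S' \<in> completions e'" and eq: "e \<union> S = e' \<union> S'"
    by (auto simp: completed_pairs_def clique_def)
  have "e' = e" using unique_pair_in_clique[OF mem(1-3)] eq by auto
  moreover have "e \<inter> S = {}" "e \<inter> S' = {}"
    using disjoint_transversal_part[of "part e" S] disjoint_transversal_part[of "part e" S'] mem part[of e]
    unfolding completions_def \<open>e' = e\<close> by (auto simp: nsets_def)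
  ultimately show "e = e' \<and> S = S'" using eq by blast
qed

lemma thinning_bounds: "i \<in> completed_pairs \<Longrightarrow> 0 \<le> thinning i \<and> thinning i \<le> 1"
  using w_nonneg w_le_completions part expected_completions_pos
  by (auto simp: completed_pairs_def thinning_def less_imp_le)

lemma sum_thinning: "sum thinning completed_pairs * p ^ ((Suc r choose 2) - 1) = sum w T"
proof -
  have "sum thinning completed_pairs = (\<Sum>e\<in>T. \<Sum>S\<in>completions e. w e / expected_completions p (part e))"
    unfolding completed_pairs_def using finite_T finite_completions
    by (subst sum.Sigma) (auto simp: thinning_def intro!: sum.cong)
  then have "sum thinning completed_pairs * p ^ ((Suc r choose 2) - 1)
      = (\<Sum>e\<in>T. real (card (completions e)) * p ^ ((Suc r choose 2) - 1)
          * (w e / expected_completions p (part e)))"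
    by (simp add: sum_distrib_left mult_ac)
  also have "\<dots> = sum w T"
    unfolding card_completions using expected_completions_pos by (intro sum.cong) (auto simp: less_le)
  finally show ?thesis .
qed

lemma sum_thinning_containing_le:
  "(\<Sum>i\<in>{i\<in>completed_pairs. J \<subseteq> clique i}. thinning i * p ^ ((Suc r choose 2) - 1))
    \<le> (\<Sum>e\<in>T. w e / (n / (2 * real r)) ^ card (J - e))"
proof -
  let ?k = "(Suc r choose 2) - 1" and ?l = "n / (2 * real r)"
  let ?above = "\<lambda>e. {S\<in>completions e. J \<subseteq> e \<union> S}"
  have "{i\<in>completed_pairs. J \<subseteq> clique i} = (SIGMA e:T. ?above e)"
    by (auto simp: completed_pairs_def clique_def)
  then have "(\<Sum>i\<in>{i\<in>completed_pairs. J \<subseteq> clique i}. thinning i * p ^ ?k)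
      = (\<Sum>e\<in>T. \<Sum>S\<in>?above e. w e / expected_completions p (part e) * p ^ ?k)"
    using finite_T finite_completions by (subst sum.Sigma) (auto simp: thinning_def intro!: sum.cong)
  also have "\<dots> = (\<Sum>e\<in>T. real (card (?above e)) * p ^ ?k * (w e / expected_completions p (part e)))"
    by (simp add: mult_ac)
  also have "\<dots> \<le> (\<Sum>e\<in>T. expected_completions p (part e) / ?l ^ card (J - e)
      * (w e / expected_completions p (part e)))"
  proof (intro sum_mono mult_right_mono)
    fix e assume e: "e \<in> T"
    have "card (?above e) \<le> card {S\<in>completions e. J - e \<subseteq> S}"
      using finite_completions by (intro card_mono) auto
    then have "real (card (?above e)) * ?l ^ card (J - e)
        \<le> real (card {S\<in>completions e. J - e \<subseteq> S}) * ?l ^ card (J - e)"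
      using scale_pos by (intro mult_right_mono) auto
    also have "\<dots> \<le> (\<Prod>W\<in>P - {part e}. real (card W))"
      unfolding completions_def using finite_P finite_part part_size scale_pos
      by (intro card_transversals_containing disjoint_parts) auto
    finally have "real (card (?above e)) * ?l ^ card (J - e) * p ^ ?k \<le> expected_completions p (part e)"
      unfolding expected_completions_def using p01 by (intro mult_right_mono) auto
    then show "real (card (?above e)) * p ^ ?k \<le> expected_completions p (part e) / ?l ^ card (J - e)"
      using scale_pos by (simp only: pos_le_divide_eq zero_less_power) (simp add: mult_ac)
    show "0 \<le> w e / expected_completions p (part e)"
      using w_nonneg[OF e] expected_completions_pos by (simp add: less_imp_le)
  qed
  also have "\<dots> = (\<Sum>e\<in>T. w e / ?l ^ card (J - e))"
    using expected_completions_pos by (intro sum.cong) (auto simp: less_le)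
  finally show ?thesis .
qed

lemma proper_subset_of_clique:
  assumes i: "i \<in> completed_pairs" and J: "J \<subset> clique i" "cross_pairs P J \<noteq> {}"
  shows "finite J" "2 \<le> card J" "card J \<le> r"
proof -
  have clique: "finite (clique i)" "card (clique i) = Suc r"
    using i clique_finite_card by (auto simp: completed_pairs_def clique_def)
  show fin: "finite J" using J(1) clique(1) by (auto intro: finite_subset)
  show "card J \<le> r" using psubset_card_mono[OF clique(1) J(1)] clique(2) by simp
  obtain f where "f \<in> nsets J 2" using J(2) by (auto simp: cross_pairs_def)
  then show "2 \<le> card J" using card_mono[OF fin, of f] by (auto simp: nsets_def)
qed

lemma common_subset_coefficient_le:
  assumes e0: "e0 \<in> T" "S \<in> completions e0" and J: "J \<subset> e0 \<union> S" "cross_pairs P J \<noteq> {}"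
    and J_card: "finite J" "2 \<le> card J" "card J \<le> r" and e: "e \<in> T"
  defines "cost \<equiv> 1 / ((n / (2 * real r)) ^ card (J - e) * p ^ card (cross_pairs P J))"
  shows "card (J \<inter> e) = 0 \<Longrightarrow> cost \<le> (2 * real r) ^ r / (n\<^sup>2 * p)"
    and "card (J \<inter> e) = 1 \<Longrightarrow> cost \<le> (2 * real r) ^ r / (n * p)"
    and "e \<subseteq> J \<Longrightarrow> e = e0 \<and> cost \<le> (2 * real r) ^ r / \<Lambda>"
proof -
  have r1: "1 \<le> 2 * real r" using parts_ge_2 by simp
  note bound = inverse_scaled_power_le[OF n0 p01 r1, of _ r]
  have diff: "card (J - e) = card J - card (J \<inter> e)"
    using J_card(1) by (simp add: card_Diff_subset_Int)
  have cross_le: "card (cross_pairs P J) \<le> card J choose 2" by (rule card_cross_pairs_le[OF J_card(1)])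
  have dense: "n\<^sup>2 * p \<le> n ^ card J * p ^ (card J choose 2)" "n * p \<le> n ^ (card J - 1) * p ^ (card J choose 2)"
    unfolding power_mult_cliques_per_pair[OF J_card(2)]
    using mult_left_mono[OF cliques_ge_1[OF J_card(2,3)], of "n\<^sup>2 * p"]
      mult_left_mono[OF cliques_ge_1[OF J_card(2,3)], of "n * p"] n0 p01 by simp_all
  show "cost \<le> (2 * real r) ^ r / (n\<^sup>2 * p)" if "card (J \<inter> e) = 0"
    unfolding cost_def diff that using J_card(3) cross_le n0 p01 dense(1) by (intro bound) auto
  show "cost \<le> (2 * real r) ^ r / (n * p)" if "card (J \<inter> e) = 1"
    unfolding cost_def diff that using J_card(3) cross_le n0 p01 dense(2) by (intro bound) auto
  show "e = e0 \<and> cost \<le> (2 * real r) ^ r / \<Lambda>" if sub: "e \<subseteq> J"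
  proof
    show "e = e0" using unique_pair_in_clique[OF e0 e] sub J(1) by auto
    then have cross: "card (cross_pairs P J) = (card J choose 2) - 1"
      using card_cross_pairs_extended_transversal[OF _ _ e0(2)[unfolded completions_def] _ J_card(1)]
        part[OF e0(1)] sub J(1) by auto
    then have "card J \<noteq> 2" using J(2) finite_cross_pairs[OF J_card(1), of P] by auto
    then have "\<Lambda> \<le> cliques_per_pair n p (card J)" using cliques_ge_\<Lambda> J_card by auto
    moreover have "card (J \<inter> e) = 2" using sub pair_finite[OF e] by (simp add: Int_absorb1)
    ultimately show "cost \<le> (2 * real r) ^ r / \<Lambda>"
      unfolding cost_def diff using cross J_card(3) \<Lambda>0 by (intro bound) (auto simp: cliques_per_pair_def)
  qed
qed

lemma common_subset_le:
  assumes i: "i \<in> completed_pairs" and J: "J \<subset> clique i" "cross_pairs P J \<noteq> {}"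
  shows "(\<Sum>j\<in>{j\<in>completed_pairs. J \<subseteq> clique j}.
      thinning j * p ^ ((Suc r choose 2) - 1) / p ^ card (cross_pairs P J))
    \<le> (real r + 2) * (2 * real r) ^ r * \<tau>"
proof -
  let ?c = "card (cross_pairs P J)" and ?l = "n / (2 * real r)" and ?K = "(2 * real r) ^ r"
  let ?coeff = "\<lambda>e. 1 / (?l ^ card (J - e) * p ^ ?c)"
  note J_card = proper_subset_of_clique[OF assms]
  obtain e0 S where e0: "e0 \<in> T" "S \<in> completions e0" "clique i = e0 \<union> S"
    using i by (auto simp: completed_pairs_def clique_def)
  note coeff = common_subset_coefficient_le[OF e0(1,2) J(1)[unfolded e0(3)] J(2) J_card]
  have "(\<Sum>j\<in>{j\<in>completed_pairs. J \<subseteq> clique j}. thinning j * p ^ ((Suc r choose 2) - 1) / p ^ ?c)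
      \<le> (\<Sum>e\<in>T. w e / ?l ^ card (J - e)) / p ^ ?c"
    unfolding sum_divide_distrib[symmetric]
    using p01 sum_thinning_containing_le by (intro divide_right_mono) auto
  also have "\<dots> = (\<Sum>e\<in>T. w e * ?coeff e)" by (simp add: sum_divide_distrib mult.commute)
  also have "\<dots> \<le> ?K / (n\<^sup>2 * p) * (\<tau> * (n\<^sup>2 * p)) + real (card J) * (?K / (n * p) * (\<tau> * (n * p)))
      + ?K / \<Lambda> * (\<tau> * \<Lambda>)"
    using pair_finite w_nonneg n0 p01 \<Lambda>0 coeff
    by (intro sum_weights_by_intersection[OF finite_T _ _ J_card(1) total_weight vertex_weight e0(1) edge_weight[OF e0(1)]])
      auto
  also have "\<dots> = (real (card J) + 2) * ?K * \<tau>"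
    using n0 p01 \<Lambda>0 by (simp add: field_simps)
  also have "\<dots> \<le> (real r + 2) * ?K * \<tau>" using J_card(3) \<tau>0 by (intro mult_right_mono) auto
  finally show ?thesis .
qed

theorem prob_edge_clique_free_le:
  "\<P>(R in random_subset (cross_pairs P (\<Union>P)) (\<lambda>_. p). edge_clique_free T R)
    \<le> exp (- ((1 - 2 ^ r * ((real r + 2) * (2 * real r) ^ r * \<tau>)) * sum w T))"
proof -
  let ?M = "random_subset (cross_pairs P (\<Union>P)) (\<lambda>_. p)" and ?b = "(real r + 2) * (2 * real r) ^ r * \<tau>"
  have "\<P>(R in ?M. edge_clique_free T R) \<le> \<P>(R in ?M. \<forall>i\<in>completed_pairs. \<not> cross_pairs P (clique i) \<subseteq> R)"
    using part by (intro prob_random_subset_mono)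
      (fastforce simp: edge_clique_free_def completed_pairs_def completions_def clique_def nsets_def)
  also have "\<dots> \<le> exp (- ((1 - 2 ^ Suc r * ?b / 2) * (sum thinning completed_pairs * p ^ ((Suc r choose 2) - 1))))"
  proof (rule janson_cliques[OF finite_completed_pairs p01 thinning_bounds _ inj_on_clique])
    show "clique i \<subseteq> \<Union>P \<and> card (clique i) = Suc r \<and> card (cross_pairs P (clique i)) = (Suc r choose 2) - 1"
      if "i \<in> completed_pairs" for i
    proof (cases i)
      case (Pair e S)
      then show ?thesis using that clique_finite_card[of e S] by (simp add: completed_pairs_def clique_def)
    qed
    fix i J assume iJ: "i \<in> completed_pairs" "J \<subset> clique i" "cross_pairs P J \<noteq> {}"
    let ?t = "\<lambda>j. thinning j * p ^ ((Suc r choose 2) - 1) / p ^ card (cross_pairs P J)"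
    have "(\<Sum>j\<in>{j\<in>completed_pairs - {i}. J \<subseteq> clique j}. ?t j) \<le> (\<Sum>j\<in>{j\<in>completed_pairs. J \<subseteq> clique j}. ?t j)"
      using finite_completed_pairs thinning_bounds p01 by (intro sum_mono2) auto
    also have "\<dots> \<le> ?b" by (rule common_subset_le[OF iJ])
    finally show "(\<Sum>j\<in>{j\<in>completed_pairs - {i}. J \<subseteq> clique j}. ?t j) \<le> ?b" .
  qed (use \<tau>0 in auto)
  finally show ?thesis unfolding sum_thinning by (simp add: mult.assoc)
qed

end

section \<open>Decomposition into stars\<close>

definition vertex_degree :: "'a set set \<Rightarrow> 'a \<Rightarrow> nat" where
  "vertex_degree T x = card {e\<in>T. x \<in> e}"

definition star_size :: "'a set set \<Rightarrow> ('a set \<Rightarrow> 'a) \<Rightarrow> 'a set \<Rightarrow> nat" where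
  "star_size T c e = card {f\<in>T. c f = c e}"

definition star_decomposition :: "nat \<Rightarrow> 'a set set \<Rightarrow> ('a set \<Rightarrow> 'a) \<Rightarrow> bool" where
  "star_decomposition d T c \<longleftrightarrow> (\<forall>e\<in>T. c e \<in> e) \<and>
    (\<forall>x. (\<Sum>e\<in>{e\<in>T. x \<in> e \<and> star_size T c e \<le> d}. 1 / sqrt (star_size T c e))
      \<le> 2 * sqrt (min (vertex_degree T x) d))"

lemma sqrt_Suc_increment: "2 * sqrt (real m) + 1 / sqrt (real (Suc m)) \<le> 2 * sqrt (real (Suc m))"
proof -
  define b where "b = sqrt (real (Suc m))"
  have b: "b > 0" "b * b = real m + 1" by (auto simp: b_def)
  have "2 * (sqrt (real m) * b) \<le> real m + b * b"
    using sum_squares_bound[of "sqrt (real m)" b] by (simp add: power2_eq_square)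
  then have "(2 * sqrt (real m) + 1 / b) * b \<le> 2 * b * b" using b by (simp add: algebra_simps)
  then show ?thesis using b(1) unfolding b_def[symmetric] by simp
qed

lemma sqrt_degree_after_removal:
  fixes T :: "'a set set"
  assumes T: "finite T" "\<forall>e\<in>T. card e = 2" and v: "\<And>x. vertex_degree T x \<le> vertex_degree T v"
  shows "2 * sqrt (min (vertex_degree {e\<in>T. v \<notin> e} x) d)
      + real (card {e\<in>T. v \<in> e \<and> x \<in> e \<and> vertex_degree T v \<le> d}) / sqrt (vertex_degree T v)
    \<le> 2 * sqrt (min (vertex_degree T x) d)"
proof -
  define T' where "T' = {e\<in>T. v \<notin> e}"
  define a where "a = vertex_degree T v"
  let ?new = "{e\<in>T. v \<in> e \<and> x \<in> e \<and> a \<le> d}"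
  consider "?new = {}" | "a \<le> d" "x = v" | "a \<le> d" "x \<noteq> v" "?new \<noteq> {}" by blast
  then have "2 * sqrt (min (vertex_degree T' x) d) + real (card ?new) / sqrt a
      \<le> 2 * sqrt (min (vertex_degree T x) d)"
  proof cases
    case 1
    have "vertex_degree T' x \<le> vertex_degree T x"
      unfolding vertex_degree_def using T(1) by (intro card_mono) (auto simp: T'_def)
    then have "2 * sqrt (min (vertex_degree T' x) d) \<le> 2 * sqrt (min (vertex_degree T x) d)" by simp
    then show ?thesis unfolding 1 by simp
  next
    case 2
    then have "vertex_degree T' x = 0" "card ?new = a" "min (vertex_degree T x) d = a"
      using T(1) by (auto simp: vertex_degree_def T'_def a_def)
    then show ?thesis by (simp add: real_div_sqrt)
  next
    case 3
    have "e = {x, v}" if "e \<in> ?new" for e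
    proof -
      have "{x, v} \<subseteq> e" "card e = card {x, v}" "finite e"
        using that 3(2) T(2) by (auto intro: card_ge_0_finite)
      then show ?thesis using card_subset_eq by metis
    qed
    then have new: "?new = {{x, v}}" using 3(3) by blast
    then have "{e\<in>T. x \<in> e} = insert {x, v} {e\<in>T'. x \<in> e}" using 3(1) by (auto simp: T'_def)
    then have deg: "vertex_degree T x = Suc (vertex_degree T' x)"
      using T(1) by (simp add: vertex_degree_def T'_def)
    then have "Suc (vertex_degree T' x) \<le> a" using v[of x] by (simp add: a_def)
    moreover from this have "1 / sqrt a \<le> 1 / sqrt (Suc (vertex_degree T' x))" by (intro divide_left_mono) auto
    ultimately show ?thesis using sqrt_Suc_increment[of "vertex_degree T' x"] 3(1) deg new by simp
  qed
  then show ?thesis by (simp only: T'_def a_def)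
qed

lemma star_decomposition_step:
  fixes T :: "'a set set"
  assumes T: "finite T" "\<forall>e\<in>T. card e = 2" and v: "\<And>x. vertex_degree T x \<le> vertex_degree T v"
    and c': "star_decomposition d {e\<in>T. v \<notin> e} c'"
  shows "star_decomposition d T (\<lambda>e. if v \<in> e then v else c' e)"
proof -
  define T' where "T' = {e\<in>T. v \<notin> e}"
  define c where "c = (\<lambda>e. if v \<in> e then v else c' e)"
  define a where "a = vertex_degree T v"
  have centre': "\<forall>e\<in>T'. c' e \<in> e" using c' by (simp add: star_decomposition_def T'_def)
  have size_v: "star_size T c e = a" if "e \<in> T" "v \<in> e" for e
    using that centre' unfolding star_size_def a_def vertex_degree_def
    by (intro arg_cong[of _ _ card]) (auto simp: c_def T'_def)
  have size_other: "star_size T c e = star_size T' c' e" if "e \<in> T'" for e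
    using that centre' unfolding star_size_def by (intro arg_cong[of _ _ card]) (auto simp: c_def T'_def)
  have "(\<Sum>e\<in>{e\<in>T. x \<in> e \<and> star_size T c e \<le> d}. 1 / sqrt (star_size T c e))
      \<le> 2 * sqrt (min (vertex_degree T x) d)" for x
  proof -
    let ?old = "{e\<in>T'. x \<in> e \<and> star_size T' c' e \<le> d}" and ?new = "{e\<in>T. v \<in> e \<and> x \<in> e \<and> a \<le> d}"
    have "{e\<in>T. x \<in> e \<and> star_size T c e \<le> d} = ?old \<union> ?new"
      using size_v size_other by (fastforce simp: T'_def)
    then have "(\<Sum>e\<in>{e\<in>T. x \<in> e \<and> star_size T c e \<le> d}. 1 / sqrt (star_size T c e))
        = (\<Sum>e\<in>?old. 1 / sqrt (star_size T c e)) + (\<Sum>e\<in>?new. 1 / sqrt (star_size T c e))"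
      using T(1) by (simp add: T'_def sum.union_disjoint disjoint_iff)
    also have "(\<Sum>e\<in>?old. 1 / sqrt (star_size T c e)) = (\<Sum>e\<in>?old. 1 / sqrt (star_size T' c' e))"
      using size_other by (intro sum.cong) auto
    also have "\<dots> \<le> 2 * sqrt (min (vertex_degree T' x) d)"
      using c' by (simp add: star_decomposition_def T'_def)
    also have "(\<Sum>e\<in>?new. 1 / sqrt (star_size T c e)) = real (card ?new) / sqrt a"
      using size_v by simp
    also have "2 * sqrt (min (vertex_degree T' x) d) + real (card ?new) / sqrt a
        \<le> 2 * sqrt (min (vertex_degree T x) d)"
      unfolding T'_def a_def by (rule sqrt_degree_after_removal[OF T v])
    finally show ?thesis by simp
  qed
  moreover have "\<forall>e\<in>T. c e \<in> e" using centre' by (auto simp: c_def T'_def)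
  ultimately show ?thesis unfolding star_decomposition_def c_def by blast
qed

text \<open>Stars are split off in order of decreasing degree; this keeps the inverse square roots of the
  star sizes summable at every vertex.\<close>

theorem ex_star_decomposition:
  fixes T :: "'a set set"
  assumes "finite T" "\<forall>e\<in>T. card e = 2"
  shows "\<exists>c. star_decomposition d T c"
  using assms
proof (induction "card T" arbitrary: T rule: less_induct)
  case less
  show ?case
  proof (cases "T = {}")
    case True
    then show ?thesis by (auto simp: star_decomposition_def)
  next
    case False
    have fin: "finite (\<Union>T)" using less.prems by (auto simp: card_ge_0_finite)
    have nonempty: "\<Union>T \<noteq> {}"
      using False less.prems(2) by (metis Union_empty_conv card.empty ex_in_conv zero_neq_numeral)
    obtain v where v: "v \<in> \<Union>T" "vertex_degree T v = Max (vertex_degree T ` \<Union>T)"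
      using Max_in[of "vertex_degree T ` \<Union>T"] fin nonempty
      by (metis (no_types, lifting) finite_imageI imageE image_is_empty)
    have max: "vertex_degree T x \<le> vertex_degree T v" for x
    proof (cases "x \<in> \<Union>T")
      case True
      then show ?thesis using v(2) fin by simp
    next
      case False
      then have "{e\<in>T. x \<in> e} = {}" by auto
      then show ?thesis by (simp only: vertex_degree_def card.empty)
    qed
    have "card {e\<in>T. v \<notin> e} < card T" using v(1) less.prems(1) by (intro psubset_card_mono) auto
    then obtain c' where "star_decomposition d {e\<in>T. v \<notin> e} c'"
      using less.hyps[of "{e\<in>T. v \<notin> e}"] less.prems by auto
    then show ?thesis using star_decomposition_step[OF less.prems max] by blast
  qed
qed

section \<open>Boxes with many dense transversals\<close>

lemma binomial_le_power_div_fact: "real (n choose d) \<le> real n ^ d / fact d"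
  using of_nat_mono[OF binomial_fact_pow[of n d], where 'a = real] by (simp add: pos_le_divide_eq)

lemma card_nsets_le:
  assumes "real (card V) \<le> n"
  shows "real (card (nsets V d)) \<le> n ^ d / fact d"
proof -
  have "real (card V choose d) \<le> real (card V) ^ d / fact d" by (rule binomial_le_power_div_fact)
  also have "\<dots> \<le> n ^ d / fact d" using assms by (intro divide_right_mono power_mono) auto
  finally show ?thesis by simp
qed

lemma card_nsets_large_Int_le:
  assumes V: "finite V" "U \<subseteq> V"
  shows "card {A\<in>nsets V d. h \<le> card (A \<inter> U)} \<le> card (nsets U h) * card (nsets V (d - h))"
proof -
  have fin: "finite (nsets U h \<times> nsets V (d - h))"
    using V by (auto simp: finite_imp_finite_nsets finite_subset)
  have "{A\<in>nsets V d. h \<le> card (A \<inter> U)} \<subseteq> (\<lambda>(B, C). B \<union> C) ` (nsets U h \<times> nsets V (d - h))"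
  proof
    fix A assume A: "A \<in> {A\<in>nsets V d. h \<le> card (A \<inter> U)}"
    then obtain B where B: "B \<subseteq> A \<inter> U" "card B = h" by (metis mem_Collect_eq obtain_subset_with_card_n)
    then have "finite B" using A finite_subset[of B A] by (simp add: nsets_def)
    then have "B \<in> nsets U h" "A - B \<in> nsets V (d - h)"
      using A B by (auto simp: nsets_def card_Diff_subset)
    moreover have "A = B \<union> (A - B)" using B by auto
    ultimately show "A \<in> (\<lambda>(B, C). B \<union> C) ` (nsets U h \<times> nsets V (d - h))"
      by (intro image_eqI[of _ _ "(B, A - B)"]) auto
  qed
  then have "card {A\<in>nsets V d. h \<le> card (A \<inter> U)} \<le> card (nsets U h \<times> nsets V (d - h))"
    using fin by (meson card_image_le card_mono finite_imageI order_trans)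
  then show ?thesis by (simp add: card_cartesian_product)
qed

lemma card_nsets_large_fraction_le:
  fixes s c n \<rho> :: real
  assumes V: "finite V" "real (card V) \<le> n" "0 < n" and U: "U \<subseteq> V" "real (card U) \<le> s * n"
    and s: "0 < s" "s \<le> 1" "s powr (c / 2) \<le> \<rho> / 4" and c: "0 < c"
  shows "real (card {A\<in>nsets V d. c * real d / 2 \<le> real (card (A \<inter> U))}) \<le> (\<rho> / 2) ^ d * (n ^ d / fact d)"
    (is "real (card ?X) \<le> _")
proof -
  define h where "h = nat \<lceil>c * real d / 2\<rceil>"
  have h: "c * real d / 2 \<le> real h" using c by (simp add: h_def)
  have X: "?X = {A\<in>nsets V d. h \<le> card (A \<inter> U)}" unfolding h_def by (auto simp: nat_le_iff ceiling_le_iff)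
  have "0 < s powr (c / 2)" using s by simp
  then have \<rho>: "0 < \<rho>" using s(3) by linarith
  show ?thesis
  proof (cases "h \<le> d")
    case False
    have "card (A \<inter> U) \<le> d" if "A \<in> nsets V d" for A
      using that by (metis (mono_tags, lifting) Int_lower1 card_mono mem_Collect_eq nsets_def)
    then have "?X = {}" using False unfolding X by fastforce
    then have "real (card ?X) = 0" by (simp only: card.empty of_nat_0)
    then show ?thesis using \<rho> V(3) by simp
  next
    case True
    have "s ^ h \<le> (\<rho> / 4) ^ d"
    proof -
      have "s ^ h = s powr real h" using s by (simp add: powr_realpow)
      also have "\<dots> \<le> s powr (c / 2 * real d)" using s h by (intro powr_mono') auto
      also have "\<dots> = (s powr (c / 2)) ^ d" using s by (simp add: powr_powr flip: powr_realpow)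
      also have "\<dots> \<le> (\<rho> / 4) ^ d" using s by (intro power_mono) auto
      finally show ?thesis .
    qed
    have "real (card ?X) \<le> real (card (nsets U h)) * real (card (nsets V (d - h)))"
      unfolding X using card_nsets_large_Int_le[OF V(1) U(1)]
      by (simp only: of_nat_mult[symmetric] of_nat_le_iff)
    also have "\<dots> \<le> ((s * n) ^ h / fact h) * (n ^ (d - h) / fact (d - h))"
      using U(2) V(2,3) s by (intro mult_mono card_nsets_le) auto
    also have "\<dots> = s ^ h * (n ^ d / fact d) * real (d choose h)"
      using True by (simp add: power_mult_distrib binomial_fact field_simps flip: power_add)
    also have "\<dots> \<le> (\<rho> / 4) ^ d * (n ^ d / fact d) * 2 ^ d"
    proof (intro mult_mono)
      have "real (d choose h) \<le> real (2 ^ d)" by (simp only: of_nat_le_iff binomial_le_pow2)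
      then show "real (d choose h) \<le> 2 ^ d" by simp
    qed (use \<open>s ^ h \<le> (\<rho> / 4) ^ d\<close> \<rho> V(3) in auto)
    also have "\<dots> = ((\<rho> / 4) * 2) ^ d * (n ^ d / fact d)" unfolding power_mult_distrib by simp
    finally show ?thesis by simp
  qed
qed

definition boxes :: "'a set set \<Rightarrow> nat \<Rightarrow> ('a set \<Rightarrow> 'a set) set" where
  "boxes I d = PiE I (\<lambda>V. nsets V d)"

definition dense_boxes :: "'a set set \<Rightarrow> nat \<Rightarrow> real \<Rightarrow> 'a set set \<Rightarrow> ('a set \<Rightarrow> 'a set) set" where
  "dense_boxes I d c \<J> = {W\<in>boxes I d. c * real d ^ card I \<le> real (card (\<J> \<inter> transversals I W))}"

definition rarely_dense :: "'a set set \<Rightarrow> real \<Rightarrow> real \<Rightarrow> real \<Rightarrow> real \<Rightarrow> bool" where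
  "rarely_dense I n c \<rho> \<sigma> \<longleftrightarrow> (\<forall>d \<J>. 1 \<le> d \<longrightarrow> \<J> \<subseteq> transversals I (\<lambda>V. V) \<longrightarrow>
    real (card \<J>) \<le> \<sigma> * n ^ card I \<longrightarrow>
    real (card (dense_boxes I d c \<J>)) \<le> \<rho> ^ d * (n ^ d / fact d) ^ card I)"

definition link :: "'a set set \<Rightarrow> 'a set set \<Rightarrow> 'a \<Rightarrow> 'a set set" where
  "link I \<J> u = {S \<in> transversals I (\<lambda>V. V). insert u S \<in> \<J>}"

lemma boxD:
  assumes "W \<in> boxes I d" "V \<in> I"
  shows "W V \<subseteq> V" "finite (W V)" "card (W V) = d"
  using PiE_mem[of W I _ V] assms unfolding boxes_def by (auto simp: nsets_def)

lemma finite_boxes: "finite I \<Longrightarrow> \<forall>V\<in>I. finite V \<Longrightarrow> finite (boxes I d)"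
  unfolding boxes_def by (intro finite_PiE) (auto simp: finite_imp_finite_nsets)

lemma card_boxes_le:
  assumes "finite I" "\<forall>V\<in>I. real (card V) \<le> n"
  shows "real (card (boxes I d)) \<le> (n ^ d / fact d) ^ card I"
proof -
  have "real (card (boxes I d)) = (\<Prod>V\<in>I. real (card (nsets V d)))"
    using assms(1) by (simp add: boxes_def card_PiE)
  also have "\<dots> \<le> (\<Prod>V\<in>I. n ^ d / fact d)"
    using assms(2) by (intro prod_mono conjI card_nsets_le) auto
  finally show ?thesis by simp
qed

lemma sum_card_link_le:
  assumes I: "finite (insert a I)" "disjoint (insert a I)" "a \<notin> I" "\<forall>V\<in>insert a I. finite V"
    and \<J>: "\<J> \<subseteq> transversals (insert a I) (\<lambda>V. V)" and U: "U \<subseteq> a"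
  shows "(\<Sum>u\<in>U. card (link I \<J> u)) \<le> card \<J>"
proof -
  have dis: "disjoint_family_on (\<lambda>V. V) (insert a I)"
    using I(2) by (auto simp: disjoint_def disjoint_family_on_def)
  then have "\<forall>V\<in>I. a \<inter> V = {}" "disjoint_family_on (\<lambda>V. V) I"
    using I(3) by (auto simp: disjoint_family_on_def)
  then have inj: "inj_on (\<lambda>(u, S). insert u S) (a \<times> transversals I (\<lambda>V. V))"
    and fin: "finite (transversals I (\<lambda>V. V))"
    using inj_on_insert_transversals[of I "\<lambda>V. V" a] finite_transversals[of I "\<lambda>V. V"] I by auto
  have \<J>_fin: "finite \<J>" using finite_subset[OF \<J> finite_transversals[OF I(1) dis I(4)]] .
  have "(\<Sum>u\<in>U. card (link I \<J> u)) = card (SIGMA u:U. link I \<J> u)"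
    using U I(4) fin by (subst card_SigmaI) (auto simp: link_def finite_subset)
  also have "\<dots> \<le> card \<J>"
    by (rule card_inj_on_le[where f = "\<lambda>(u, S). insert u S"])
      (use U in \<open>auto simp: link_def \<J>_fin intro!: inj_on_subset[OF inj]\<close>)
  finally show ?thesis .
qed

lemma card_transversals_through_box_le:
  assumes dis: "\<forall>V\<in>I. a \<inter> V = {}" "disjoint_family_on (\<lambda>V. V) I" and fin: "finite I" "\<forall>V\<in>I. finite V"
    and W: "W \<in> boxes (insert a I) d"
  shows "card (\<J> \<inter> transversals (insert a I) W) \<le> (\<Sum>u\<in>W a. card (link I \<J> u \<inter> transversals I W))"
proof -
  have WV: "W V \<subseteq> V" if "V \<in> insert a I" for V using boxD(1)[OF W that] .
  have sub: "transversals I W \<subseteq> transversals I (\<lambda>V. V)" by (rule transversals_mono[OF dis(2)]) (use WV in auto)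
  have fin_link: "finite (link I \<J> u \<inter> transversals I W)" for u
    using finite_transversals[OF fin(1) dis(2)] fin(2) by (simp add: link_def)
  have "W a \<inter> W V = {}" if "V \<in> I" for V using dis(1) WV that by blast
  then have "\<J> \<inter> transversals (insert a I) W
      \<subseteq> (\<lambda>(u, S). insert u S) ` (SIGMA u:W a. link I \<J> u \<inter> transversals I W)"
    using transversals_insert[of I W a] sub by (auto simp: link_def)
  then have "card (\<J> \<inter> transversals (insert a I) W) \<le> card (SIGMA u:W a. link I \<J> u \<inter> transversals I W)"
    using boxD(2)[OF W] fin_link by (intro order_trans[OF card_mono card_image_le]) auto
  also have "\<dots> = (\<Sum>u\<in>W a. card (link I \<J> u \<inter> transversals I W))"
    using boxD(2)[OF W] fin_link by (intro card_SigmaI) auto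
  finally show ?thesis .
qed

lemma dense_box_cases:
  assumes dis: "\<forall>V\<in>I. a \<inter> V = {}" "disjoint_family_on (\<lambda>V. V) I" and a: "a \<notin> I"
    and fin: "finite I" "\<forall>V\<in>I. finite V" and c: "0 < c" and d: "1 \<le> d"
    and W: "W \<in> dense_boxes (insert a I) d c \<J>"
  shows "c * real d / 2 \<le> real (card (W a \<inter> U)) \<or>
    (\<exists>u\<in>W a - U. restrict W I \<in> dense_boxes I d (c / 2) (link I \<J> u))"
proof (rule ccontr)
  assume neg: "\<not> ?thesis"
  let ?t = "\<lambda>u. real (card (link I \<J> u \<inter> transversals I W))" and ?D = "real d ^ card I"
  have box: "W \<in> boxes (insert a I) d" using W by (simp add: dense_boxes_def)
  have Wa: "finite (W a)" "card (W a) = d" using boxD[OF box] by auto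
  have restr: "restrict W I \<in> boxes I d" using box by (auto simp: boxes_def PiE_def)
  have trans: "transversals I (restrict W I) = transversals I W" by (rule transversals_cong) simp
  have W_trans: "finite (transversals I W)" "card (transversals I W) = d ^ card I"
    using transversals_count[OF fin(1) disjoint_family_on_subset[OF dis(2)], of W] boxD[OF box] by auto
  have inside: "?t u \<le> ?D" for u
    using card_mono[OF W_trans(1), of "link I \<J> u \<inter> transversals I W"] W_trans(2)
    by (simp only: of_nat_power[symmetric] of_nat_le_iff) simp
  have outside: "?t u \<le> c / 2 * ?D" if "u \<in> W a - U" for u
  proof -
    have "restrict W I \<notin> dense_boxes I d (c / 2) (link I \<J> u)" using neg that by blast
    then show ?thesis by (simp add: dense_boxes_def restr trans)
  qed
  have "c * real d ^ Suc (card I) \<le> real (card (\<J> \<inter> transversals (insert a I) W))"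
    using W a fin(1) by (simp add: dense_boxes_def)
  also have "\<dots> \<le> (\<Sum>u\<in>W a. ?t u)"
    using card_transversals_through_box_le[OF dis fin box] by (simp only: of_nat_sum[symmetric] of_nat_le_iff)
  also have "\<dots> = (\<Sum>u\<in>W a \<inter> U. ?t u) + (\<Sum>u\<in>W a - U. ?t u)"
    using Wa by (subst sum.union_disjoint[symmetric]) (auto simp: Int_Diff_Un)
  also have "\<dots> \<le> (\<Sum>u\<in>W a \<inter> U. ?D) + (\<Sum>u\<in>W a - U. c / 2 * ?D)"
    using inside outside by (intro add_mono sum_mono) auto
  also have "\<dots> = real (card (W a \<inter> U)) * ?D + real (card (W a - U)) * (c / 2 * ?D)" by simp
  also have "\<dots> < c * real d / 2 * ?D + real d * (c / 2 * ?D)"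
  proof (rule add_less_le_mono)
    show "real (card (W a \<inter> U)) * ?D < c * real d / 2 * ?D"
      using neg d by (intro mult_strict_right_mono) auto
    have "card (W a - U) \<le> d" using Wa by (metis Diff_subset card_mono)
    then show "real (card (W a - U)) * (c / 2 * ?D) \<le> real d * (c / 2 * ?D)"
      using c by (intro mult_right_mono) auto
  qed
  finally show False by simp
qed

lemma card_dense_boxes_insert_le:
  assumes dis: "\<forall>V\<in>I. a \<inter> V = {}" "disjoint_family_on (\<lambda>V. V) I" and a: "finite a" "a \<notin> I"
    and fin: "finite I" "\<forall>V\<in>I. finite V" and c: "0 < c" and d: "1 \<le> d"
  shows "card (dense_boxes (insert a I) d c \<J>)
    \<le> card {A\<in>nsets a d. c * real d / 2 \<le> real (card (A \<inter> U))} * card (boxes I d)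
      + (\<Sum>u\<in>a - U. card {A\<in>nsets a d. u \<in> A} * card (dense_boxes I d (c / 2) (link I \<J> u)))"
proof -
  let ?X = "{A\<in>nsets a d. c * real d / 2 \<le> real (card (A \<inter> U))} \<times> boxes I d"
  let ?Y = "\<lambda>u. {A\<in>nsets a d. u \<in> A} \<times> dense_boxes I d (c / 2) (link I \<J> u)"
  have finX: "finite ?X" and finY: "finite (?Y u)" for u
    using finite_boxes[OF fin] finite_imp_finite_nsets[OF a(1)] by (auto simp: dense_boxes_def)
  have "card (dense_boxes (insert a I) d c \<J>) \<le> card (?X \<union> (\<Union>u\<in>a - U. ?Y u))"
  proof (rule card_inj_on_le[where f = "\<lambda>W. (W a, restrict W I)"])
    show "inj_on (\<lambda>W. (W a, restrict W I)) (dense_boxes (insert a I) d c \<J>)"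
    proof (rule inj_onI)
      fix W W' assume W: "W \<in> dense_boxes (insert a I) d c \<J>" "W' \<in> dense_boxes (insert a I) d c \<J>"
        and eq: "(W a, restrict W I) = (W' a, restrict W' I)"
      then have "W \<in> PiE (insert a I) (\<lambda>V. nsets V d)" "W' \<in> PiE (insert a I) (\<lambda>V. nsets V d)"
        by (auto simp: dense_boxes_def boxes_def)
      moreover have "W V = W' V" if "V \<in> insert a I" for V
        using eq that by (metis Pair_inject insertE restrict_apply')
      ultimately show "W = W'" by (rule PiE_ext)
    qed
    show "(\<lambda>W. (W a, restrict W I)) ` dense_boxes (insert a I) d c \<J> \<subseteq> ?X \<union> (\<Union>u\<in>a - U. ?Y u)"
    proof (intro image_subsetI)
      fix W assume W: "W \<in> dense_boxes (insert a I) d c \<J>"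
      then have "W \<in> boxes (insert a I) d" by (simp add: dense_boxes_def)
      then have "W a \<in> nsets a d" "restrict W I \<in> boxes I d" by (auto simp: boxes_def PiE_def)
      moreover have "W a \<subseteq> a" using calculation(1) by (simp add: nsets_def)
      ultimately show "(W a, restrict W I) \<in> ?X \<union> (\<Union>u\<in>a - U. ?Y u)"
        using dense_box_cases[OF dis a(2) fin c d W, of U] by blast
    qed
  qed (use finX finY a(1) in auto)
  also have "\<dots> \<le> card ?X + (\<Sum>u\<in>a - U. card (?Y u))"
    using card_Un_le[of ?X "\<Union>u\<in>a - U. ?Y u"] card_UN_le[of "a - U" ?Y] a(1) by force
  finally show ?thesis by (simp add: card_cartesian_product)
qed

lemma sum_card_nsets_containing:
  assumes "finite a"
  shows "(\<Sum>u\<in>a. card {A\<in>nsets a d. u \<in> A}) = d * card (nsets a d)"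
proof -
  have fin: "finite (nsets a d)" using assms by (rule finite_imp_finite_nsets)
  have "(\<Sum>u\<in>a. card {A\<in>nsets a d. u \<in> A}) = card (SIGMA u:a. {A\<in>nsets a d. u \<in> A})"
    using assms fin by (subst card_SigmaI) auto
  also have "\<dots> = card (SIGMA A:nsets a d. A)"
    by (rule bij_betw_same_card[where f = prod.swap]) (auto simp: bij_betw_def inj_on_def image_def nsets_def)
  also have "\<dots> = (\<Sum>A\<in>nsets a d. card A)" using fin by (subst card_SigmaI) (auto simp: nsets_def)
  also have "\<dots> = (\<Sum>A\<in>nsets a d. d)" by (intro sum.cong) (auto simp: nsets_def)
  finally show ?thesis by simp
qed

lemma rarely_dense_mono:
  assumes "rarely_dense I n c \<rho> \<sigma>" "s \<le> \<sigma>" "0 \<le> n"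
  shows "rarely_dense I n c \<rho> s"
  unfolding rarely_dense_def
proof (intro allI impI)
  fix d :: nat and \<J> assume "1 \<le> d" "\<J> \<subseteq> transversals I (\<lambda>V. V)" "real (card \<J>) \<le> s * n ^ card I"
  moreover have "s * n ^ card I \<le> \<sigma> * n ^ card I" using assms(2,3) by (intro mult_right_mono) auto
  ultimately show "real (card (dense_boxes I d c \<J>)) \<le> \<rho> ^ d * (n ^ d / fact d) ^ card I"
    using assms(1) unfolding rarely_dense_def by (meson order_trans)
qed

lemma sum_dense_links_le:
  assumes a: "finite a" "real (card a) \<le> n" and n: "0 < n" and \<rho>: "0 < \<rho>"
    and dense: "\<And>u. u \<in> a - U \<Longrightarrow> real (D u) \<le> (\<rho> / 4) ^ d * (n ^ d / fact d) ^ j"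
  shows "(\<Sum>u\<in>a - U. real (card {A\<in>nsets a d. u \<in> A}) * real (D u)) \<le> (\<rho> / 2) ^ d * (n ^ d / fact d) ^ Suc j"
proof -
  let ?B = "(\<rho> / 4) ^ d * (n ^ d / fact d) ^ j"
  have "(\<Sum>u\<in>a - U. real (card {A\<in>nsets a d. u \<in> A}) * real (D u))
      \<le> (\<Sum>u\<in>a - U. real (card {A\<in>nsets a d. u \<in> A}) * ?B)"
    using dense by (intro sum_mono mult_left_mono) auto
  also have "\<dots> \<le> (\<Sum>u\<in>a. real (card {A\<in>nsets a d. u \<in> A}) * ?B)"
    using a(1) \<rho> n by (intro sum_mono2) auto
  also have "\<dots> = real (\<Sum>u\<in>a. card {A\<in>nsets a d. u \<in> A}) * ?B" by (simp add: sum_distrib_right)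
  also have "\<dots> = real d * real (card (nsets a d)) * ?B"
    unfolding sum_card_nsets_containing[OF a(1)] by simp
  also have "\<dots> \<le> 2 ^ d * (n ^ d / fact d) * ?B"
  proof (intro mult_right_mono mult_mono card_nsets_le a(2))
    have "real d \<le> real (2 ^ d)" by (simp only: of_nat_le_iff less_imp_le[OF less_exp])
    then show "real d \<le> 2 ^ d" by simp
  qed (use \<rho> n in auto)
  also have "\<dots> = (2 * (\<rho> / 4)) ^ d * (n ^ d / fact d) ^ Suc j" unfolding power_mult_distrib by simp
  finally show ?thesis by simp
qed

lemma rarely_dense_insert:
  assumes I: "finite (insert a I)" "disjoint (insert a I)" "a \<notin> I"
    and sizes: "\<forall>V\<in>insert a I. finite V \<and> real (card V) \<le> n" and n: "0 < n"
    and c: "0 < c" and \<rho>: "0 < \<rho>" and s: "0 < s" "s \<le> 1" "s powr (c / 2) \<le> \<rho> / 4"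
    and links: "rarely_dense I n (c / 2) (\<rho> / 4) s"
  shows "rarely_dense (insert a I) n c \<rho> (s\<^sup>2)"
  unfolding rarely_dense_def
proof (intro allI impI)
  fix d :: nat and \<J> assume d: "1 \<le> d" and \<J>: "\<J> \<subseteq> transversals (insert a I) (\<lambda>V. V)"
    and few: "real (card \<J>) \<le> s\<^sup>2 * n ^ card (insert a I)"
  let ?j = "card I" and ?X = "n ^ d / fact d"
  have fin: "finite I" "\<forall>V\<in>I. finite V" "finite a" "real (card a) \<le> n" using I sizes by auto
  have dis: "\<forall>V\<in>I. a \<inter> V = {}" "disjoint_family_on (\<lambda>V. V) I"
    using I(2,3) by (auto simp: disjoint_def disjoint_family_on_def)
  define U where "U = {u\<in>a. s * n ^ ?j < real (card (link I \<J> u))}"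
  have "real (card U) * (s * n ^ ?j) = (\<Sum>u\<in>U. s * n ^ ?j)" by simp
  also have "\<dots> \<le> (\<Sum>u\<in>U. real (card (link I \<J> u)))" by (rule sum_mono) (auto simp: U_def)
  also have "\<dots> \<le> real (card \<J>)"
    using sum_card_link_le[OF I _ \<J>, of U] sizes by (simp add: U_def flip: of_nat_sum)
  also have "\<dots> \<le> s * n * (s * n ^ ?j)" using few I by (simp add: power2_eq_square mult_ac)
  finally have U_small: "real (card U) \<le> s * n" using s(1) n by (simp add: mult.commute)
  have first: "real (card {A\<in>nsets a d. c * real d / 2 \<le> real (card (A \<inter> U))}) * real (card (boxes I d))
      \<le> (\<rho> / 2) ^ d * ?X * ?X ^ ?j"
    using fin sizes n \<rho> U_small s c
    by (intro mult_mono card_nsets_large_fraction_le card_boxes_le) (auto simp: U_def)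
  have rest: "(\<Sum>u\<in>a - U. real (card {A\<in>nsets a d. u \<in> A}) * real (card (dense_boxes I d (c / 2) (link I \<J> u))))
      \<le> (\<rho> / 2) ^ d * ?X ^ Suc ?j"
  proof (rule sum_dense_links_le[OF fin(3,4) n \<rho>])
    fix u assume "u \<in> a - U"
    then have "real (card (link I \<J> u)) \<le> s * n ^ ?j" by (auto simp: U_def)
    then show "real (card (dense_boxes I d (c / 2) (link I \<J> u))) \<le> (\<rho> / 4) ^ d * ?X ^ ?j"
      using links d unfolding rarely_dense_def by (auto simp: link_def)
  qed
  have "real (card (dense_boxes (insert a I) d c \<J>))
      \<le> real (card {A\<in>nsets a d. c * real d / 2 \<le> real (card (A \<inter> U))} * card (boxes I d)
        + (\<Sum>u\<in>a - U. card {A\<in>nsets a d. u \<in> A} * card (dense_boxes I d (c / 2) (link I \<J> u))))"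
    using card_dense_boxes_insert_le[OF dis fin(3) I(3) fin(1,2) c d] by (simp only: of_nat_le_iff)
  also have "\<dots> \<le> (\<rho> / 2) ^ d * ?X * ?X ^ ?j + (\<rho> / 2) ^ d * ?X ^ Suc ?j"
    using add_mono[OF first rest] by (simp only: of_nat_add of_nat_mult of_nat_sum)
  also have "\<dots> = 2 * (\<rho> / 2) ^ d * ?X ^ Suc ?j" by simp
  also have "\<dots> \<le> \<rho> ^ d * ?X ^ Suc ?j"
  proof (rule mult_right_mono)
    have "2 * (\<rho> / 2) ^ d \<le> 2 ^ d * (\<rho> / 2) ^ d"
      using d \<rho> power_increasing[of 1 d "2::real"] by (intro mult_right_mono) auto
    then show "2 * (\<rho> / 2) ^ d \<le> \<rho> ^ d" by (simp flip: power_mult_distrib)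
  qed (use n in simp)
  finally show "real (card (dense_boxes (insert a I) d c \<J>)) \<le> \<rho> ^ d * ?X ^ card (insert a I)"
    using I by simp
qed

theorem ex_rarely_dense:
  assumes "0 < c" "0 < \<rho>"
  shows "\<exists>\<sigma>>0. \<forall>(I :: 'a set set) n. finite I \<longrightarrow> card I = j \<longrightarrow> disjoint I \<longrightarrow>
    (\<forall>V\<in>I. finite V \<and> real (card V) \<le> n) \<longrightarrow> 0 < n \<longrightarrow> rarely_dense I n c \<rho> \<sigma>"
  using assms
proof (induction j arbitrary: c \<rho>)
  case 0
  have "rarely_dense ({} :: 'a set set) n c \<rho> (1 / 2)" for n
    unfolding rarely_dense_def
  proof (intro allI impI)
    fix d :: nat and \<J> :: "'a set set"
    assume "\<J> \<subseteq> transversals {} (\<lambda>V. V)" "real (card \<J>) \<le> 1 / 2 * n ^ card ({} :: 'a set set)"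
    then have "\<J> = {}" by (auto simp: transversals_empty dest: subset_singletonD)
    then have "dense_boxes {} d c \<J> = {}" using 0 by (simp add: dense_boxes_def)
    then show "real (card (dense_boxes {} d c \<J>)) \<le> \<rho> ^ d * (n ^ d / fact d) ^ card ({} :: 'a set set)"
      using 0 by simp
  qed
  then show ?case by (intro exI[of _ "1 / 2"]) auto
next
  case (Suc j)
  have "0 < c / 2" "0 < \<rho> / 4" using Suc.prems by auto
  from Suc.IH[OF this] obtain \<sigma> where \<sigma>: "\<sigma> > 0"
    and IH: "\<And>(I :: 'a set set) n. finite I \<Longrightarrow> card I = j \<Longrightarrow> disjoint I \<Longrightarrow>
      \<forall>V\<in>I. finite V \<and> real (card V) \<le> n \<Longrightarrow> 0 < n \<Longrightarrow> rarely_dense I n (c / 2) (\<rho> / 4) \<sigma>"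
    by blast
  define s where "s = min (min \<sigma> 1) ((\<rho> / 4) powr (2 / c))"
  have s: "0 < s" "s \<le> \<sigma>" "s \<le> 1" using \<sigma> Suc.prems by (auto simp: s_def)
  have s_powr: "s powr (c / 2) \<le> \<rho> / 4"
  proof -
    have "s powr (c / 2) \<le> ((\<rho> / 4) powr (2 / c)) powr (c / 2)"
      using s Suc.prems by (intro powr_mono2) (auto simp: s_def)
    then show ?thesis using Suc.prems by (simp add: powr_powr)
  qed
  have "rarely_dense I n c \<rho> (s\<^sup>2)"
    if I: "finite I" "card I = Suc j" "disjoint I" "\<forall>V\<in>I. finite V \<and> real (card V) \<le> n" "0 < n"
    for I :: "'a set set" and n
  proof -
    obtain a I' where "I = insert a I'" "a \<notin> I'" "card I' = j" using I(2) card_Suc_eq[of I j] by auto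
    moreover have "rarely_dense I' n (c / 2) (\<rho> / 4) \<sigma>"
      using calculation I by (intro IH) (auto simp: disjoint_def)
    moreover have "rarely_dense I' n (c / 2) (\<rho> / 4) s"
      using rarely_dense_mono[OF calculation(4) s(2)] I(5) by simp
    ultimately show ?thesis
      using rarely_dense_insert[of a I' n c \<rho> s] I s s_powr Suc.prems by simp
  qed
  then show ?case using s by (intro exI[of _ "s\<^sup>2"]) auto
qed

section \<open>Greedy families of transversals\<close>

definition codegree :: "'a set set \<Rightarrow> 'a set \<Rightarrow> nat" where
  "codegree \<S> J = card {S\<in>\<S>. J \<subseteq> S}"

definition heavy :: "(nat \<Rightarrow> real) \<Rightarrow> 'a set set \<Rightarrow> 'a set \<Rightarrow> bool" where
  "heavy \<kappa> \<S> S \<longleftrightarrow> (\<exists>J\<subseteq>S. 2 \<le> card J \<and> \<kappa> (card J) / 2 < real (codegree \<S> J))"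

definition capped :: "(nat \<Rightarrow> real) \<Rightarrow> 'a set set \<Rightarrow> bool" where
  "capped \<kappa> \<S> \<longleftrightarrow>
    (\<forall>J. 2 \<le> card J \<longrightarrow> (\<exists>S\<in>\<S>. J \<subseteq> S) \<longrightarrow> real (codegree \<S> J) \<le> 1 + \<kappa> (card J))"

lemma sum_codegree_le:
  assumes "finite \<S>" "\<forall>S\<in>\<S>. finite S \<and> card S = r" "finite H"
  shows "(\<Sum>J\<in>H. codegree \<S> J) \<le> 2 ^ r * card \<S>"
proof -
  have "(\<Sum>J\<in>H. codegree \<S> J) = card (SIGMA J:H. {S\<in>\<S>. J \<subseteq> S})"
    unfolding codegree_def using assms by (subst card_SigmaI) auto
  also have "\<dots> \<le> card (SIGMA S:\<S>. Pow S)"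
    by (rule card_inj_on_le[where f = prod.swap]) (use assms in \<open>auto intro!: finite_SigmaI\<close>)
  also have "\<dots> = (\<Sum>S\<in>\<S>. card (Pow S))" using assms by (subst card_SigmaI) auto
  also have "\<dots> = 2 ^ r * card \<S>" using assms by (simp add: card_Pow)
  finally show ?thesis .
qed

definition crowded_sets :: "(nat \<Rightarrow> real) \<Rightarrow> 'a set set \<Rightarrow> 'a set set" where
  "crowded_sets \<kappa> \<S> = {J \<in> (\<Union>S\<in>\<S>. Pow S). 2 \<le> card J \<and> \<kappa> (card J) / 2 < real (codegree \<S> J)}"

context
  fixes I :: "'i set" and W :: "'i \<Rightarrow> 'a set" and \<S> :: "'a set set"
    and r :: nat and l \<theta> :: real and \<kappa> :: "nat \<Rightarrow> real"
  assumes I: "finite I" "card I = r" and dis: "disjoint_family_on W I" and W: "\<forall>i\<in>I. finite (W i)"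
    and l: "\<forall>i\<in>I. l \<le> real (card (W i))" "0 < l"
    and \<S>: "finite \<S>" "\<forall>S\<in>\<S>. finite S \<and> card S = r"
    and \<kappa>: "\<And>j. 2 \<le> j \<Longrightarrow> j \<le> r \<Longrightarrow> 0 < \<kappa> j \<and> 2 ^ Suc r * real (card \<S>) \<le> \<theta> * (\<kappa> j * l ^ j)"
    and \<theta>: "0 \<le> \<theta>"
begin

lemma card_transversals_containing_crowded:
  assumes J: "J \<in> crowded_sets \<kappa> \<S>"
  shows "real (card {S\<in>transversals I W. J \<subseteq> S}) * (2 ^ r * real (card \<S>))
    \<le> \<theta> * (\<Prod>i\<in>I. real (card (W i))) * real (codegree \<S> J)"
proof -
  let ?k = "\<kappa> (card J)" and ?l = "l ^ card J" and ?c = "real (card {S\<in>transversals I W. J \<subseteq> S})"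
    and ?total = "\<Prod>i\<in>I. real (card (W i))"
  have J_card: "2 \<le> card J" "card J \<le> r"
    using J \<S>(2) card_mono by (fastforce simp: crowded_sets_def)+
  have "?c * ?l \<le> ?total"
    using card_transversals_containing[OF I(1) dis W l(1)] l(2) by simp
  moreover have "?k \<le> 2 * real (codegree \<S> J)" using J by (simp add: crowded_sets_def)
  ultimately have "?c * ?l * ?k \<le> ?total * (2 * real (codegree \<S> J))"
    using \<kappa>[OF J_card] by (intro mult_mono) (auto intro: prod_nonneg)
  then have "\<theta> * (?c * ?l * ?k) \<le> \<theta> * (?total * (2 * real (codegree \<S> J)))"
    using \<theta> by (rule mult_left_mono)
  moreover have "?c * (2 ^ Suc r * real (card \<S>)) \<le> ?c * (\<theta> * (?k * ?l))"
    using \<kappa>[OF J_card] by (intro mult_left_mono) auto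
  ultimately show ?thesis by (simp add: algebra_simps)
qed

lemma heavy_transversal_contains_crowded:
  assumes S: "S \<in> transversals I W" "heavy \<kappa> \<S> S"
  shows "\<exists>J\<in>crowded_sets \<kappa> \<S>. J \<subseteq> S"
proof -
  obtain J where J: "J \<subseteq> S" "2 \<le> card J" "\<kappa> (card J) / 2 < real (codegree \<S> J)"
    using S(2) by (auto simp: heavy_def)
  have "card J \<le> r" using card_mono[OF _ J(1)] transversal_finite_card[OF I(1) dis S(1)] I(2) by simp
  then have "0 < codegree \<S> J" using \<kappa>[OF J(2)] J(3) by (intro gr0I) auto
  then have "{S'\<in>\<S>. J \<subseteq> S'} \<noteq> {}" unfolding codegree_def by (metis card.empty less_irrefl)
  then show ?thesis using J by (intro bexI[of _ J]) (auto simp: crowded_sets_def)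
qed

lemma card_heavy_transversals_le:
  "real (card {S\<in>transversals I W. heavy \<kappa> \<S> S}) \<le> \<theta> * (\<Prod>i\<in>I. real (card (W i)))"
proof -
  let ?H = "crowded_sets \<kappa> \<S>" and ?above = "\<lambda>J. {S\<in>transversals I W. J \<subseteq> S}"
    and ?total = "\<Prod>i\<in>I. real (card (W i))"
  have H: "finite ?H" unfolding crowded_sets_def using \<S> by auto
  have total: "0 \<le> ?total" by (intro prod_nonneg) auto
  have "card {S\<in>transversals I W. heavy \<kappa> \<S> S} \<le> (\<Sum>J\<in>?H. card (?above J))"
    using H finite_transversals[OF I(1) dis W] heavy_transversal_contains_crowded
    by (intro order_trans[OF card_mono card_UN_le]) auto
  then have heavy: "real (card {S\<in>transversals I W. heavy \<kappa> \<S> S}) \<le> (\<Sum>J\<in>?H. real (card (?above J)))"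
    by (simp only: of_nat_sum[symmetric] of_nat_le_iff)
  show ?thesis
  proof (cases "\<S> = {}")
    case True
    then show ?thesis using heavy total \<theta> by (simp add: crowded_sets_def)
  next
    case False
    then have pos: "0 < 2 ^ r * real (card \<S>)" using \<S> by (simp add: card_gt_0_iff)
    have "real (card {S\<in>transversals I W. heavy \<kappa> \<S> S}) * (2 ^ r * real (card \<S>))
        \<le> (\<Sum>J\<in>?H. real (card (?above J)) * (2 ^ r * real (card \<S>)))"
      using heavy pos by (simp add: sum_distrib_right[symmetric] mult_right_mono)
    also have "\<dots> \<le> (\<Sum>J\<in>?H. \<theta> * ?total * real (codegree \<S> J))"
      by (intro sum_mono card_transversals_containing_crowded)
    also have "\<dots> = \<theta> * ?total * real (\<Sum>J\<in>?H. codegree \<S> J)" by (simp add: sum_distrib_left)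
    also have "\<dots> \<le> \<theta> * ?total * real (2 ^ r * card \<S>)"
      using \<theta> total sum_codegree_le[OF \<S> H]
      by (intro mult_left_mono) (simp_all only: of_nat_le_iff mult_nonneg_nonneg)
    finally show ?thesis unfolding of_nat_mult of_nat_power of_nat_numeral
      by (rule mult_right_le_imp_le[OF _ pos])
  qed
qed

end

lemma codegree_le_of_not_heavy:
  assumes "finite \<S>" "finite \<N>" "\<not> heavy \<kappa> \<S> S" "\<not> heavy \<kappa> \<N> S" "J \<subseteq> S" "2 \<le> card J"
  shows "real (codegree (\<S> \<union> \<N>) J) \<le> \<kappa> (card J)"
proof -
  have "{S\<in>\<S> \<union> \<N>. J \<subseteq> S} = {S\<in>\<S>. J \<subseteq> S} \<union> {S\<in>\<N>. J \<subseteq> S}" by auto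
  then have "codegree (\<S> \<union> \<N>) J \<le> codegree \<S> J + codegree \<N> J" by (simp add: codegree_def card_Un_le)
  then have "real (codegree (\<S> \<union> \<N>) J) \<le> real (codegree \<S> J) + real (codegree \<N> J)" by linarith
  moreover have "real (codegree \<S> J) \<le> \<kappa> (card J) / 2" "real (codegree \<N> J) \<le> \<kappa> (card J) / 2"
    using assms unfolding heavy_def by (meson not_le)+
  ultimately show ?thesis by linarith
qed

lemma capped_insert:
  assumes "finite \<S>" "capped \<kappa> \<S>" "S \<notin> \<S>"
    and low: "\<And>J. J \<subseteq> S \<Longrightarrow> 2 \<le> card J \<Longrightarrow> real (codegree \<S> J) \<le> \<kappa> (card J)"
  shows "capped \<kappa> (insert S \<S>)"
  unfolding capped_def
proof (intro allI impI)
  fix J assume J: "2 \<le> card J" "\<exists>S'\<in>insert S \<S>. J \<subseteq> S'"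
  show "real (codegree (insert S \<S>) J) \<le> 1 + \<kappa> (card J)"
  proof (cases "J \<subseteq> S")
    case True
    then have "{S'\<in>insert S \<S>. J \<subseteq> S'} = insert S {S'\<in>\<S>. J \<subseteq> S'}" by auto
    then have "codegree (insert S \<S>) J = Suc (codegree \<S> J)" using assms(1,3) by (simp add: codegree_def)
    then show ?thesis using low[OF True J(1)] by simp
  next
    case False
    then have "{S'\<in>insert S \<S>. J \<subseteq> S'} = {S'\<in>\<S>. J \<subseteq> S'}" by auto
    then show ?thesis using assms(2) J False by (auto simp: capped_def codegree_def)
  qed
qed

text \<open>The cap on the number of members containing \<open>j\<close> given vertices under which the correlations in
  Janson's inequality are negligible.\<close>

definition codegree_cap :: "nat \<Rightarrow> real \<Rightarrow> nat \<Rightarrow> real" where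
  "codegree_cap r p j = 1 / 2 ^ r * p ^ (j choose 2) / p ^ (r choose 2)"

lemma codegree_cap_pos: "0 < p \<Longrightarrow> 0 < codegree_cap r p j"
  by (simp add: codegree_cap_def)

context multipartite
begin

lemma disjoint_box: "W \<in> boxes P d \<Longrightarrow> disjoint_family_on W P"
  using boxD(1) by (intro disjoint_family_on_subset[OF disjoint_parts[OF order_refl]])

lemma box_transversals:
  assumes "W \<in> boxes P d"
  shows "finite (transversals P W)" "card (transversals P W) = d ^ r"
      "transversals P W \<subseteq> transversals P (\<lambda>V. V)"
proof -
  show "finite (transversals P W)" "card (transversals P W) = d ^ r"
    using transversals_count[OF finite_P disjoint_box[OF assms]] boxD[OF assms] card_P by auto
  show "transversals P W \<subseteq> transversals P (\<lambda>V. V)"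
    using boxD(1)[OF assms] by (intro transversals_mono disjoint_parts) auto
qed

lemma full_transversal:
  assumes "S \<in> transversals P (\<lambda>V. V)"
  shows "finite S" "card S = r" "S \<subseteq> \<Union>P"
  using transversal_finite_card[OF finite_P disjoint_parts[OF order_refl] assms] card_P assms
  by (auto simp: transversals_def)

lemma prob_no_clique_in_family_le:
  assumes p: "0 < p" "p \<le> 1" and \<S>: "\<S> \<subseteq> transversals P (\<lambda>V. V)" and cap: "capped (codegree_cap r p) \<S>"
  shows "\<P>(R in random_subset (cross_pairs P (\<Union>P)) (\<lambda>_. p). \<forall>S\<in>\<S>. \<not> cross_pairs P S \<subseteq> R)
    \<le> exp (- (1 / 2 * (real (card \<S>) * p ^ (r choose 2))))"
proof -
  have fin: "finite \<S>"
    using \<S> finite_transversals[OF finite_P disjoint_parts[OF order_refl]] finite_part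
    by (auto intro: finite_subset)
  have cross: "card (cross_pairs P J) = card J choose 2" if "S \<in> \<S>" "J \<subseteq> S" for S J
    using cross_pairs_transversal[of S J] that \<S> by auto
  have "\<P>(R in random_subset (cross_pairs P (\<Union>P)) (\<lambda>_. p). \<forall>S\<in>\<S>. \<not> cross_pairs P S \<subseteq> R)
    \<le> exp (- ((1 - 2 ^ r * (1 / 2 ^ r) / 2) * (sum (\<lambda>_. 1) \<S> * p ^ (r choose 2))))"
  proof (rule janson_cliques[OF fin p, where A = "\<lambda>S. S"])
    show "S \<subseteq> \<Union>P \<and> card S = r \<and> card (cross_pairs P S) = r choose 2" if "S \<in> \<S>" for S
      using full_transversal[of S] cross[OF that order_refl] that \<S> by auto
    fix S J assume S: "S \<in> \<S>" and J: "J \<subset> S" "cross_pairs P J \<noteq> {}"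
    let ?t = "p ^ (r choose 2) / p ^ (card J choose 2)"
    have "finite J" using full_transversal(1)[of S] S \<S> J(1) by (auto intro: finite_subset)
    moreover obtain f where "f \<in> nsets J 2" using J(2) by (auto simp: cross_pairs_def)
    ultimately have J2: "2 \<le> card J" using card_mono[of J f] by (auto simp: nsets_def)
    have "{S'\<in>\<S>. J \<subseteq> S'} = insert S {S'\<in>\<S> - {S}. J \<subseteq> S'}" using S J(1) by auto
    then have "codegree \<S> J = Suc (card {S'\<in>\<S> - {S}. J \<subseteq> S'})" using fin by (simp add: codegree_def)
    moreover have "real (codegree \<S> J) \<le> 1 + codegree_cap r p (card J)"
      using cap J2 S J(1) unfolding capped_def by blast
    ultimately have "real (card {S'\<in>\<S> - {S}. J \<subseteq> S'}) * ?t \<le> codegree_cap r p (card J) * ?t"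
      using p by (intro mult_right_mono) auto
    also have "\<dots> = 1 / 2 ^ r" using p by (simp add: codegree_cap_def)
    finally show "(\<Sum>S'\<in>{S'\<in>\<S> - {S}. J \<subseteq> S'}. 1 * p ^ (r choose 2) / p ^ card (cross_pairs P J)) \<le> 1 / 2 ^ r"
      using cross[OF S] J(1) by auto
  qed auto
  then show ?thesis by simp
qed

lemma ex_light_transversal:
  assumes W: "W \<in> boxes P d" and d: "1 \<le> d" and \<N>: "\<N> \<subseteq> transversals P W" "card \<N> \<le> N"
    and cap: "\<And>j. 2 \<le> j \<Longrightarrow> j \<le> r \<Longrightarrow> 0 < \<kappa> j \<and> 2 ^ Suc r * real N \<le> 1 / 2 * (\<kappa> j * real d ^ j)"
    and few: "real (card {S\<in>transversals P W. heavy \<kappa> \<S> S}) < 1 / 2 * real d ^ r"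
  shows "\<exists>S\<in>transversals P W. \<not> heavy \<kappa> \<S> S \<and> \<not> heavy \<kappa> \<N> S"
proof -
  let ?old = "{S\<in>transversals P W. heavy \<kappa> \<S> S}" and ?own = "{S\<in>transversals P W. heavy \<kappa> \<N> S}"
  have "real (card ?own) \<le> 1 / 2 * (\<Prod>V\<in>P. real (card (W V)))"
  proof (rule card_heavy_transversals_le[OF finite_P card_P disjoint_box[OF W], where l = "real d"])
    show "finite \<N>" using \<N>(1) box_transversals(1)[OF W] by (rule finite_subset)
    show "\<forall>S\<in>\<N>. finite S \<and> card S = r"
      using transversal_finite_card[OF finite_P disjoint_box[OF W]] \<N>(1) card_P by auto
    fix j assume j: "2 \<le> j" "j \<le> r"
    have "2 ^ Suc r * real (card \<N>) \<le> 2 ^ Suc r * real N" using \<N>(2) by simp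
    then show "0 < \<kappa> j \<and> 2 ^ Suc r * real (card \<N>) \<le> 1 / 2 * (\<kappa> j * real d ^ j)" using cap[OF j] by linarith
  qed (use boxD[OF W] d in auto)
  then have "real (card ?own) \<le> 1 / 2 * real d ^ r" using boxD(3)[OF W] card_P by simp
  moreover have "real (card (?old \<union> ?own)) \<le> real (card ?old) + real (card ?own)"
    by (simp only: of_nat_add[symmetric] of_nat_le_iff card_Un_le)
  moreover have "real (card (transversals P W)) = real d ^ r" using box_transversals(2)[OF W] by simp
  ultimately have "real (card (?old \<union> ?own)) < real (card (transversals P W))" using few by linarith
  then have "?old \<union> ?own \<noteq> transversals P W" by (metis less_irrefl)
  then show ?thesis by blast
qed

lemma ex_capped_extension:
  assumes W: "W \<in> boxes P d" and d: "1 \<le> d"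
    and \<S>: "finite \<S>" "capped \<kappa> \<S>"
    and cap: "\<And>j. 2 \<le> j \<Longrightarrow> j \<le> r \<Longrightarrow> 0 < \<kappa> j \<and> 2 ^ Suc r * real N \<le> 1 / 2 * (\<kappa> j * real d ^ j)"
    and cap_r: "\<kappa> r < 1"
    and few: "real (card {S\<in>transversals P W. heavy \<kappa> \<S> S}) < 1 / 2 * real d ^ r"
    and M: "M \<le> N"
  shows "\<exists>\<S>'. \<S> \<subseteq> \<S>' \<and> \<S>' \<subseteq> \<S> \<union> transversals P W \<and> capped \<kappa> \<S>' \<and> card \<S>' = card \<S> + M"
  using M
proof (induction M)
  case 0
  then show ?case using \<S> by auto
next
  case (Suc M)
  then obtain \<S>' where \<S>': "\<S> \<subseteq> \<S>'" "\<S>' \<subseteq> \<S> \<union> transversals P W" "capped \<kappa> \<S>'" "card \<S>' = card \<S> + M"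
    by auto
  have fin: "finite \<S>'" using \<S>'(2) \<S>(1) box_transversals(1)[OF W] by (auto intro: finite_subset)
  have "\<S>' - \<S> \<subseteq> transversals P W" "card (\<S>' - \<S>) \<le> N"
    using \<S>' \<S>(1) Suc.prems by (auto simp: card_Diff_subset)
  from ex_light_transversal[OF W d this cap few] obtain S
    where S: "S \<in> transversals P W" "\<not> heavy \<kappa> \<S> S" "\<not> heavy \<kappa> (\<S>' - \<S>) S" by blast
  have low: "real (codegree \<S>' J) \<le> \<kappa> (card J)" if "J \<subseteq> S" "2 \<le> card J" for J
    using codegree_le_of_not_heavy[OF \<S>(1) _ S(2,3) that] fin \<S>'(1) by (simp add: Un_absorb1)
  have "S \<notin> \<S>'"
  proof
    assume "S \<in> \<S>'"
    then have "0 < codegree \<S>' S" using fin unfolding codegree_def card_gt_0_iff by auto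
    moreover have "card S = r"
      using transversal_finite_card[OF finite_P disjoint_box[OF W] S(1)] card_P by simp
    ultimately show False using low[of S] parts_ge_2 cap_r by auto
  qed
  then have "capped \<kappa> (insert S \<S>')" using capped_insert[OF fin \<S>'(3)] low by blast
  then show ?case
    using \<S>' S(1) \<open>S \<notin> \<S>'\<close> fin by (intro exI[of _ "insert S \<S>'"]) auto
qed

end

lemma sum_foldl_le:
  fixes f :: "'s \<Rightarrow> 'w \<Rightarrow> 's" and \<Phi> :: "'s \<Rightarrow> real"
  assumes K: "0 \<le> K"
    and ok: "\<And>k s w. Ok (Suc k) s \<Longrightarrow> w \<in> A \<Longrightarrow> Ok k (f s w)"
    and step: "\<And>k s. Ok (Suc k) s \<Longrightarrow> (\<Sum>w\<in>A. \<Phi> (f s w)) \<le> K * \<Phi> s"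
  shows "distinct ys \<Longrightarrow> Ok (length ys) s \<Longrightarrow>
    (\<Sum>B\<in>PiE (set ys) (\<lambda>_. A). \<Phi> (foldl (\<lambda>s v. f s (B v)) s ys)) \<le> K ^ length ys * \<Phi> s"
proof (induction ys arbitrary: s)
  case Nil
  then show ?case by simp
next
  case (Cons v ys)
  have fold: "foldl (\<lambda>s x. f s (if x = v then w else B x)) t ys = foldl (\<lambda>s x. f s (B x)) t ys" for B w t
    using Cons.prems(1) by (intro foldl_cong) auto
  have "(\<Sum>B\<in>PiE (set (v # ys)) (\<lambda>_. A). \<Phi> (foldl (\<lambda>s v. f s (B v)) s (v # ys)))
      = (\<Sum>(w, B)\<in>A \<times> PiE (set ys) (\<lambda>_. A). \<Phi> (foldl (\<lambda>s v. f s (B v)) (f s w) ys))"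
    using Cons.prems(1) inj_combinator[of v "set ys" "\<lambda>_. A"] unfolding list.set PiE_insert_eq
    by (subst sum.reindex) (auto simp: fold intro!: sum.cong)
  also have "\<dots> = (\<Sum>w\<in>A. \<Sum>B\<in>PiE (set ys) (\<lambda>_. A). \<Phi> (foldl (\<lambda>s v. f s (B v)) (f s w) ys))"
    by (rule sum.cartesian_product[symmetric])
  also have "\<dots> \<le> (\<Sum>w\<in>A. K ^ length ys * \<Phi> (f s w))"
    using Cons ok by (intro sum_mono) auto
  also have "\<dots> = K ^ length ys * (\<Sum>w\<in>A. \<Phi> (f s w))" by (simp add: sum_distrib_left)
  also have "\<dots> \<le> K ^ length ys * (K * \<Phi> s)"
    using step[of "length ys" s] Cons.prems(2) K by (intro mult_left_mono) auto
  finally show ?case by (simp add: mult_ac)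
qed

locale greedy_transversals = multipartite P r for P :: "'a set set" and r +
  fixes n p \<rho> \<sigma> :: real and d N :: nat
  assumes n_pos: "0 < n" and p_pos: "0 < p" and p_le_1: "p \<le> 1"
    and d_ge_1: "1 \<le> d" and \<rho>_pos: "0 < \<rho>" and \<sigma>_pos: "0 < \<sigma>"
    and part_ge: "V \<in> P \<Longrightarrow> n / (2 * real r) \<le> real (card V)"
    and part_le: "V \<in> P \<Longrightarrow> real (card V) \<le> n"
    and rare: "rarely_dense P n (1 / 2) \<rho> \<sigma>"
    and room_in_box: "2 \<le> j \<Longrightarrow> j \<le> r \<Longrightarrow> 2 ^ Suc r * real N \<le> 1 / 2 * (codegree_cap r p j * real d ^ j)"
begin

definition room_for :: "nat \<Rightarrow> bool" where
  "room_for y \<longleftrightarrow> (\<forall>j. 2 \<le> j \<longrightarrow> j \<le> r \<longrightarrow>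
    2 ^ Suc r * (real y * real N) \<le> \<sigma> * (codegree_cap r p j * (n / (2 * real r)) ^ j))"

definition extends_by :: "'a set set \<Rightarrow> ('a set \<Rightarrow> 'a set) \<Rightarrow> 'a set set \<Rightarrow> bool" where
  "extends_by \<S> W \<S>' \<longleftrightarrow>
    \<S> \<subseteq> \<S>' \<and> \<S>' \<subseteq> \<S> \<union> transversals P W \<and> capped (codegree_cap r p) \<S>' \<and> card \<S>' = card \<S> + N"

definition extend :: "'a set set \<Rightarrow> ('a set \<Rightarrow> 'a set) \<Rightarrow> 'a set set" where
  "extend \<S> W = (if \<exists>\<S>'. extends_by \<S> W \<S>' then SOME \<S>'. extends_by \<S> W \<S>' else \<S>)"

definition greedy_family :: "'b list \<Rightarrow> ('b \<Rightarrow> 'a set \<Rightarrow> 'a set) \<Rightarrow> 'a set set" where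
  "greedy_family ys B = foldl (\<lambda>\<S> v. extend \<S> (B v)) {} ys"

definition half_mean :: "'a set set \<Rightarrow> real" where
  "half_mean \<S> = 1 / 2 * (real (card \<S>) * p ^ (r choose 2))"

definition box_sum_bound :: "real \<Rightarrow> real" where
  "box_sum_bound b = (\<rho> ^ d + exp (- (b * (1 / 2 * (real N * p ^ (r choose 2)))))) * (n ^ d / fact d) ^ r"

lemma box_sum_bound_nonneg: "0 \<le> box_sum_bound b"
  unfolding box_sum_bound_def using \<rho>_pos n_pos by (intro mult_nonneg_nonneg add_nonneg_nonneg) auto

definition admissible :: "nat \<Rightarrow> 'a set set \<Rightarrow> bool" where
  "admissible y \<S> \<longleftrightarrow> \<S> \<subseteq> transversals P (\<lambda>V. V) \<and> capped (codegree_cap r p) \<S> \<and> card \<S> \<le> y * N"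

lemma extend_cases: "extends_by \<S> W (extend \<S> W) \<or> ((\<nexists>\<S>'. extends_by \<S> W \<S>') \<and> extend \<S> W = \<S>)"
  unfolding extend_def by (cases "\<exists>\<S>'. extends_by \<S> W \<S>'") (auto intro: someI_ex)

lemma extend:
  shows extend_subset: "extend \<S> W \<subseteq> \<S> \<union> transversals P W"
    and card_extend_ge: "card \<S> \<le> card (extend \<S> W)"
    and card_extend_le: "card (extend \<S> W) \<le> card \<S> + N"
    and capped_extend: "capped (codegree_cap r p) \<S> \<Longrightarrow> capped (codegree_cap r p) (extend \<S> W)"
  using extend_cases[of \<S> W] by (auto simp: extends_by_def)

lemma finite_admissible: "admissible y \<S> \<Longrightarrow> finite \<S>"
  using finite_transversals[OF finite_P disjoint_parts[OF order_refl]] finite_part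
  by (auto simp: admissible_def intro: finite_subset)

lemma admissible_extend:
  assumes "admissible y \<S>" "W \<in> boxes P d"
  shows "admissible (Suc y) (extend \<S> W)"
  using assms extend_subset[of \<S> W] box_transversals(3)[OF assms(2)] capped_extend[of \<S> W] card_extend_le[of \<S> W]
  by (auto simp: admissible_def)

lemma admissible_empty: "admissible 0 {}"
  by (simp add: admissible_def capped_def)

lemma admissible_greedy_family:
  assumes "\<And>v. v \<in> set ys \<Longrightarrow> B v \<in> boxes P d"
  shows "admissible (length ys) (greedy_family ys B) \<and> greedy_family ys B \<subseteq> (\<Union>v\<in>set ys. transversals P (B v))"
  using assms
proof (induction ys rule: rev_induct)
  case Nil
  then show ?case by (simp add: greedy_family_def admissible_empty)
next
  case (snoc v ys)
  then have "admissible (length ys) (greedy_family ys B)"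
    and "greedy_family ys B \<subseteq> (\<Union>v\<in>set ys. transversals P (B v))" by auto
  moreover have "greedy_family (ys @ [v]) B = extend (greedy_family ys B) (B v)"
    by (simp add: greedy_family_def)
  ultimately show ?case
    using admissible_extend snoc.prems extend_subset[of "greedy_family ys B" "B v"] by auto
qed

theorem prob_boxes_clique_free_le:
  assumes B: "\<And>v. v \<in> set ys \<Longrightarrow> B v \<in> boxes P d"
  shows "\<P>(R in random_subset (cross_pairs P (\<Union>P)) (\<lambda>_. p). \<forall>v\<in>set ys. box_clique_free (B v) R)
    \<le> exp (- half_mean (greedy_family ys B))"
proof -
  note greedy = admissible_greedy_family[of ys B, OF B]
  have "\<P>(R in random_subset (cross_pairs P (\<Union>P)) (\<lambda>_. p). \<forall>v\<in>set ys. box_clique_free (B v) R)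
      \<le> \<P>(R in random_subset (cross_pairs P (\<Union>P)) (\<lambda>_. p). \<forall>S\<in>greedy_family ys B. \<not> cross_pairs P S \<subseteq> R)"
    using greedy by (intro prob_random_subset_mono) (auto simp: box_clique_free_def)
  also have "\<dots> \<le> exp (- half_mean (greedy_family ys B))"
    unfolding half_mean_def using greedy
    by (intro prob_no_clique_in_family_le[OF p_pos p_le_1]) (auto simp: admissible_def)
  finally show ?thesis .
qed

lemma codegree_cap_less_1: "codegree_cap r p r < 1"
  using p_pos parts_ge_2 by (simp add: codegree_cap_def)

lemma extends_by_extend:
  assumes \<S>: "finite \<S>" "capped (codegree_cap r p) \<S>" and W: "W \<in> boxes P d"
    and light: "W \<notin> dense_boxes P d (1 / 2) {S\<in>transversals P (\<lambda>V. V). heavy (codegree_cap r p) \<S> S}"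
  shows "extends_by \<S> W (extend \<S> W)"
proof -
  have "{S\<in>transversals P (\<lambda>V. V). heavy (codegree_cap r p) \<S> S} \<inter> transversals P W
      = {S\<in>transversals P W. heavy (codegree_cap r p) \<S> S}"
    using box_transversals(3)[OF W] by auto
  then have "real (card {S\<in>transversals P W. heavy (codegree_cap r p) \<S> S}) < 1 / 2 * real d ^ r"
    using light W card_P by (simp add: dense_boxes_def)
  then have "\<exists>\<S>'. extends_by \<S> W \<S>'"
    unfolding extends_by_def using ex_capped_extension[OF W d_ge_1 \<S> _ codegree_cap_less_1 _ order_refl, of N]
      room_in_box codegree_cap_pos[OF p_pos] by auto
  then show ?thesis using extend_cases[of \<S> W] by blast
qed

lemma card_blocked_boxes_le:
  assumes \<S>: "admissible y \<S>" and y: "room_for y"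
  shows "real (card (dense_boxes P d (1 / 2) {S\<in>transversals P (\<lambda>V. V). heavy (codegree_cap r p) \<S> S}))
    \<le> \<rho> ^ d * (n ^ d / fact d) ^ r"
proof -
  let ?\<H> = "{S\<in>transversals P (\<lambda>V. V). heavy (codegree_cap r p) \<S> S}"
  have "real (card ?\<H>) \<le> \<sigma> * (\<Prod>V\<in>P. real (card V))"
  proof (rule card_heavy_transversals_le[OF finite_P card_P disjoint_parts[OF order_refl], where l = "n / (2 * real r)"])
    show "finite \<S>" by (rule finite_admissible[OF \<S>])
    show "\<forall>S\<in>\<S>. finite S \<and> card S = r" using \<S> full_transversal by (auto simp: admissible_def)
    fix j assume j: "2 \<le> j" "j \<le> r"
    have "real (card \<S>) \<le> real y * real N"
      using \<S> by (simp only: admissible_def of_nat_mult[symmetric] of_nat_le_iff)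
    then have "2 ^ Suc r * real (card \<S>) \<le> 2 ^ Suc r * (real y * real N)" by simp
    also have "\<dots> \<le> \<sigma> * (codegree_cap r p j * (n / (2 * real r)) ^ j)" using y j by (simp add: room_for_def)
    finally show "0 < codegree_cap r p j \<and> 2 ^ Suc r * real (card \<S>)
        \<le> \<sigma> * (codegree_cap r p j * (n / (2 * real r)) ^ j)"
      using codegree_cap_pos[OF p_pos] by simp
  qed (use part_ge finite_part n_pos parts_ge_2 \<sigma>_pos in auto)
  also have "\<dots> \<le> \<sigma> * n ^ r"
    using prod_mono[of P "\<lambda>V. real (card V)" "\<lambda>_. n"] part_le \<sigma>_pos card_P by (intro mult_left_mono) auto
  finally show ?thesis using rare d_ge_1 card_P unfolding rarely_dense_def by auto
qed

lemma sum_extend_le: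
  assumes \<S>: "admissible y \<S>" and y: "room_for y" and b: "0 \<le> b"
  shows "(\<Sum>W\<in>boxes P d. exp (- (b * half_mean (extend \<S> W)))) \<le> box_sum_bound b * exp (- (b * half_mean \<S>))"
proof -
  let ?X = "(n ^ d / fact d) ^ r" and ?old = "exp (- (b * half_mean \<S>))"
  let ?new = "exp (- (b * (1 / 2 * (real N * p ^ (r choose 2)))))"
  define blocked where
    "blocked = dense_boxes P d (1 / 2) {S\<in>transversals P (\<lambda>V. V). heavy (codegree_cap r p) \<S> S}"
  have fin: "finite (boxes P d)" using finite_boxes[OF finite_P] finite_part by blast
  have blocked: "blocked \<subseteq> boxes P d" "real (card blocked) \<le> \<rho> ^ d * ?X"
    using card_blocked_boxes_le[OF \<S> y] by (auto simp: blocked_def dense_boxes_def)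
  have "exp (- (b * half_mean (extend \<S> W))) \<le> ?new * ?old + (if W \<in> blocked then ?old else 0)"
    if W: "W \<in> boxes P d" for W
  proof (cases "W \<in> blocked")
    case True
    have "half_mean \<S> \<le> half_mean (extend \<S> W)"
      unfolding half_mean_def using card_extend_ge[of \<S> W] p_pos by (intro mult_left_mono mult_right_mono) auto
    then have "b * half_mean \<S> \<le> b * half_mean (extend \<S> W)" using b by (rule mult_left_mono)
    then have "exp (- (b * half_mean (extend \<S> W))) \<le> ?old" by simp
    then show ?thesis using True by (simp add: add_increasing)
  next
    case False
    then have "extends_by \<S> W (extend \<S> W)"
      using \<S> finite_admissible[OF \<S>] W by (intro extends_by_extend) (auto simp: blocked_def admissible_def)
    then have "half_mean (extend \<S> W) = half_mean \<S> + 1 / 2 * (real N * p ^ (r choose 2))"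
      by (simp add: half_mean_def extends_by_def algebra_simps add_divide_distrib)
    then have "exp (- (b * half_mean (extend \<S> W))) = ?new * ?old"
      by (simp add: exp_add[symmetric] algebra_simps)
    then show ?thesis using False by simp
  qed
  then have "(\<Sum>W\<in>boxes P d. exp (- (b * half_mean (extend \<S> W))))
      \<le> (\<Sum>W\<in>boxes P d. ?new * ?old + (if W \<in> blocked then ?old else 0))" by (rule sum_mono)
  also have "\<dots> = real (card (boxes P d)) * (?new * ?old) + real (card blocked) * ?old"
    using fin blocked(1) by (simp add: sum.distrib sum.If_cases Int_absorb1)
  also have "\<dots> \<le> ?X * (?new * ?old) + (\<rho> ^ d * ?X) * ?old"
    using blocked(2) card_boxes_le[OF finite_P, of n d] part_le card_P by (intro add_mono mult_right_mono) auto
  finally show ?thesis by (simp add: box_sum_bound_def algebra_simps)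
qed

theorem sum_greedy_families_le:
  assumes "distinct ys" "room_for (length ys)" "0 \<le> b"
  shows "(\<Sum>B\<in>PiE (set ys) (\<lambda>_. boxes P d). exp (- (b * half_mean (greedy_family ys B))))
      \<le> box_sum_bound b ^ length ys"
proof -
  let ?Ok = "\<lambda>k \<S>. \<exists>i. i + k = length ys \<and> admissible i \<S>"
  have room: "room_for i" if "i \<le> length ys" for i
  proof -
    have "real i * real N \<le> real (length ys) * real N" using that by (intro mult_right_mono) auto
    then have "2 ^ Suc r * (real i * real N) \<le> 2 ^ Suc r * (real (length ys) * real N)" by simp
    then show ?thesis using assms(2) unfolding room_for_def by (meson order_trans)
  qed
  have "(\<Sum>B\<in>PiE (set ys) (\<lambda>_. boxes P d). exp (- (b * half_mean (foldl (\<lambda>\<S> v. extend \<S> (B v)) {} ys))))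
      \<le> box_sum_bound b ^ length ys * exp (- (b * half_mean {}))"
  proof (rule sum_foldl_le[where Ok = ?Ok])
    show "0 \<le> box_sum_bound b" by (rule box_sum_bound_nonneg)
    show "?Ok k (extend \<S> W)" if "?Ok (Suc k) \<S>" "W \<in> boxes P d" for k \<S> W
      using admissible_extend[OF _ that(2)] that(1) by (metis add_Suc_right add_Suc)
    show "(\<Sum>W\<in>boxes P d. exp (- (b * half_mean (extend \<S> W)))) \<le> box_sum_bound b * exp (- (b * half_mean \<S>))"
      if "?Ok (Suc k) \<S>" for k \<S>
      using that room sum_extend_le[OF _ _ assms(3)] by force
    show "?Ok (length ys) {}" using admissible_empty by auto
  qed (rule assms(1))
  then show ?thesis by (simp add: greedy_family_def half_mean_def)
qed

end

section \<open>Graphs close to a partition\<close>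

lemma card_le_sum_fibres:
  assumes "finite I" "\<And>i. i \<in> I \<Longrightarrow> finite (D i)" "A \<subseteq> (\<Union>i\<in>I. f i ` D i)"
  shows "real (card A) \<le> (\<Sum>i\<in>I. real (card (D i)))"
proof -
  have "card A \<le> card (\<Union>i\<in>I. f i ` D i)" using assms by (intro card_mono) auto
  also have "\<dots> \<le> (\<Sum>i\<in>I. card (f i ` D i))" by (rule card_UN_le[OF assms(1)])
  also have "\<dots> \<le> (\<Sum>i\<in>I. card (D i))" using assms(2) by (intro sum_mono card_image_le)
  finally show ?thesis by (simp only: of_nat_sum[symmetric] of_nat_le_iff)
qed

lemma card_pairs_le:
  assumes "A \<subseteq> nsets {1..n} 2"
  shows "2 * real (card A) \<le> real n ^ 2"
proof -
  have "card A \<le> n choose 2"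
    using card_mono[OF finite_imp_finite_nsets assms] by simp
  then have "2 * card A \<le> n * n" unfolding choose_two by (cases n) auto
  then have "real (2 * card A) \<le> real (n * n)" by (simp only: of_nat_le_iff)
  then show ?thesis by (simp add: power2_eq_square)
qed

lemma inj_on_doubleton: "inj_on (\<lambda>u. {v, u}) A"
  by (auto simp: inj_on_def doubleton_eq_iff)

locale vertex_partition =
  fixes n r :: nat and P :: "nat set set"
  assumes P: "P \<in> r_partitions n r" and r_ge_2: "2 \<le> r"
begin

lemma Union_P: "\<Union>P = {1..n}"
  using P by (simp add: r_partitions_def)

lemma part_subset: "V \<in> P \<Longrightarrow> V \<subseteq> {1..n}"
  using Union_P by auto

sublocale multipartite P r
proof
  show "card P = r" using P by (simp add: r_partitions_def)
  then show "finite P" using r_ge_2 by (metis card.infinite not_numeral_le_zero)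
  show "disjoint P" using P by (auto simp: r_partitions_def disjoint_def)
  show "finite V" if "V \<in> P" for V using part_subset[OF that] finite_subset by blast
qed (rule r_ge_2)

abbreviation "E \<equiv> partition_graph P"

lemma E_eq: "E = cross_pairs P {1..n}"
  by (simp add: partition_graph_eq Union_P)

lemma E_subset: "E \<subseteq> nsets {1..n} 2"
  by (auto simp: E_eq cross_pairs_def)

lemma finite_E: "finite E"
  by (simp add: E_eq finite_cross_pairs)

lemma inner_pairs_subset: "inner_pairs \<subseteq> nsets {1..n} 2"
  using part_subset nsets_mono unfolding inner_pairs_def by blast

lemma pairs_split: "nsets {1..n} 2 = inner_pairs \<union> E" "inner_pairs \<inter> E = {}"
  using inner_pairs_subset by (auto simp: E_eq cross_pairs_def inner_pairs_def nsets_def)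

lemma cross_pair:
  assumes "V \<in> P" "W \<in> P" "V \<noteq> W" "x \<in> V" "y \<in> W"
  shows "{x, y} \<in> E"
proof -
  have "x \<noteq> y" using same_part[OF assms(1,2), of x] assms by auto
  moreover have "\<not> {x, y} \<subseteq> U" if "U \<in> P" for U using same_part[OF that] assms that by auto
  moreover have "x \<in> {1..n}" "y \<in> {1..n}" using assms part_subset by blast+
  ultimately show ?thesis by (simp add: E_eq cross_pairs_def del: atLeastAtMost_iff insert_subset)
qed

lemma transversal_subset: "I \<subseteq> P \<Longrightarrow> S \<in> transversals I (\<lambda>V. V) \<Longrightarrow> S \<subseteq> {1..n}"
  using Union_P unfolding transversals_def by blast

definition inner_edges :: "nat set set \<Rightarrow> nat set set" where
  "inner_edges G = G \<inter> inner_pairs"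

definition missing :: "nat set set \<Rightarrow> nat set set" where
  "missing G = E - G"

lemma finite_missing: "finite (missing G)" "missing G \<subseteq> E"
  using finite_E by (auto simp: missing_def)

lemma cross_pairs_subset_if_avoids_missing:
  assumes "S \<subseteq> {1..n}" "\<forall>f\<in>missing G. \<not> f \<subseteq> S"
  shows "cross_pairs P S \<subseteq> G"
proof
  fix f assume f: "f \<in> cross_pairs P S"
  then have "f \<in> E" using cross_pairs_mono[OF assms(1), of P] by (auto simp: E_eq)
  moreover have "f \<subseteq> S" using f by (auto simp: cross_pairs_def nsets_def)
  ultimately show "f \<in> G" using assms(2) by (auto simp: missing_def)
qed

context
  fixes m :: nat and \<delta> \<gamma> :: real and G
  assumes G: "G \<in> F_star n m r \<delta> \<gamma> P"
begin

lemma G_subset: "G \<subseteq> nsets {1..n} 2"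
  using G by (auto simp: F_star_def F_delta_gamma_def Kfree_graphs_def graphs_on_def nsets_def card_ge_0_finite)

lemma card_G: "card G = m"
  using G by (auto simp: F_star_def F_delta_gamma_def Kfree_graphs_def)

lemma finite_G: "finite G"
  using G_subset by (rule finite_subset) (simp add: finite_imp_finite_nsets)

lemma ex_non_edge:
  assumes "A \<subseteq> {1..n}" "card A = Suc r"
  shows "\<exists>f\<in>nsets A 2. f \<notin> G"
proof -
  obtain u v where "u \<in> A" "v \<in> A" "u \<noteq> v" "{u, v} \<notin> G"
    using G assms by (auto simp: F_star_def F_delta_gamma_def Kfree_graphs_def clique_free_def)
  then show ?thesis by (intro bexI[of _ "{u, v}"]) auto
qed

lemma G_split: "G = inner_edges G \<union> (G \<inter> E)" "inner_edges G \<inter> (G \<inter> E) = {}"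
  using G_subset pairs_split by (auto simp: inner_edges_def)

lemma inner_edges_finite: "finite (inner_edges G)" "inner_edges G \<subseteq> inner_pairs"
  using finite_G by (auto simp: inner_edges_def)

lemma card_inner_edges: "card (inner_edges G) = (\<Sum>V\<in>P. e_inside G V)"
proof -
  have "inner_edges G = (\<Union>V\<in>P. {e\<in>G. e \<subseteq> V})"
    using G_subset by (auto simp: inner_edges_def inner_pairs_def nsets_def)
  also have "card \<dots> = (\<Sum>V\<in>P. card {e\<in>G. e \<subseteq> V})"
  proof (rule card_UN_disjoint)
    have "{e\<in>G. e \<subseteq> V} \<inter> {e\<in>G. e \<subseteq> W} = {}" if VW: "V \<in> P" "W \<in> P" "V \<noteq> W" for V W
    proof (intro equals0I)
      fix e assume e: "e \<in> {e\<in>G. e \<subseteq> V} \<inter> {e\<in>G. e \<subseteq> W}"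
      then obtain x where "x \<in> e" using G_subset by (fastforce simp: nsets_def)
      then show False using same_part[OF VW(1,2), of x] e VW(3) by auto
    qed
    then show "\<forall>V\<in>P. \<forall>W\<in>P. V \<noteq> W \<longrightarrow> {e\<in>G. e \<subseteq> V} \<inter> {e\<in>G. e \<subseteq> W} = {}" by blast
  qed (use finite_P finite_G in auto)
  finally show ?thesis by (simp add: e_inside_def)
qed

lemma inner_edges_nonempty: "inner_edges G \<noteq> {}"
  using G card_inner_edges by (auto simp: F_star_def)

lemma card_inner_edges_le: "real (card (inner_edges G)) \<le> \<delta> * real m"
  using G card_inner_edges by (auto simp: F_star_def condA_def)

lemma card_cross_edges: "card (G \<inter> E) + card (inner_edges G) = m"
proof -
  have "card G = card (inner_edges G) + card (G \<inter> E)"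
    by (subst G_split(1), rule card_Un_disjoint) (use finite_G G_split(2) in \<open>auto simp: inner_edges_def\<close>)
  then show ?thesis using card_G by simp
qed

lemma card_missing: "card (missing G) + m = e_part P + card (inner_edges G)"
proof -
  have "card E = card (missing G) + card (G \<inter> E)"
    by (subst card_Un_disjoint[symmetric])
        (use finite_E in \<open>auto simp: missing_def intro!: arg_cong[of _ _ card]\<close>)
  then show ?thesis using card_cross_edges by (simp add: e_part_def)
qed

lemma vertex_degree_inner_edges:
  assumes "v \<in> V" "V \<in> P"
  shows "vertex_degree (inner_edges G) v = deg_in G v V"
proof -
  have "{e\<in>inner_edges G. v \<in> e} = (\<lambda>u. {v, u}) ` {u\<in>V. {v, u} \<in> G}"
  proof (intro equalityI subsetI)
    fix e assume e: "e \<in> {e\<in>inner_edges G. v \<in> e}"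
    then obtain W where W: "W \<in> P" "e \<in> nsets W 2" by (auto simp: inner_edges_def inner_pairs_def)
    have "v \<in> W" using e W(2) by (auto simp: nsets_def)
    then have "W = V" using same_part[OF W(1) assms(2)] assms(1) by blast
    moreover obtain u where "e = {v, u}" using e W(2) by (auto simp: nsets_def card_2_iff)
    ultimately show "e \<in> (\<lambda>u. {v, u}) ` {u\<in>V. {v, u} \<in> G}"
      using e W(2) by (auto simp: nsets_def inner_edges_def)
  next
    fix e assume "e \<in> (\<lambda>u. {v, u}) ` {u\<in>V. {v, u} \<in> G}"
    then obtain u where u: "e = {v, u}" "u \<in> V" "{v, u} \<in> G" by auto
    moreover have "u \<noteq> v" using u(3) G_subset by (auto simp: nsets_def)
    ultimately show "e \<in> {e\<in>inner_edges G. v \<in> e}"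
      using assms by (auto simp: inner_edges_def inner_pairs_def)
  qed
  then show ?thesis by (simp add: vertex_degree_def deg_in_def card_image[OF inj_on_doubleton])
qed

lemma deg_in_own_part_le: "v \<in> V \<Longrightarrow> V \<in> P \<Longrightarrow> W \<in> P \<Longrightarrow> deg_in G v V \<le> deg_in G v W"
  using G by (cases "W = V") (auto simp: F_star_def condB_def)

lemma neighbourhood_clique_free:
  assumes v: "v \<in> {1..n}" and W: "\<And>V. V \<in> P \<Longrightarrow> W V \<subseteq> {u\<in>V. {v, u} \<in> G}"
  shows "box_clique_free W G"
  unfolding box_clique_free_def
proof (intro ballI notI)
  fix S assume S: "S \<in> transversals P W" and cross: "cross_pairs P S \<subseteq> G"
  have parts: "W V \<subseteq> V" if "V \<in> P" for V using W[OF that] by auto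
  then have S': "S \<in> transversals P (\<lambda>V. V)"
    using transversals_mono[OF disjoint_parts[OF order_refl]] S by blast
  have edge: "{v, u} \<in> G" if "u \<in> S" for u using that W S unfolding transversals_def by blast
  have "v \<notin> S"
  proof
    assume "v \<in> S"
    then have "{v, v} \<in> G" by (rule edge)
    then show False using G_subset by (auto simp: nsets_def)
  qed
  then have "card (insert v S) = Suc r" "insert v S \<subseteq> {1..n}"
    using full_transversal[OF S'] v by (auto simp: Union_P)
  then obtain f where f: "f \<in> nsets (insert v S) 2" "f \<notin> G" using ex_non_edge by blast
  obtain x y where "f = {x, y}" "x \<in> insert v S" "y \<in> insert v S" using f(1) by (rule nsets2_E)
  then have "f \<in> nsets S 2" using f edge[of x] edge[of y] by (auto simp: nsets_def insert_commute)
  then show False using f(2) cross cross_pairs_transversal[OF S' order_refl] by auto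
qed

lemma inner_edges_clique_free: "edge_clique_free (inner_edges G) G"
  unfolding edge_clique_free_def
proof (intro ballI impI notI)
  fix e V S assume e: "e \<in> inner_edges G" and V: "V \<in> P" "e \<subseteq> V"
    and S: "S \<in> transversals (P - {V}) (\<lambda>V. V)" and cross: "cross_pairs P (e \<union> S) \<subseteq> G"
  have eV: "e \<in> nsets V 2" using e V inner_pairs_subset by (auto simp: inner_edges_def nsets_def)
  obtain f where "f \<in> nsets (e \<union> S) 2" "f \<notin> G"
    using ex_non_edge[of "e \<union> S"] extended_transversal[OF V(1) eV S] by (auto simp: Union_P)
  then show False
    using cross cross_pairs_extended_transversal[OF V(1) eV S order_refl] e by (auto simp: inner_edges_def)
qed

end

lemma part_ge_of_balanced:
  assumes "P \<in> balanced_partitions n r \<gamma>" "\<gamma> \<le> 1 / (2 * real r)" "V \<in> P"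
  shows "real n / (2 * real r) \<le> real (card V)"
proof -
  have "1 / (2 * real r) \<le> 1 / real r - \<gamma>" using assms(2) r_ge_2 by (simp add: field_simps)
  then have "1 / (2 * real r) * real n \<le> (1 / real r - \<gamma>) * real n" by (intro mult_right_mono) auto
  also have "\<dots> \<le> real (card V)" using assms(1,3) by (simp add: balanced_partitions_def)
  finally show ?thesis by simp
qed

lemma F_star_empty:
  assumes "\<delta> * real n ^ 2 \<le> 1" "0 \<le> \<delta>"
  shows "F_star n m r \<delta> \<gamma> P = {}"
proof (rule ccontr)
  assume "F_star n m r \<delta> \<gamma> P \<noteq> {}"
  then obtain G where G: "G \<in> F_star n m r \<delta> \<gamma> P" by auto
  have "1 \<le> card (inner_edges G)"
    using inner_edges_nonempty[OF G] inner_edges_finite(1)[OF G] by (simp add: Suc_leI card_gt_0_iff)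
  then have "1 \<le> \<delta> * real m" using card_inner_edges_le[OF G] by linarith
  moreover have "2 * (\<delta> * real m) \<le> \<delta> * real n ^ 2"
    using mult_left_mono[OF card_pairs_le[OF G_subset[OF G]] assms(2)] card_G[OF G] by simp
  ultimately show False using assms(1) by linarith
qed

end

section \<open>The dense range\<close>

lemma binomial_diff_le:
  assumes "a \<le> s" "s \<le> N"
  shows "real ((N - a) choose (s - a)) \<le> (real s / real N) ^ a * real (N choose s)"
  using assms
proof (induction a)
  case (Suc a)
  let ?N = "N - a" and ?s = "s - a"
  have pos: "0 < ?s" "?s \<le> ?N" "0 < ?N" "0 < N" using Suc.prems by auto
  have "?s * (?N choose ?s) = ?N * ((N - Suc a) choose (s - Suc a))"
    using times_binomial_minus1_eq[OF pos(1), of ?N] by simp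
  then have "real ?s * real (?N choose ?s) = real ?N * real ((N - Suc a) choose (s - Suc a))"
    by (metis of_nat_mult)
  then have "real ((N - Suc a) choose (s - Suc a)) = (real ?s / real ?N) * real (?N choose ?s)"
    using pos by (simp add: field_simps)
  also have "\<dots> \<le> (real s / real N) * ((real s / real N) ^ a * real (N choose s))"
  proof (rule mult_mono)
    have "real a * real s \<le> real a * real N" using Suc.prems by (intro mult_left_mono) auto
    then have "real ?s * real N \<le> real s * real ?N"
      using Suc.prems by (simp add: of_nat_diff algebra_simps)
    then show "real ?s / real ?N \<le> real s / real N"
      using pos by (simp add: divide_le_eq le_divide_eq mult.commute)
    show "real (?N choose ?s) \<le> (real s / real N) ^ a * real (N choose s)" using Suc by simp
  qed auto
  finally show ?case by simp
qed simp

lemma card_supersets_binomial_le: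
  assumes A: "finite A" "F \<subseteq> A" and t: "t \<le> card F"
  shows "real (card {Q. F \<subseteq> Q \<and> Q \<subseteq> A \<and> card Q + m = card A + t})
    \<le> (real (card A - m) / real (card A)) ^ (card F - t) * real (card A choose m)"
    (is "real (card ?D) \<le> _")
proof (cases "?D = {}")
  case True
  then show ?thesis by (simp only: card.empty) simp
next
  case False
  let ?e = "card A" and ?f = "card F" and ?s = "card A - m" and ?a = "card F - t"
  obtain Q where Q: "F \<subseteq> Q" "Q \<subseteq> A" "card Q + m = ?e + t" using False by auto
  have "?f \<le> card Q" "card Q \<le> ?e" using Q A finite_subset by (auto intro!: card_mono)
  then have m: "m \<le> ?e" "?a \<le> ?s" "card Q - ?f = ?s - ?a" using Q(3) t by auto
  have "card ?D \<le> card {R. F \<subseteq> R \<and> R \<subseteq> A \<and> card R = card Q}"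
    using A(1) Q(3) by (intro card_mono) auto
  also have "\<dots> \<le> (?e - ?f) choose (card Q - ?f)" by (rule card_supersets_le[OF A])
  also have "\<dots> \<le> (?e - ?a) choose (?s - ?a)" unfolding m(3) by (rule binomial_right_mono) simp
  finally have "real (card ?D) \<le> real ((?e - ?a) choose (?s - ?a))" by (simp only: of_nat_le_iff)
  also have "\<dots> \<le> (real ?s / real ?e) ^ ?a * real (?e choose ?s)"
    by (rule binomial_diff_le) (use m in auto)
  also have "?e choose ?s = ?e choose m" using m(1) by (rule binomial_symmetric[symmetric])
  finally show ?thesis .
qed

lemma sum_power_card_Pow:
  fixes c :: real
  assumes "finite A"
  shows "(\<Sum>X\<in>Pow A. c ^ card X) = (1 + c) ^ card A"
  using prod_add[OF assms, of "\<lambda>_. c" "\<lambda>_. 1"] by (simp add: add.commute)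

lemma sum_vertex_degree_le:
  assumes "finite X" "finite Q" "\<forall>f\<in>Q. finite f \<and> card f = 2"
  shows "(\<Sum>v\<in>X. vertex_degree Q v) \<le> 2 * card {f\<in>Q. f \<inter> X \<noteq> {}}"
proof -
  have "(\<Sum>v\<in>X. vertex_degree Q v) = card (SIGMA v:X. {f\<in>Q. v \<in> f})"
    unfolding vertex_degree_def using assms by (subst card_SigmaI) auto
  also have "\<dots> \<le> card (SIGMA f:{f\<in>Q. f \<inter> X \<noteq> {}}. f)"
    by (rule card_inj_on_le[where f = prod.swap]) (use assms in \<open>auto intro!: finite_SigmaI\<close>)
  also have "\<dots> = (\<Sum>f\<in>{f\<in>Q. f \<inter> X \<noteq> {}}. card f)" using assms by (intro card_SigmaI) auto
  also have "\<dots> = 2 * card {f\<in>Q. f \<inter> X \<noteq> {}}" using assms(3) by simp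
  finally show ?thesis .
qed

lemma card_le_sum_vertex_degree:
  assumes "finite X" "finite T" "\<forall>e\<in>T. e \<inter> X \<noteq> {}"
  shows "card T \<le> (\<Sum>v\<in>X. vertex_degree T v)"
proof -
  have "card T \<le> card (\<Union>v\<in>X. {e\<in>T. v \<in> e})" using assms by (intro card_mono) auto
  also have "\<dots> \<le> (\<Sum>v\<in>X. vertex_degree T v)" unfolding vertex_degree_def by (rule card_UN_le[OF assms(1)])
  finally show ?thesis .
qed

definition dense_gap :: "nat \<Rightarrow> real" where
  "dense_gap r = (1 / 16) ^ (32 * r)"

lemma dense_gap_le:
  assumes "2 \<le> r"
  shows "dense_gap r \<le> 1 / (2 ^ 13 * real r ^ 2)"
proof -
  have "real r \<le> 2 ^ r" using less_exp[of r] by (metis less_imp_le of_nat_le_iff of_nat_numeral of_nat_power)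
  then have "real r ^ 2 \<le> (2 ^ r) ^ 2" by (intro power_mono) auto
  then have "2 ^ 13 * real r ^ 2 \<le> 2 ^ 13 * 2 ^ (2 * r)" by (simp add: power_mult[symmetric] mult.commute)
  also have "\<dots> = 2 ^ (13 + 2 * r)" by (simp add: power_add)
  also have "\<dots> \<le> 2 ^ (4 * (32 * r))" using assms by (intro power_increasing) auto
  also have "\<dots> = 16 ^ (32 * r)" by (simp add: power_mult)
  finally have "1 / 16 ^ (32 * r) \<le> 1 / (2 ^ 13 * real r ^ 2)" using assms by (intro divide_left_mono) auto
  then show ?thesis by (simp add: dense_gap_def power_one_over)
qed

text \<open>In the dense range every inner edge has an endpoint that misses linearly many crossing edges,
  and no vertex has large inner degree; the missing edges then outweigh the inner ones.\<close>

context vertex_partition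
begin

definition deficient :: "nat set set \<Rightarrow> nat set" where
  "deficient G = {v\<in>{1..n}. real n / (8 * real r) \<le> real (vertex_degree (missing G) v)}"

definition touching :: "nat set \<Rightarrow> nat set set" where
  "touching X = {e \<in> nsets {1..n} 2. e \<inter> X \<noteq> {}}"

lemma finite_touching: "finite (touching X)"
  by (simp add: touching_def finite_imp_finite_nsets)

lemma card_touching_le:
  assumes "X \<subseteq> {1..n}"
  shows "card (touching X) \<le> card X * n"
proof -
  have X: "finite X" using assms finite_subset by blast
  have "touching X \<subseteq> (\<lambda>(v, u). {v, u}) ` (X \<times> {1..n})"
  proof
    fix e assume e: "e \<in> touching X"
    then obtain v where v: "v \<in> e" "v \<in> X" by (auto simp: touching_def)
    then obtain u where "e = {v, u}" using e by (auto simp: touching_def nsets_def card_2_iff)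
    then show "e \<in> (\<lambda>(v, u). {v, u}) ` (X \<times> {1..n})"
      using e v by (intro image_eqI[of _ _ "(v, u)"]) (auto simp: touching_def)
  qed
  then have "card (touching X) \<le> card (X \<times> {1..n})"
    using X by (meson card_image_le card_mono finite_SigmaI finite_atLeastAtMost finite_imageI order_trans)
  then show ?thesis by (simp add: card_cartesian_product)
qed

context
  fixes m :: nat and \<delta> \<gamma> :: real and G
  assumes G: "G \<in> F_star n m r \<delta> \<gamma> P" and n: "0 < n"
    and size: "\<forall>V\<in>P. real n / (2 * real r) \<le> real (card V)"
    and few: "real (card (missing G)) < (real n / (64 * real r)) ^ 2"
begin

lemma ex_transversal_avoiding_missing:
  assumes "I \<subseteq> P" "\<And>V. V \<in> I \<Longrightarrow> W V \<subseteq> V" "\<And>V. V \<in> I \<Longrightarrow> real n / (64 * real r) \<le> real (card (W V))"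
  shows "\<exists>S\<in>transversals I W. \<forall>f\<in>missing G. \<not> f \<subseteq> S"
proof (rule ex_transversal_avoiding_pairs[OF _ _ _ _ _ finite_missing(1) _ few])
  show "disjoint_family_on W I" using assms(2)
    by (rule disjoint_family_on_subset[OF disjoint_parts[OF assms(1)]])
  show "finite I" using assms(1) finite_P finite_subset by blast
  show "\<forall>V\<in>I. finite (W V)" using assms(1,2) finite_part by (meson finite_subset subsetD)
  show "\<forall>f\<in>missing G. card f = 2" using finite_missing(2) E_subset by (fastforce simp: nsets_def)
  show "0 < real n / (64 * real r)" using n r_ge_2 by simp
qed (use assms(3) in blast)

lemma inner_degree_le: "real (vertex_degree (inner_edges G) v) \<le> real n / (64 * real r)"
proof (rule ccontr)
  assume "\<not> ?thesis"
  then have big: "real n / (64 * real r) < real (vertex_degree (inner_edges G) v)" by simp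
  then have "vertex_degree (inner_edges G) v \<noteq> 0" by (intro notI) (simp add: divide_less_0_iff)
  then obtain e where "e \<in> inner_edges G" "v \<in> e"
    unfolding vertex_degree_def by (metis (no_types, lifting) card.empty empty_Collect_eq)
  then have v: "v \<in> {1..n}" using inner_pairs_subset unfolding inner_edges_def nsets_def by blast
  then obtain V where V: "V \<in> P" "v \<in> V" unfolding Union_P[symmetric] by blast
  let ?W = "\<lambda>W. {u\<in>W. {v, u} \<in> G}"
  have "real n / (64 * real r) \<le> real (card (?W U))" if U: "U \<in> P" for U
    using deg_in_own_part_le[OF G V(2,1) U] vertex_degree_inner_edges[OF G V(2,1)] big by (simp add: deg_in_def)
  then obtain S where S: "S \<in> transversals P ?W" "\<forall>f\<in>missing G. \<not> f \<subseteq> S"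
    using ex_transversal_avoiding_missing[of P ?W] by auto
  have "S \<subseteq> {1..n}" using S(1) Union_P unfolding transversals_def by blast
  then have "cross_pairs P S \<subseteq> G" using S(2) by (rule cross_pairs_subset_if_avoids_missing)
  then show False using neighbourhood_clique_free[OF G v, of ?W] S(1) by (auto simp: box_clique_free_def)
qed

lemma card_non_neighbours_less:
  assumes "V \<in> P" "U \<in> P" "U \<noteq> V" "x \<in> V" "x \<notin> deficient G"
  shows "real (card {w\<in>U. {x, w} \<notin> G}) < real n / (8 * real r)"
proof -
  have "(\<lambda>w. {x, w}) ` {w\<in>U. {x, w} \<notin> G} \<subseteq> {f\<in>missing G. x \<in> f}"
    using cross_pair[OF assms(1,2) _ assms(4)] assms(3) by (auto simp: missing_def)
  then have "card {w\<in>U. {x, w} \<notin> G} \<le> vertex_degree (missing G) x"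
    unfolding vertex_degree_def using finite_missing(1) inj_on_doubleton by (intro card_inj_on_le) auto
  moreover have "real (vertex_degree (missing G) x) < real n / (8 * real r)"
    using assms(5) subsetD[OF part_subset[OF assms(1)] assms(4)]
    by (simp add: deficient_def not_le del: atLeastAtMost_iff)
  ultimately show ?thesis by linarith
qed

lemma card_common_neighbours_ge:
  assumes "V \<in> P" "U \<in> P" "U \<noteq> V" "x \<in> V" "y \<in> V" "x \<notin> deficient G" "y \<notin> deficient G"
  shows "real n / (64 * real r) \<le> real (card {w\<in>U. {x, w} \<in> G \<and> {y, w} \<in> G})"
proof -
  let ?W = "{w\<in>U. {x, w} \<in> G \<and> {y, w} \<in> G}" and ?X = "{w\<in>U. {x, w} \<notin> G}" and ?Y = "{w\<in>U. {y, w} \<notin> G}"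
  have "card U \<le> card (?W \<union> (?X \<union> ?Y))" using finite_part[OF assms(2)] by (intro card_mono) auto
  also have "\<dots> \<le> card ?W + (card ?X + card ?Y)"
    by (meson add_left_mono card_Un_le order_trans)
  finally have "real (card U) \<le> real (card ?W) + (real (card ?X) + real (card ?Y))" by linarith
  moreover have "real (card ?X) < real n / (8 * real r)" "real (card ?Y) < real n / (8 * real r)"
    using card_non_neighbours_less assms by blast+
  moreover have "real n / (2 * real r) \<le> real (card U)" using size assms(2) by auto
  moreover have "real n / (64 * real r) + (real n / (8 * real r) + real n / (8 * real r))
      \<le> real n / (2 * real r)"
    using r_ge_2 by (simp add: field_simps)
  ultimately show ?thesis by linarith
qed

lemma inner_edge_meets_deficient:
  assumes e: "e \<in> inner_edges G"
  shows "e \<inter> deficient G \<noteq> {}"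
proof
  assume avoid: "e \<inter> deficient G = {}"
  obtain V where V: "V \<in> P" "e \<in> nsets V 2" using e by (auto simp: inner_edges_def inner_pairs_def)
  obtain x y where xy: "e = {x, y}" "x \<in> V" "y \<in> V" using V(2) by (rule nsets2_E)
  let ?W = "\<lambda>U. {w\<in>U. {x, w} \<in> G \<and> {y, w} \<in> G}"
  obtain S where S: "S \<in> transversals (P - {V}) ?W" "\<forall>f\<in>missing G. \<not> f \<subseteq> S"
    using ex_transversal_avoiding_missing[of "P - {V}" ?W] card_common_neighbours_ge[OF V(1)] xy avoid by auto
  have S': "S \<in> transversals (P - {V}) (\<lambda>V. V)"
    using transversals_mono[OF disjoint_parts[of "P - {V}"], of ?W] S(1) by auto
  have common: "{x, w} \<in> G \<and> {y, w} \<in> G" if "w \<in> S" for w using that S(1) unfolding transversals_def by blast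
  have "cross_pairs P S \<subseteq> G"
    using cross_pairs_subset_if_avoids_missing[OF transversal_subset[OF _ S'] S(2)] by blast
  moreover have "f \<in> cross_pairs P S \<or> f \<in> G" if f: "f \<in> cross_pairs P (e \<union> S)" for f
  proof (cases "f \<subseteq> S")
    case True
    then show ?thesis using f by (auto simp: cross_pairs_def nsets_def)
  next
    case False
    have pair: "f \<in> nsets (e \<union> S) 2" "f \<noteq> e"
      using f cross_pairs_extended_transversal[OF V S' order_refl] by auto
    obtain a b where "f = {a, b}" "a \<in> e \<union> S" "b \<in> e \<union> S" using pair(1) by (rule nsets2_E)
    then show ?thesis using False common pair xy(1) by (auto simp: insert_commute nsets_def)
  qed
  ultimately have "cross_pairs P (e \<union> S) \<subseteq> G" by blast
  then show False
    using inner_edges_clique_free[OF G] e V S' by (auto simp: edge_clique_free_def nsets_def)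
qed

lemma card_inner_edges_deficient_le: "64 * r * card (inner_edges G) \<le> card (deficient G) * n"
proof -
  have "real (card (inner_edges G)) \<le> (\<Sum>v\<in>deficient G. real (vertex_degree (inner_edges G) v))"
    using card_le_sum_vertex_degree[of "deficient G" "inner_edges G"] inner_edge_meets_deficient inner_edges_finite(1)[OF G]
    by (simp add: deficient_def del: of_nat_sum flip: of_nat_sum)
  also have "\<dots> \<le> real (card (deficient G)) * (real n / (64 * real r))"
    using sum_mono[of "deficient G" _ "\<lambda>_. real n / (64 * real r)"] inner_degree_le by simp
  finally have "real (64 * r * card (inner_edges G)) \<le> real (card (deficient G) * n)"
    using r_ge_2 by (simp add: field_simps)
  then show ?thesis by (simp only: of_nat_le_iff)
qed

lemma card_missing_touching_ge:
  "real (card (deficient G)) * real n / (16 * real r) \<le> real (card (missing G \<inter> touching (deficient G)))"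
proof -
  have "real (card (deficient G)) * (real n / (8 * real r)) = (\<Sum>v\<in>deficient G. real n / (8 * real r))" by simp
  also have "\<dots> \<le> real (\<Sum>v\<in>deficient G. vertex_degree (missing G) v)"
    unfolding of_nat_sum by (rule sum_mono) (auto simp: deficient_def)
  also have "\<dots> \<le> real (2 * card {f\<in>missing G. f \<inter> deficient G \<noteq> {}})"
    unfolding of_nat_le_iff using finite_missing E_subset
    by (intro sum_vertex_degree_le) (auto simp: deficient_def nsets_def)
  also have "{f\<in>missing G. f \<inter> deficient G \<noteq> {}} = missing G \<inter> touching (deficient G)"
    using finite_missing(2)[of G] E_subset by (auto simp: touching_def)
  finally show ?thesis using r_ge_2 by (simp add: field_simps)
qed

end

definition missing_codes :: "nat set \<Rightarrow> nat set set set" where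
  "missing_codes X = {F. F \<subseteq> E \<inter> touching X \<and> real (card F) = \<lceil>real (card X) * real n / (16 * real r)\<rceil>}"

lemma ex_missing_code:
  assumes "G \<in> F_star n m r \<delta> \<gamma> P" "0 < n" "\<forall>V\<in>P. real n / (2 * real r) \<le> real (card V)"
    "real (card (missing G)) < (real n / (64 * real r)) ^ 2"
  shows "\<exists>F\<in>missing_codes (deficient G). F \<subseteq> missing G"
proof -
  let ?x = "real (card (deficient G)) * real n / (16 * real r)"
  have "nat \<lceil>?x\<rceil> \<le> card (missing G \<inter> touching (deficient G))"
    using card_missing_touching_ge[OF assms] by (simp add: nat_le_iff ceiling_le_iff)
  then obtain F where "F \<subseteq> missing G \<inter> touching (deficient G)" "card F = nat \<lceil>?x\<rceil>"
    by (meson obtain_subset_with_card_n)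
  then show ?thesis
    using finite_missing(2)[of G] by (intro bexI[of _ F]) (auto simp: missing_codes_def)
qed

lemma dense_fibre:
  assumes F: "F \<in> missing_codes X" and t: "64 * r * t \<le> card X * n"
    and m: "(1 - dense_gap r) * real (e_part P) \<le> real m"
  shows "real (card {Q. F \<subseteq> Q \<and> Q \<subseteq> E \<and> card Q + m = e_part P + t})
    \<le> ((1 / 16) ^ n) ^ card X * real (e_part P choose m)"
proof -
  let ?f = "card F" and ?x = "real (card X) * real n"
  have r: "0 < real r" using r_ge_2 by simp
  have "?x / (16 * real r) \<le> real ?f" using F by (simp add: missing_codes_def)
  then have f: "?x \<le> 16 * (real r * real ?f)" using r by (simp add: field_simps)
  have "real (64 * r * t) \<le> real (card X * n)" using t by (simp only: of_nat_le_iff)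
  then have t: "64 * (real r * real t) \<le> ?x" by simp
  have "0 \<le> real r * real t" "0 \<le> real r * real ?f" by auto
  then have "real r * real t \<le> real r * real ?f" using f t by linarith
  then have tf: "t \<le> ?f" using r by simp
  have "real r * real (?f - t) = real r * real ?f - real r * real t"
    using tf by (simp add: of_nat_diff right_diff_distrib)
  then have "?x \<le> 32 * (real r * real (?f - t))" using f t \<open>0 \<le> real r * real t\<close> by linarith
  then have "real (n * card X) \<le> real (32 * r * (?f - t))" by (simp add: mult_ac)
  then have exponent: "n * card X \<le> 32 * r * (?f - t)" by (simp only: of_nat_le_iff)
  have "real (card {Q. F \<subseteq> Q \<and> Q \<subseteq> E \<and> card Q + m = e_part P + t})
      \<le> (real (e_part P - m) / real (e_part P)) ^ (?f - t) * real (e_part P choose m)"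
    unfolding e_part_def by (rule card_supersets_binomial_le[OF finite_E _ tf])
        (use F in \<open>simp add: missing_codes_def\<close>)
  also have "\<dots> \<le> dense_gap r ^ (?f - t) * real (e_part P choose m)"
  proof (intro mult_right_mono power_mono)
    have "real (e_part P - m) \<le> dense_gap r * real (e_part P)"
      using m by (cases "m \<le> e_part P") (auto simp: of_nat_diff algebra_simps dense_gap_def)
    then show "real (e_part P - m) / real (e_part P) \<le> dense_gap r"
      by (cases "e_part P = 0") (simp_all add: divide_le_eq dense_gap_def)
  qed auto
  also have "dense_gap r ^ (?f - t) \<le> (1 / 16) ^ (n * card X)"
    unfolding dense_gap_def power_mult[symmetric] using exponent by (intro power_decreasing) auto
  also have "(1 / 16 :: real) ^ (n * card X) = ((1 / 16) ^ n) ^ card X" by (rule power_mult)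
  finally show ?thesis by (simp add: mult_right_mono)
qed

lemma card_missing_less:
  assumes G: "G \<in> F_star n m r \<delta> \<gamma> P" and n: "0 < n"
    and m: "(1 - dense_gap r) * real (e_part P) \<le> real m" and \<delta>: "\<delta> \<le> 1 / (2 ^ 13 * real r ^ 2)"
  shows "real (card (missing G)) < (real n / (64 * real r)) ^ 2"
proof -
  let ?c = "1 / (2 ^ 13 * real r ^ 2)"
  have r: "0 < real r" using r_ge_2 by simp
  have "real (card (missing G)) + real m = real (e_part P) + real (card (inner_edges G))"
    using card_missing[OF G] by (simp only: of_nat_add[symmetric] of_nat_eq_iff)
  then have "real (card (missing G)) \<le> dense_gap r * real (e_part P) + \<delta> * real m"
    using m card_inner_edges_le[OF G] by (simp add: algebra_simps)
  also have "\<dots> \<le> ?c * real (e_part P) + ?c * real m"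
    using dense_gap_le[OF r_ge_2] \<delta> by (intro add_mono mult_right_mono) auto
  also have "\<dots> = ?c * (real (e_part P) + real m)" by (simp add: distrib_left)
  also have "\<dots> \<le> ?c * real n ^ 2"
    using card_pairs_le[OF E_subset] card_pairs_le[OF G_subset[OF G]] card_G[OF G]
    by (intro mult_left_mono) (auto simp: e_part_def)
  also have "\<dots> < (1 / (2 ^ 12 * real r ^ 2)) * real n ^ 2"
    using n r by (intro mult_strict_right_mono) (auto simp: field_simps)
  also have "\<dots> = (real n / (64 * real r)) ^ 2" by (simp add: power2_eq_square)
  finally show ?thesis .
qed

lemma card_families_touching_le:
  assumes "X \<subseteq> {1..n}" "\<A> \<subseteq> Pow (touching X)"
  shows "real (card \<A>) \<le> (2 ^ n) ^ card X"
proof -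
  have "card \<A> \<le> card (Pow (touching X))" using assms(2) finite_touching by (intro card_mono) auto
  also have "\<dots> = 2 ^ card (touching X)" using finite_touching by (simp add: card_Pow)
  also have "\<dots> \<le> 2 ^ (card X * n)" using card_touching_le[OF assms(1)] by (intro power_increasing) auto
  finally have "real (card \<A>) \<le> real (2 ^ (card X * n))" by (simp only: of_nat_le_iff)
  then show ?thesis by (simp add: power_mult[symmetric] mult.commute)
qed

definition inner_codes :: "nat set \<Rightarrow> nat set set set" where
  "inner_codes X = {T. T \<subseteq> touching X \<and> 64 * r * card T \<le> card X * n}"

lemma finite_codes: "finite (inner_codes X)" "finite (missing_codes X)"
  using finite_touching finite_E by (auto simp: inner_codes_def missing_codes_def)

lemma dense_decomposition:
  assumes n: "0 < n" and size: "\<forall>V\<in>P. real n / (2 * real r) \<le> real (card V)"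
    and m: "(1 - dense_gap r) * real (e_part P) \<le> real m" and \<delta>: "\<delta> \<le> 1 / (2 ^ 13 * real r ^ 2)"
  shows "F_star n m r \<delta> \<gamma> P \<subseteq> (\<Union>(X, T, F)\<in>SIGMA X:Pow {1..n} - {{}}. inner_codes X \<times> missing_codes X.
    (\<lambda>Q. T \<union> (E - Q)) ` {Q. F \<subseteq> Q \<and> Q \<subseteq> E \<and> card Q + m = e_part P + card T})"
proof
  fix G assume G: "G \<in> F_star n m r \<delta> \<gamma> P"
  let ?X = "deficient G" and ?T = "inner_edges G"
  note few = card_missing_less[OF G n m \<delta>]
  obtain F where F: "F \<in> missing_codes ?X" "F \<subseteq> missing G"
    using ex_missing_code[OF G n size few] by blast
  have meets: "\<forall>e\<in>?T. e \<inter> ?X \<noteq> {}" using inner_edge_meets_deficient[OF G n size few] by blast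
  have "?T \<in> inner_codes ?X"
    using card_inner_edges_deficient_le[OF G n size few] meets inner_pairs_subset
    by (auto simp: inner_codes_def touching_def inner_edges_def)
  moreover have "?X \<noteq> {}" using meets inner_edges_nonempty[OF G] by auto
  moreover have "?X \<subseteq> {1..n}" by (auto simp: deficient_def)
  moreover have "G \<in> (\<lambda>Q. ?T \<union> (E - Q)) ` {Q. F \<subseteq> Q \<and> Q \<subseteq> E \<and> card Q + m = e_part P + card ?T}"
  proof (rule image_eqI)
    show "G = ?T \<union> (E - missing G)" using G_split(1)[OF G] by (auto simp: missing_def)
  qed (use F(2) finite_missing(2) card_missing[OF G] in auto)
  ultimately show "G \<in> (\<Union>(X, T, F)\<in>SIGMA X:Pow {1..n} - {{}}. inner_codes X \<times> missing_codes X.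
    (\<lambda>Q. T \<union> (E - Q)) ` {Q. F \<subseteq> Q \<and> Q \<subseteq> E \<and> card Q + m = e_part P + card T})"
    using F(1) by (intro UN_I[of "(?X, ?T, F)"]) auto
qed

theorem dense_bound:
  assumes "0 < n" and "\<forall>V\<in>P. real n / (2 * real r) \<le> real (card V)"
    and m: "(1 - dense_gap r) * real (e_part P) \<le> real m" and "\<delta> \<le> 1 / (2 ^ 13 * real r ^ 2)"
  shows "real (card (F_star n m r \<delta> \<gamma> P)) \<le> ((1 + (1 / 4) ^ n) ^ n - 1) * real (e_part P choose m)"
proof -
  let ?A = "Pow {1..n} - {{}}" and ?C = "real (e_part P choose m)"
  let ?D = "\<lambda>T F. {Q. F \<subseteq> Q \<and> Q \<subseteq> E \<and> card Q + m = e_part P + card T}"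
  let ?I = "SIGMA X:?A. inner_codes X \<times> missing_codes X"
  have I: "finite ?I" using finite_codes by (intro finite_SigmaI) auto
  have "real (card (F_star n m r \<delta> \<gamma> P)) \<le> (\<Sum>i\<in>?I. real (card (case i of (X, T, F) \<Rightarrow> ?D T F)))"
    using dense_decomposition[OF assms, of \<gamma>] finite_E
    by (intro card_le_sum_fibres[OF I, where f = "\<lambda>(X, T, F) Q. T \<union> (E - Q)"]) (auto simp: split_def)
  also have "\<dots> \<le> (\<Sum>(X, T, F)\<in>?I. ((1 / 16) ^ n) ^ card X * ?C)"
    using dense_fibre[OF _ _ m] by (intro sum_mono) (auto simp: inner_codes_def)
  also have "\<dots> = (\<Sum>X\<in>?A. \<Sum>(T, F)\<in>inner_codes X \<times> missing_codes X. ((1 / 16) ^ n) ^ card X * ?C)"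
    using finite_codes by (subst sum.Sigma) (auto simp: split_def)
  also have "\<dots> = (\<Sum>X\<in>?A. real (card (inner_codes X)) * real (card (missing_codes X))
      * (((1 / 16) ^ n) ^ card X * ?C))"
    by (simp add: split_def card_cartesian_product)
  also have "\<dots> \<le> (\<Sum>X\<in>?A. (2 ^ n) ^ card X * (2 ^ n) ^ card X * (((1 / 16) ^ n) ^ card X * ?C))"
    by (intro sum_mono mult_mono card_families_touching_le) (auto simp: inner_codes_def missing_codes_def)
  also have "\<dots> = (\<Sum>X\<in>?A. ((1 / 4) ^ n) ^ card X) * ?C"
  proof -
    have "(2 ^ n) ^ k * (2 ^ n) ^ k * (((1 / 16) ^ n) ^ k * ?C) = ((1 / 4) ^ n) ^ k * ?C" for k
    proof -
      have "(2 ^ n) ^ k * (2 ^ n) ^ k * ((1 / 16) ^ n) ^ k = (((2 * 2 * (1 / 16)) :: real) ^ n) ^ k"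
        by (simp only: power_mult_distrib)
      then show ?thesis by simp
    qed
    then show ?thesis by (simp only: sum_distrib_right)
  qed
  also have "(\<Sum>X\<in>?A. ((1 / 4 :: real) ^ n) ^ card X) = (1 + (1 / 4) ^ n) ^ n - 1"
    using sum_power_card_Pow[of "{1..n}" "(1 / 4 :: real) ^ n"] by (simp add: sum_diff1)
  finally show ?thesis .
qed

end

section \<open>The sparse range: graphs with large gain\<close>

lemma binomial_lower_le:
  assumes "t \<le> m" "m < N"
  shows "real (N choose (m - t)) \<le> (real m / real (N - m)) ^ t * real (N choose m)"
  using assms
proof (induction t)
  case (Suc t)
  define k where "k = m - t"
  have k: "0 < k" "k \<le> m" "m - Suc t = k - 1" using Suc.prems by (auto simp: k_def)
  have "k * (N choose k) = (N - (k - 1)) * (N choose (k - 1))"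
    using binomial_absorption[of "k - 1" N] binomial_absorb_comp[of N "k - 1"] k(1) by simp
  then have "real k * real (N choose k) = real (N - (k - 1)) * real (N choose (k - 1))"
    by (metis of_nat_mult)
  moreover have pos: "0 < real (N - (k - 1))" "0 < real (N - m)" "real (N - m) \<le> real (N - (k - 1))"
    using k assms(2) by auto
  ultimately have "real (N choose (m - Suc t)) = (real k / real (N - (k - 1))) * real (N choose k)"
    unfolding k(3) by (simp add: field_simps)
  also have "\<dots> \<le> (real m / real (N - m)) * ((real m / real (N - m)) ^ t * real (N choose m))"
    using Suc k pos by (intro mult_mono frac_le) (auto simp: k_def)
  finally show ?case by simp
qed simp

lemma binomial_remove_le:
  assumes m: "m < N" "real m \<le> z * real (N - m)" and t: "t + f \<le> m"
  shows "real ((N - f) choose (m - t - f)) \<le> z ^ (t + f) * real (N choose m)"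
proof -
  have z: "real m / real (N - m) \<le> z" using m by (simp add: divide_le_eq)
  moreover have "0 \<le> real m / real (N - m)" by simp
  ultimately have "0 \<le> z" by (rule order_trans[rotated])
  have "real ((N - f) choose (m - t - f)) \<le> (real (m - t) / real N) ^ f * real (N choose (m - t))"
    by (rule binomial_diff_le) (use t m in auto)
  also have "\<dots> \<le> z ^ f * (z ^ t * real (N choose m))"
  proof (intro mult_mono power_mono)
    have "real (m - t) / real N \<le> real m / real (N - m)" using m by (intro frac_le) auto
    then show "real (m - t) / real N \<le> z" using z by (rule order_trans)
    have "real (N choose (m - t)) \<le> (real m / real (N - m)) ^ t * real (N choose m)"
      by (rule binomial_lower_le) (use t m in auto)
    also have "\<dots> \<le> z ^ t * real (N choose m)" using z by (intro mult_right_mono power_mono) auto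
    finally show "real (N choose (m - t)) \<le> z ^ t * real (N choose m)" .
  qed (use \<open>0 \<le> z\<close> in auto)
  finally show ?thesis by (simp add: power_add mult_ac)
qed

lemma card_supersets_antimono_le:
  assumes A: "finite A" "F \<subseteq> A" and p: "0 \<le> p" "p \<le> 1" and \<eta>: "0 \<le> \<eta>" "\<eta> \<le> 1"
    and m: "m < card A" "real m \<le> z * real (card A - m)"
    and mean: "real (card A) * p \<le> (1 - \<eta>) * (real m - real t - real (card F))" and Q: "antimono Q"
  shows "\<eta> * real (card {H. F \<subseteq> H \<and> H \<subseteq> A \<and> card H + t = m \<and> Q H})
    \<le> z ^ (t + card F) * real (card A choose m) * \<P>(R in random_subset A (\<lambda>_. p). Q R)"
    (is "\<eta> * real (card ?D) \<le> _")
proof (cases "?D = {}")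
  case True
  have "0 \<le> z * real (card A - m)" using m(2) by (rule order_trans[OF of_nat_0_le_iff])
  then have "0 \<le> z" using m(1) by (simp add: zero_le_mult_iff)
  then show ?thesis using True by (simp only: card.empty) simp
next
  case False
  let ?f = "card F" and ?P = "\<lambda>\<Omega> Q. \<P>(R in random_subset \<Omega> (\<lambda>_. p). Q R)"
  let ?M = "m - t - ?f" and ?Q = "\<lambda>R. Q (R \<union> F)"
  have F: "finite F" using A finite_subset by blast
  obtain H where H: "F \<subseteq> H" "H \<subseteq> A" "card H + t = m" using False by auto
  have fm: "t + ?f \<le> m" using H A(1) card_mono[of H F] finite_subset by fastforce
  have Q': "antimono ?Q" by (rule antimonoI) (rule antimonoD[OF Q], blast)
  have "card ?D \<le> card {R. R \<subseteq> A - F \<and> card R = ?M \<and> ?Q R}"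
    using A(1) F by (intro card_inj_on_le[where f = "\<lambda>H. H - F"])
      (auto simp: inj_on_def card_Diff_subset Un_absorb2)
  then have "\<eta> * real (card ?D) \<le> \<eta> * real (card {R. R \<subseteq> A - F \<and> card R = ?M \<and> ?Q R})"
    using \<eta>(1) by (intro mult_left_mono) auto
  also have "\<dots> \<le> real (card (A - F) choose ?M) * ?P (A - F) ?Q"
  proof (rule uniform_le_random_subset[OF _ p Q' _ \<eta>(2)])
    have "real (card (A - F)) * p \<le> real (card A) * p"
      using p A(1) by (intro mult_right_mono) (auto intro!: card_mono)
    also have "\<dots> \<le> (1 - \<eta>) * real ?M" using mean fm by (simp add: of_nat_diff diff_diff_eq)
    finally show "real (card (A - F)) * p \<le> (1 - \<eta>) * real ?M" .
  qed (use A(1) in simp)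
  also have "\<dots> \<le> (z ^ (t + ?f) * real (card A choose m)) * ?P A Q"
  proof (rule mult_mono)
    show "real (card (A - F) choose ?M) \<le> z ^ (t + ?f) * real (card A choose m)"
      using binomial_remove_le[OF m fm] A(2) F by (simp add: card_Diff_subset)
    then show "0 \<le> z ^ (t + ?f) * real (card A choose m)" by (rule order_trans[OF of_nat_0_le_iff])
    have "?P (A - F) ?Q = ?P A ?Q" by (rule prob_random_subset_Un_fixed[OF A, symmetric])
    also have "\<dots> \<le> ?P A Q"
      using antimonoD[OF Q Un_upper1] by (intro prob_random_subset_mono) auto
    finally show "?P (A - F) ?Q \<le> ?P A Q" .
  qed auto
  finally show ?thesis .
qed

lemma sum_small_subsets_le:
  fixes z \<theta> b :: real
  assumes A: "finite A" and \<theta>: "0 < \<theta>" "\<theta> \<le> 1" and z: "0 \<le> z"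
  shows "(\<Sum>T\<in>{T\<in>Pow A. real (card T) \<le> b}. z ^ card T) \<le> exp (b * ln (1 / \<theta>) + \<theta> * z * real (card A))"
proof -
  have "(\<Sum>T\<in>{T\<in>Pow A. real (card T) \<le> b}. z ^ card T)
      \<le> (\<Sum>T\<in>{T\<in>Pow A. real (card T) \<le> b}. exp (b * ln (1 / \<theta>)) * (\<theta> * z) ^ card T)"
  proof (rule sum_mono)
    fix T assume T: "T \<in> {T\<in>Pow A. real (card T) \<le> b}"
    have "(1 / \<theta>) ^ card T = exp (real (card T) * ln (1 / \<theta>))" using \<theta> by (simp add: exp_of_nat_mult)
    also have "\<dots> \<le> exp (b * ln (1 / \<theta>))" using T \<theta> by (auto intro!: mult_right_mono)
    finally have "(1 / \<theta>) ^ card T * (\<theta> * z) ^ card T \<le> exp (b * ln (1 / \<theta>)) * (\<theta> * z) ^ card T"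
      using \<theta> z by (intro mult_right_mono) auto
    then show "z ^ card T \<le> exp (b * ln (1 / \<theta>)) * (\<theta> * z) ^ card T"
      using \<theta> by (simp flip: power_mult_distrib)
  qed
  also have "\<dots> \<le> (\<Sum>T\<in>Pow A. exp (b * ln (1 / \<theta>)) * (\<theta> * z) ^ card T)"
    using A \<theta> z by (intro sum_mono2) auto
  also have "\<dots> = exp (b * ln (1 / \<theta>)) * (1 + \<theta> * z) ^ card A"
    using A by (simp add: sum_distrib_left[symmetric] sum_power_card_Pow)
  also have "\<dots> \<le> exp (b * ln (1 / \<theta>)) * exp (\<theta> * z) ^ card A"
    using \<theta> z by (intro mult_left_mono power_mono exp_ge_add_one_self) auto
  also have "\<dots> = exp (b * ln (1 / \<theta>) + \<theta> * z * real (card A))"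
    by (simp add: exp_add exp_of_nat_mult[symmetric] mult.commute)
  finally show ?thesis .
qed

locale sparse_range = vertex_partition n r P + greedy_transversals P r "real n" p \<rho> \<sigma> d N
  for n r :: nat and P :: "nat set set" and p \<rho> \<sigma> :: real and d N :: nat +
  fixes m :: nat and \<delta> \<gamma> \<eta> z \<tau> \<Lambda> \<epsilon> M u S :: real
  assumes \<eta>: "0 < \<eta>" "\<eta> \<le> 1" and \<delta>_nonneg: "0 \<le> \<delta>" and z_pos: "0 < z" and \<Lambda>_pos: "0 < \<Lambda>"
    and \<epsilon>: "0 < \<epsilon>" "\<epsilon> \<le> 1" and u_nonneg: "0 \<le> u"
    and m_less: "m < e_part P" and m_le: "real m \<le> z * real (e_part P - m)"
    and mean: "real (e_part P) * p \<le> (1 - \<eta>) * ((1 - (real r + 1) * \<delta>) * real m)"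
    and cliques_ge_1: "2 \<le> j \<Longrightarrow> j \<le> r \<Longrightarrow> 1 \<le> cliques_per_pair (real n) p j"
    and cliques_ge_\<Lambda>: "3 \<le> j \<Longrightarrow> j \<le> r \<Longrightarrow> \<Lambda> \<le> cliques_per_pair (real n) p j"
    and M: "0 \<le> M" "M \<le> \<tau> * \<Lambda>" "V \<in> P \<Longrightarrow> M \<le> expected_completions p V"
    and \<tau>: "0 < \<tau>" "2 ^ r * ((real r + 2) * (2 * real r) ^ r * \<tau>) \<le> \<epsilon>"
    and d_small: "2 * sqrt (real d) \<le> \<tau> * sqrt (p * real n)"
    and room: "real y * real d \<le> \<delta> * real m \<Longrightarrow> room_for y"
    and box_sum: "box_sum_bound \<epsilon> * z ^ (r * d) \<le> exp (- (real r * (z * real n + u)))"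
    and star_sum: "(\<Sum>A\<in>{A\<in>Pow {1..n}. card A \<le> d}.
      z ^ card A * exp (- ((1 - \<epsilon>)\<^sup>2 * (real (card A) * min M (sqrt (p * real n / real (card A))))))) \<le> 1 + S"
begin

abbreviation "prob Q \<equiv> \<P>(R in random_subset E (\<lambda>_. p). Q R)"

lemma sparse_fibre:
  assumes "F \<subseteq> E" "real t \<le> \<delta> * real m" "real (card F) \<le> real r * (\<delta> * real m)" "antimono Q"
  shows "\<eta> * real (card {H. F \<subseteq> H \<and> H \<subseteq> E \<and> card H + t = m \<and> Q H})
    \<le> z ^ (t + card F) * real (e_part P choose m) * prob Q"
  unfolding e_part_def
proof (rule card_supersets_antimono_le[OF finite_E assms(1) _ p_le_1 _ \<eta>(2) _ _ _ assms(4)])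
  have "(1 - (real r + 1) * \<delta>) * real m \<le> real m - real t - real (card F)"
    using assms(2,3) by (simp add: algebra_simps)
  then have "(1 - \<eta>) * ((1 - (real r + 1) * \<delta>) * real m) \<le> (1 - \<eta>) * (real m - real t - real (card F))"
    using \<eta> by (intro mult_left_mono) auto
  then show "real (card E) * p \<le> (1 - \<eta>) * (real m - real t - real (card F))"
    using mean by (simp add: e_part_def)
qed (use p_pos \<eta> m_less m_le in \<open>auto simp: e_part_def\<close>)

definition star_weight :: "nat \<Rightarrow> real" where
  "star_weight a = min M (sqrt (p * real n / real a))"

definition small_stars :: "nat set set \<Rightarrow> (nat set \<Rightarrow> nat) \<Rightarrow> nat set set" where
  "small_stars T c = {e\<in>T. star_size T c e \<le> d}"

definition gain :: "nat set set \<Rightarrow> (nat set \<Rightarrow> nat) \<Rightarrow> real" where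
  "gain T c = (\<Sum>e\<in>small_stars T c. star_weight (star_size T c e))"

definition gain_cap :: real where
  "gain_cap = \<tau> * (real n ^ 2 * p)"

lemma star_weight_nonneg: "0 \<le> star_weight a"
  using M(1) p_pos by (simp add: star_weight_def)

lemma vertex_gain_le:
  assumes "star_decomposition d T c"
  shows "(\<Sum>e\<in>{e\<in>small_stars T c. x \<in> e}. star_weight (star_size T c e)) \<le> \<tau> * (real n * p)"
proof -
  have "(\<Sum>e\<in>{e\<in>small_stars T c. x \<in> e}. star_weight (star_size T c e))
      \<le> (\<Sum>e\<in>{e\<in>small_stars T c. x \<in> e}. sqrt (p * real n) * (1 / sqrt (real (star_size T c e))))"
    by (intro sum_mono) (simp add: star_weight_def real_sqrt_divide)
  also have "\<dots> = sqrt (p * real n) * (\<Sum>e\<in>{e\<in>T. x \<in> e \<and> star_size T c e \<le> d}. 1 / sqrt (real (star_size T c e)))"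
    unfolding sum_distrib_left by (intro sum.cong) (auto simp: small_stars_def)
  also have "\<dots> \<le> sqrt (p * real n) * (2 * sqrt (real (min (vertex_degree T x) d)))"
    using assms p_pos by (intro mult_left_mono) (auto simp: star_decomposition_def)
  also have "\<dots> \<le> sqrt (p * real n) * (2 * sqrt (real d))"
    using p_pos by (intro mult_left_mono) auto
  also have "\<dots> \<le> sqrt (p * real n) * (\<tau> * sqrt (p * real n))"
    using d_small p_pos by (intro mult_left_mono) auto
  also have "\<dots> = \<tau> * (real n * p)" using p_pos by (simp add: mult_ac)
  finally show ?thesis .
qed

lemma prob_small_stars_clique_free_le:
  assumes T: "finite T" "T \<subseteq> inner_pairs" and c: "star_decomposition d T c"
  shows "prob (edge_clique_free (small_stars T c)) \<le> exp (- ((1 - \<epsilon>) * min (gain T c) gain_cap))"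
proof -
  let ?T = "small_stars T c" and ?g = "gain T c" and ?w = "\<lambda>e. star_weight (star_size T c e)"
  define s where "s = (if ?g \<le> gain_cap then 1 else gain_cap / ?g)"
  have cap: "0 < gain_cap" using \<tau> n_pos p_pos by (simp add: gain_cap_def)
  have g: "0 \<le> ?g" unfolding gain_def using star_weight_nonneg by (intro sum_nonneg)
  have s: "0 \<le> s" "s \<le> 1" "s * ?g = min ?g gain_cap" using cap by (auto simp: s_def)
  have scaled: "s * ?w e \<le> ?w e" for e
    using s star_weight_nonneg mult_right_mono[of s 1 "?w e"] by simp
  then have le_M: "s * ?w e \<le> M" for e by (rule order_trans) (simp add: star_weight_def)
  have sum: "(\<Sum>e\<in>?T. s * ?w e) = min ?g gain_cap"
    using s(3) by (simp add: gain_def sum_distrib_left)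
  interpret weighted_inner_pairs P r "real n" p \<tau> \<Lambda> ?T "\<lambda>e. s * ?w e"
  proof
    show "finite ?T" "?T \<subseteq> inner_pairs" using T by (auto simp: small_stars_def)
    show "0 \<le> s * ?w e" for e using s star_weight_nonneg by simp
    show "s * ?w e \<le> expected_completions p V" if "V \<in> P" for e V
      using le_M M(3)[OF that] by (rule order_trans)
    show "(\<Sum>e\<in>?T. s * ?w e) \<le> \<tau> * ((real n)\<^sup>2 * p)" unfolding sum by (simp add: gain_cap_def)
    show "s * ?w e \<le> \<tau> * \<Lambda>" for e using le_M M(2) by (rule order_trans)
    have "(\<Sum>e\<in>{e\<in>?T. x \<in> e}. s * ?w e) \<le> (\<Sum>e\<in>{e\<in>?T. x \<in> e}. ?w e)" for x
      using scaled by (rule sum_mono)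
    then show "(\<Sum>e\<in>{e\<in>?T. x \<in> e}. s * ?w e) \<le> \<tau> * (real n * p)" for x
      using vertex_gain_le[OF c] by (rule order_trans)
  qed (use n_pos p_pos p_le_1 \<Lambda>_pos \<tau> part_ge cliques_ge_1 cliques_ge_\<Lambda> in auto)
  have "prob (edge_clique_free ?T)
      \<le> exp (- ((1 - 2 ^ r * ((real r + 2) * (2 * real r) ^ r * \<tau>)) * min ?g gain_cap))"
    using prob_edge_clique_free_le unfolding sum partition_graph_eq .
  also have "\<dots> \<le> exp (- ((1 - \<epsilon>) * min ?g gain_cap))"
    using \<tau>(2) g cap by (simp add: mult_right_mono)
  finally show ?thesis .
qed

definition large_gain :: "nat set set \<Rightarrow> (nat set \<Rightarrow> nat) \<Rightarrow> bool" where
  "large_gain T c \<longleftrightarrow> star_decomposition d T c \<and> gain_cap < gain T c"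

definition F_large_gain :: "nat set set set" where
  "F_large_gain = {G\<in>F_star n m r \<delta> \<gamma> P. \<exists>c. large_gain (inner_edges G) c}"

lemma large_gain_fibre:
  assumes T: "T \<subseteq> inner_pairs" "real (card T) \<le> \<delta> * real m" and c: "large_gain T c"
  shows "\<eta> * real (card {H. {} \<subseteq> H \<and> H \<subseteq> E \<and> card H + card T = m \<and> edge_clique_free (small_stars T c) H})
    \<le> z ^ card T * (real (e_part P choose m) * exp (- ((1 - \<epsilon>) * gain_cap)))"
proof -
  have finite: "finite T" using T(1) inner_pairs_subset
    by (meson finite_subset finite_imp_finite_nsets finite_atLeastAtMost)
  have "\<eta> * real (card {H. {} \<subseteq> H \<and> H \<subseteq> E \<and> card H + card T = m \<and> edge_clique_free (small_stars T c) H})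
      \<le> z ^ (card T + card ({} :: nat set set)) * real (e_part P choose m)
          * prob (edge_clique_free (small_stars T c))"
    by (rule sparse_fibre[OF _ T(2) _ antimono_edge_clique_free]) (use \<delta>_nonneg in auto)
  also have "\<dots> \<le> z ^ (card T + card ({} :: nat set set)) * real (e_part P choose m)
      * exp (- ((1 - \<epsilon>) * gain_cap))"
  proof (rule mult_left_mono)
    show "prob (edge_clique_free (small_stars T c)) \<le> exp (- ((1 - \<epsilon>) * gain_cap))"
      using prob_small_stars_clique_free_le[OF finite T(1), of c] c by (simp add: large_gain_def min_absorb2)
  qed (use z_pos in simp)
  finally show ?thesis by simp
qed

lemma card_F_large_gain_le:
  assumes \<theta>: "0 < \<theta>" "\<theta> \<le> 1"
  shows "\<eta> * real (card F_large_gain) \<le> real (e_part P choose m) *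
     exp (- ((1 - \<epsilon>) * gain_cap) + (\<delta> * real m * ln (1 / \<theta>) + \<theta> * z * real n ^ 2))"
proof -
  let ?C = "real (e_part P choose m) * exp (- ((1 - \<epsilon>) * gain_cap))"
  define centre where "centre T = (SOME c. large_gain T c)" for T
  define \<T> where "\<T> = {T\<in>Pow inner_pairs. real (card T) \<le> \<delta> * real m \<and> (\<exists>c. large_gain T c)}"
  let ?D = "\<lambda>T. {H. {} \<subseteq> H \<and> H \<subseteq> E \<and> card H + card T = m \<and> edge_clique_free (small_stars T (centre T)) H}"
  have centre: "large_gain T (centre T)" if "T \<in> \<T>" for T
    using that someI_ex[of "large_gain T"] by (simp add: \<T>_def centre_def)
  have pairs: "finite inner_pairs"
    using inner_pairs_subset by (rule finite_subset) (simp add: finite_imp_finite_nsets)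
  have "F_large_gain \<subseteq> (\<Union>T\<in>\<T>. (\<lambda>H. T \<union> H) ` ?D T)"
  proof
    fix G assume "G \<in> F_large_gain"
    then have G: "G \<in> F_star n m r \<delta> \<gamma> P" and large: "\<exists>c. large_gain (inner_edges G) c"
      by (auto simp: F_large_gain_def)
    have "edge_clique_free (small_stars (inner_edges G) c) (G \<inter> E)" for c
      using inner_edges_clique_free[OF G] by (auto simp: edge_clique_free_def small_stars_def)
    then have "G \<inter> E \<in> ?D (inner_edges G)" using card_cross_edges[OF G] by simp
    then have "G \<in> (\<lambda>H. inner_edges G \<union> H) ` ?D (inner_edges G)"
      using G_split(1)[OF G] by (rule image_eqI[rotated])
    moreover have "inner_edges G \<in> \<T>"
      unfolding \<T>_def using inner_edges_finite(2)[OF G] card_inner_edges_le[OF G] large by simp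
    ultimately show "G \<in> (\<Union>T\<in>\<T>. (\<lambda>H. T \<union> H) ` ?D T)" by blast
  qed
  then have "\<eta> * real (card F_large_gain) \<le> \<eta> * (\<Sum>T\<in>\<T>. real (card (?D T)))"
    using pairs finite_E \<eta> by (intro mult_left_mono card_le_sum_fibres) (auto simp: \<T>_def)
  also have "\<dots> \<le> (\<Sum>T\<in>\<T>. z ^ card T * ?C)"
    unfolding sum_distrib_left using centre by (intro sum_mono large_gain_fibre) (auto simp: \<T>_def)
  also have "\<dots> = (\<Sum>T\<in>\<T>. z ^ card T) * ?C" by (rule sum_distrib_right[symmetric])
  also have "\<dots> \<le> exp (\<delta> * real m * ln (1 / \<theta>) + \<theta> * z * real n ^ 2) * ?C"
  proof (rule mult_right_mono)
    have "(\<Sum>T\<in>\<T>. z ^ card T) \<le> (\<Sum>T\<in>{T\<in>Pow inner_pairs. real (card T) \<le> \<delta> * real m}. z ^ card T)"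
      using pairs z_pos by (intro sum_mono2) (auto simp: \<T>_def)
    also have "\<dots> \<le> exp (\<delta> * real m * ln (1 / \<theta>) + \<theta> * z * real (card inner_pairs))"
      by (rule sum_small_subsets_le[OF pairs \<theta>]) (use z_pos in simp)
    also have "\<dots> \<le> exp (\<delta> * real m * ln (1 / \<theta>) + \<theta> * z * real n ^ 2)"
    proof -
      have "real (card inner_pairs) \<le> real n ^ 2" using card_pairs_le[OF inner_pairs_subset] by linarith
      then show ?thesis
        unfolding exp_le_cancel_iff using \<theta> z_pos by (intro add_left_mono mult_left_mono) auto
    qed
    finally show "(\<Sum>T\<in>\<T>. z ^ card T) \<le> exp (\<delta> * real m * ln (1 / \<theta>) + \<theta> * z * real n ^ 2)" .
  qed simp
  finally show ?thesis by (simp only: exp_add mult_ac)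
qed

end

section \<open>The sparse range: graphs with small gain\<close>

lemma le_exp_convex_combination:
  fixes x :: real
  assumes "x \<le> exp (- a)" "x \<le> exp (- b)" "0 \<le> t" "t \<le> 1"
  shows "x \<le> exp (- ((1 - t) * a + t * b))"
proof -
  have "(1 - t) * a + t * b \<le> (1 - t) * max a b + t * max a b"
    using assms(3,4) by (intro add_mono mult_left_mono) auto
  also have "\<dots> = max a b" by (simp add: algebra_simps)
  finally have "exp (- max a b) \<le> exp (- ((1 - t) * a + t * b))" by simp
  moreover have "x \<le> exp (- max a b)" using assms(1,2) by (simp add: max_def)
  ultimately show ?thesis by linarith
qed

lemma (in vertex_partition) ex_rich_part:
  assumes "X \<subseteq> {1..n}"
  shows "\<exists>V\<in>P. card X \<le> r * card (X \<inter> V)"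
proof (rule ccontr)
  assume "\<not> ?thesis"
  then have poor: "r * card (X \<inter> V) < card X" if "V \<in> P" for V using that by force
  have "X = (\<Union>V\<in>P. X \<inter> V)" using assms Union_P by blast
  then have "card X \<le> (\<Sum>V\<in>P. card (X \<inter> V))" using card_UN_le[OF finite_P, of "\<lambda>V. X \<inter> V"] by simp
  then have "r * card X \<le> (\<Sum>V\<in>P. r * card (X \<inter> V))" by (metis mult_le_mono2 sum_distrib_left)
  also have "\<dots> < (\<Sum>V\<in>P. card X)"
    using poor finite_P card_P r_ge_2 by (intro sum_strict_mono) auto
  also have "\<dots> = r * card X" using card_P by simp
  finally show False by simp
qed

lemma (in vertex_partition) ex_neighbour_box:
  assumes G: "G \<in> F_star n m r \<delta> \<gamma> P" and V0: "V0 \<in> P" "v \<in> V0"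
    and A: "A \<subseteq> {u\<in>V0. {v, u} \<in> G}" "d \<le> card A"
  shows "\<exists>W\<in>boxes P d. W V0 \<subseteq> A \<and> (\<forall>V\<in>P. W V \<subseteq> {u\<in>V. {v, u} \<in> G})"
proof -
  let ?nb = "\<lambda>V. {u\<in>V. {v, u} \<in> G}"
  have "\<exists>D. D \<subseteq> ?nb V \<and> card D = d \<and> (V = V0 \<longrightarrow> D \<subseteq> A)" if V: "V \<in> P" for V
  proof (cases "V = V0")
    case True
    then show ?thesis using obtain_subset_with_card_n[OF A(2)] A(1) by (metis subset_trans)
  next
    case False
    have "card A \<le> card (?nb V0)" using finite_part[OF V0(1)] A(1) by (intro card_mono) auto
    also have "\<dots> \<le> card (?nb V)"
      using deg_in_own_part_le[OF G V0(2,1) V] by (simp add: deg_in_def)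
    finally have "d \<le> card (?nb V)" using A(2) by simp
    then obtain D where "D \<subseteq> ?nb V" "card D = d" by (rule obtain_subset_with_card_n)
    then show ?thesis using False by blast
  qed
  then obtain W where W: "\<And>V. V \<in> P \<Longrightarrow> W V \<subseteq> ?nb V \<and> card (W V) = d \<and> (V = V0 \<longrightarrow> W V \<subseteq> A)"
    by metis
  have "restrict W P \<in> boxes P d"
  proof -
    have "W V \<in> nsets V d" if "V \<in> P" for V
      using W[OF that] finite_part[OF that] finite_subset[of "W V" V] by (auto simp: nsets_def)
    then show ?thesis by (simp add: boxes_def)
  qed
  moreover have "restrict W P V0 \<subseteq> A" using W[OF V0(1)] V0(1) by simp
  moreover have "\<forall>V\<in>P. restrict W P V \<subseteq> ?nb V" using W by simp
  ultimately show ?thesis by blast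
qed

context sparse_range
begin

text \<open>A graph of small gain is encoded by the leaf sets of its stars, a part that contains many of the
  large centres, and boxes inside the neighbourhoods of those centres.  The edges from a centre to its
  boxes are then forced, which costs a power of \<open>z\<close>, while the boxes must not span a clique.\<close>

definition star_maps :: "(nat \<Rightarrow> nat set) set" where
  "star_maps = PiE {1..n} (\<lambda>_. Pow {1..n})"

definition large_centres :: "(nat \<Rightarrow> nat set) \<Rightarrow> nat set" where
  "large_centres L = {v\<in>{1..n}. d < card (L v)}"

definition star_factor :: "nat \<Rightarrow> real" where
  "star_factor a = z ^ a * (if a \<le> d then exp (- ((1 - \<epsilon>)\<^sup>2 * (real a * star_weight a))) else 1)"

definition map_weight :: "(nat \<Rightarrow> nat set) \<Rightarrow> real" where
  "map_weight L = (\<Prod>v\<in>{1..n}. star_factor (card (L v)))"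

lemma finite_star_maps: "finite star_maps"
  unfolding star_maps_def by (intro finite_PiE) auto

lemma star_factor_nonneg: "0 \<le> star_factor a"
  using z_pos by (simp add: star_factor_def)

lemma map_weight_nonneg: "0 \<le> map_weight L"
  unfolding map_weight_def by (intro prod_nonneg) (simp add: star_factor_nonneg)

lemma sum_small_star_factors_le: "(\<Sum>A\<in>{A\<in>Pow {1..n}. card A \<le> d}. star_factor (card A)) \<le> 1 + S"
proof -
  have "(\<Sum>A\<in>{A\<in>Pow {1..n}. card A \<le> d}. star_factor (card A)) = (\<Sum>A\<in>{A\<in>Pow {1..n}. card A \<le> d}.
      z ^ card A * exp (- ((1 - \<epsilon>)\<^sup>2 * (real (card A) * min M (sqrt (p * real n / real (card A)))))))"
    by (intro sum.cong) (auto simp: star_factor_def star_weight_def)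
  then show ?thesis using star_sum by simp
qed

lemma S_nonneg: "0 \<le> S"
proof -
  have "star_factor (card ({} :: nat set)) \<le> (\<Sum>A\<in>{A\<in>Pow {1..n}. card A \<le> d}. star_factor (card A))"
    using star_factor_nonneg by (intro member_le_sum) auto
  then show ?thesis using sum_small_star_factors_le by (simp add: star_factor_def)
qed

lemma sum_large_star_factors_le:
  assumes A: "A \<subseteq> {1..n}"
  shows "(\<Sum>B\<in>{B\<in>Pow {1..n}. d < card B \<and> A \<subseteq> B}. star_factor (card B)) \<le> exp (z * real n) * z ^ card A"
proof -
  let ?s = "{B\<in>Pow {1..n}. d < card B \<and> A \<subseteq> B}"
  have inj: "inj_on (\<lambda>B. B - A) ?s" by (auto simp: inj_on_def)
  have "(\<Sum>B\<in>?s. star_factor (card B)) = (\<Sum>B\<in>?s. z ^ card A * z ^ card (B - A))"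
  proof (intro sum.cong refl)
    fix B assume B: "B \<in> ?s"
    have "card B = card A + card (B - A)"
      using B finite_subset[of B "{1..n}"] card_Un_disjoint[of A "B - A"] finite_subset[of A B]
      by (simp add: Un_absorb1)
    then show "star_factor (card B) = z ^ card A * z ^ card (B - A)"
      using B by (simp add: star_factor_def power_add)
  qed
  also have "\<dots> = z ^ card A * (\<Sum>C\<in>(\<lambda>B. B - A) ` ?s. z ^ card C)"
    by (simp only: sum_distrib_left[symmetric] sum.reindex[OF inj] o_def)
  also have "\<dots> \<le> z ^ card A * (\<Sum>C\<in>Pow {1..n}. z ^ card C)"
    using z_pos by (intro mult_left_mono sum_mono2) auto
  also have "\<dots> = z ^ card A * (1 + z) ^ n" by (simp add: sum_power_card_Pow)
  also have "\<dots> \<le> z ^ card A * exp z ^ n"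
    using z_pos by (intro mult_left_mono power_mono exp_ge_add_one_self) auto
  also have "\<dots> = exp (z * real n) * z ^ card A" by (simp add: exp_of_nat_mult[symmetric] mult.commute)
  finally show ?thesis .
qed

definition star_choices :: "nat set \<Rightarrow> (nat \<Rightarrow> nat set) \<Rightarrow> nat \<Rightarrow> nat set set" where
  "star_choices X A v =
    (if v \<in> X then {D\<in>Pow {1..n}. d < card D \<and> A v \<subseteq> D} else {D\<in>Pow {1..n}. card D \<le> d})"

lemma star_maps_subset_choices:
  "{L\<in>star_maps. large_centres L = X \<and> (\<forall>v\<in>Y. B v \<subseteq> L v)}
    \<subseteq> PiE {1..n} (star_choices X (\<lambda>v. if v \<in> Y then B v else {}))"
proof
  fix L assume "L \<in> {L\<in>star_maps. large_centres L = X \<and> (\<forall>v\<in>Y. B v \<subseteq> L v)}"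
  then have L: "L \<in> star_maps" "large_centres L = X" "\<forall>v\<in>Y. B v \<subseteq> L v" by auto
  have "L v \<in> star_choices X (\<lambda>v. if v \<in> Y then B v else {}) v" if v: "v \<in> {1..n}" for v
  proof -
    have "L v \<subseteq> {1..n}" using L(1) v by (auto simp: star_maps_def)
    moreover have "v \<in> X \<longleftrightarrow> d < card (L v)" using L(2) v by (auto simp: large_centres_def)
    ultimately show ?thesis using L(3) by (simp add: star_choices_def)
  qed
  then show "L \<in> PiE {1..n} (star_choices X (\<lambda>v. if v \<in> Y then B v else {}))"
    using L(1) by (auto simp: star_maps_def PiE_iff)
qed

lemma sum_star_choices_le:
  assumes "A v \<subseteq> {1..n}" "v \<notin> X \<Longrightarrow> A v = {}"
  shows "(\<Sum>D\<in>star_choices X A v. star_factor (card D))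
    \<le> (if v \<in> X then exp (z * real n) else 1 + S) * z ^ card (A v)"
  using sum_large_star_factors_le[OF assms(1)] sum_small_star_factors_le assms(2)
  by (cases "v \<in> X") (simp_all add: star_choices_def)

lemma sum_map_weights_le:
  assumes X: "X \<subseteq> {1..n}" "Y \<subseteq> X" and B: "\<And>v. v \<in> Y \<Longrightarrow> B v \<subseteq> {1..n} \<and> card (B v) = d"
  shows "(\<Sum>L\<in>{L\<in>star_maps. large_centres L = X \<and> (\<forall>v\<in>Y. B v \<subseteq> L v)}. map_weight L)
    \<le> (1 + S) ^ n * exp (z * real n) ^ card X * (z ^ d) ^ card Y"
proof -
  let ?e = "exp (z * real n)" and ?A = "\<lambda>v. if v \<in> Y then B v else {}"
  let ?choices = "star_choices X ?A"
  have "(\<Sum>L\<in>{L\<in>star_maps. large_centres L = X \<and> (\<forall>v\<in>Y. B v \<subseteq> L v)}. map_weight L)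
      \<le> (\<Sum>L\<in>PiE {1..n} ?choices. map_weight L)"
    using map_weight_nonneg
    by (intro sum_mono2[OF _ star_maps_subset_choices] finite_PiE) (auto simp: star_choices_def)
  also have "\<dots> = (\<Prod>v\<in>{1..n}. \<Sum>D\<in>?choices v. star_factor (card D))"
    unfolding map_weight_def by (intro prod_sum_PiE[symmetric]) (auto simp: star_choices_def)
  also have "\<dots> \<le> (\<Prod>v\<in>{1..n}. (if v \<in> X then ?e else 1 + S) * z ^ card (?A v))"
    using star_factor_nonneg B X by (intro prod_mono conjI sum_star_choices_le sum_nonneg) auto
  also have "\<dots> = (\<Prod>v\<in>{1..n}. (if v \<in> X then ?e else 1 + S) * (if v \<in> Y then z ^ d else 1))"
    using B by (intro prod.cong) auto
  also have "\<dots> = (?e ^ card X * (1 + S) ^ card ({1..n} - X)) * (z ^ d) ^ card Y"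
  proof -
    have "{1..n} \<inter> {v. v \<in> X} = X" "{1..n} \<inter> - {v. v \<in> X} = {1..n} - X" "{1..n} \<inter> {v. v \<in> Y} = Y"
      using X by auto
    then show ?thesis by (simp add: prod.distrib prod.If_cases)
  qed
  also have "\<dots> \<le> (?e ^ card X * (1 + S) ^ n) * (z ^ d) ^ card Y"
    using S_nonneg z_pos card_mono[of "{1..n}" "{1..n} - X"]
    by (intro mult_right_mono mult_left_mono power_increasing) auto
  finally show ?thesis by (simp only: mult_ac)
qed

definition star_total :: "(nat \<Rightarrow> nat set) \<Rightarrow> nat" where
  "star_total L = (\<Sum>v\<in>{1..n}. card (L v))"

lemma sum_nonempty_map_weights_le:
  "(\<Sum>L\<in>{L\<in>star_maps. large_centres L = {} \<and> 0 < star_total L}. map_weight L) \<le> (1 + S) ^ n - 1"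
proof -
  define L0 where "L0 = (\<lambda>v\<in>{1..n}. {} :: nat set)"
  let ?A = "{L\<in>star_maps. large_centres L = {} \<and> (\<forall>v\<in>{}. {} \<subseteq> L v)}"
  let ?B = "{L\<in>star_maps. large_centres L = {} \<and> 0 < star_total L}"
  have L0: "L0 \<in> ?A" "L0 \<notin> ?B" by (auto simp: L0_def star_maps_def large_centres_def star_total_def)
  have finite: "finite ?A" "finite ?B" using finite_star_maps by auto
  have "(\<Sum>L\<in>?B. map_weight L) + 1 = (\<Sum>L\<in>insert L0 ?B. map_weight L)"
    unfolding sum.insert[OF finite(2) L0(2)] by (simp add: map_weight_def L0_def star_factor_def)
  also have "\<dots> \<le> (\<Sum>L\<in>?A. map_weight L)"
    using finite(1) L0(1) map_weight_nonneg by (intro sum_mono2) auto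
  also have "\<dots> \<le> (1 + S) ^ n * exp (z * real n) ^ card ({} :: nat set) * (z ^ d) ^ card ({} :: nat set)"
    by (rule sum_map_weights_le[of "{}" "{}" "\<lambda>_. {}"]) auto
  finally show ?thesis by simp
qed

definition star_edges :: "(nat \<Rightarrow> nat set) \<Rightarrow> nat set set" where
  "star_edges L = (\<Union>v\<in>{1..n}. (\<lambda>u. {v, u}) ` L v)"

definition small_star_edges :: "(nat \<Rightarrow> nat set) \<Rightarrow> nat set set" where
  "small_star_edges L = (\<Union>v\<in>{1..n} - large_centres L. (\<lambda>u. {v, u}) ` L v)"

definition small_gain :: "(nat \<Rightarrow> nat set) \<Rightarrow> real" where
  "small_gain L = (\<Sum>v\<in>{1..n} - large_centres L. real (card (L v)) * star_weight (card (L v)))"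

lemma map_weight_eq: "map_weight L = z ^ star_total L * exp (- ((1 - \<epsilon>)\<^sup>2 * small_gain L))"
proof -
  let ?g = "\<lambda>v. exp (- ((1 - \<epsilon>)\<^sup>2 * (real (card (L v)) * star_weight (card (L v)))))"
  have "map_weight L = (\<Prod>v\<in>{1..n}. z ^ card (L v)) * (\<Prod>v\<in>{1..n}. if v \<in> large_centres L then 1 else ?g v)"
    unfolding map_weight_def star_factor_def prod.distrib[symmetric]
    by (intro prod.cong) (auto simp: large_centres_def)
  also have "(\<Prod>v\<in>{1..n}. z ^ card (L v)) = z ^ star_total L" by (simp add: star_total_def power_sum)
  also have "(\<Prod>v\<in>{1..n}. if v \<in> large_centres L then 1 else ?g v) = (\<Prod>v\<in>{1..n} - large_centres L. ?g v)"
    by (simp add: prod.If_cases Diff_eq)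
  also have "\<dots> = exp (- ((1 - \<epsilon>)\<^sup>2 * small_gain L))"
    unfolding small_gain_def sum_distrib_left sum_negf[symmetric] by (rule exp_sum[symmetric]) simp
  finally show ?thesis .
qed

definition leaves :: "nat set set \<Rightarrow> (nat set \<Rightarrow> nat) \<Rightarrow> nat \<Rightarrow> nat set" where
  "leaves T c = (\<lambda>v\<in>{1..n}. {u. {v, u} \<in> T \<and> c {v, u} = v})"

context
  fixes T c
  assumes T: "T \<subseteq> nsets {1..n} 2" and c: "\<forall>e\<in>T. c e \<in> e"
begin

lemma centre_in: "e \<in> T \<Longrightarrow> c e \<in> {1..n}"
  using T c unfolding nsets_def by blast

lemma star_leaves:
  assumes "v \<in> {1..n}"
  shows "(\<lambda>u. {v, u}) ` leaves T c v = {e\<in>T. c e = v}"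
proof (intro equalityI subsetI)
  fix e assume e: "e \<in> {e\<in>T. c e = v}"
  then have "v \<in> e" "card e = 2" using c T by (auto simp: nsets_def)
  then obtain u where "e = {v, u}" by (auto simp: card_2_iff)
  then show "e \<in> (\<lambda>u. {v, u}) ` leaves T c v" using e assms by (auto simp: leaves_def)
qed (use assms in \<open>auto simp: leaves_def\<close>)

lemma card_leaves: "v \<in> {1..n} \<Longrightarrow> card (leaves T c v) = card {e\<in>T. c e = v}"
  using card_image[OF inj_on_doubleton, of v "leaves T c v"] star_leaves by simp

lemma star_size_leaves: "e \<in> T \<Longrightarrow> star_size T c e = card (leaves T c (c e))"
  using card_leaves[OF centre_in] by (simp add: star_size_def)

lemma leaves_in_star_maps: "leaves T c \<in> star_maps"
  using T by (auto simp: leaves_def star_maps_def nsets_def)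

lemma star_edges_leaves: "star_edges (leaves T c) = T"
  using star_leaves centre_in by (auto simp: star_edges_def)

lemma small_star_edges_leaves: "small_star_edges (leaves T c) = small_stars T c"
proof -
  have "small_star_edges (leaves T c) = {e\<in>T. c e \<notin> large_centres (leaves T c)}"
    using star_leaves centre_in by (auto simp: small_star_edges_def)
  then show ?thesis
    using star_size_leaves centre_in by (auto simp: small_stars_def large_centres_def)
qed

lemma star_total_leaves: "star_total (leaves T c) = card T"
proof -
  have finite: "finite T" using T by (rule finite_subset) (simp add: finite_imp_finite_nsets)
  have "star_total (leaves T c) = (\<Sum>v\<in>{1..n}. \<Sum>e\<in>{e\<in>T. c e = v}. 1)"
    unfolding star_total_def using card_leaves by (intro sum.cong) auto
  also have "\<dots> = (\<Sum>e\<in>T. 1)" by (rule sum.group) (use finite centre_in in auto)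
  finally show ?thesis by simp
qed

lemma small_gain_leaves: "small_gain (leaves T c) = gain T c"
proof -
  let ?V = "{1..n} - large_centres (leaves T c)"
  have finite: "finite T" using T by (rule finite_subset) (simp add: finite_imp_finite_nsets)
  have "gain T c = (\<Sum>v\<in>?V. \<Sum>e\<in>{e\<in>small_stars T c. c e = v}. star_weight (star_size T c e))"
    unfolding gain_def
    by (rule sum.group[symmetric])
      (use finite centre_in star_size_leaves in \<open>auto simp: small_stars_def large_centres_def\<close>)
  also have "\<dots> = small_gain (leaves T c)" unfolding small_gain_def
  proof (intro sum.cong refl)
    fix v assume v: "v \<in> ?V"
    then have "{e\<in>small_stars T c. c e = v} = {e\<in>T. c e = v}"
      using star_size_leaves by (auto simp: small_stars_def large_centres_def)
    then show "(\<Sum>e\<in>{e\<in>small_stars T c. c e = v}. star_weight (star_size T c e))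
        = real (card (leaves T c v)) * star_weight (card (leaves T c v))"
      using v star_size_leaves card_leaves[of v] by simp
  qed
  finally show ?thesis by simp
qed

end

definition spokes :: "nat set \<Rightarrow> nat set \<Rightarrow> (nat \<Rightarrow> nat set \<Rightarrow> nat set) \<Rightarrow> nat set set" where
  "spokes V0 Y B = (\<lambda>(v, u). {v, u}) ` (SIGMA v:Y. \<Union>V\<in>P - {V0}. B v V)"

context
  fixes V0 Y B
  assumes V0: "V0 \<in> P" "Y \<subseteq> V0" and B: "\<forall>v\<in>Y. B v \<in> boxes P d"
begin

lemma spokes_subset: "spokes V0 Y B \<subseteq> E"
proof
  fix e assume "e \<in> spokes V0 Y B"
  then obtain v V u where "v \<in> Y" "V \<in> P - {V0}" "u \<in> B v V" "e = {v, u}" by (auto simp: spokes_def)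
  then show "e \<in> E" using cross_pair[OF V0(1), of V v u] V0(2) boxD(1)[of "B v" P d V] B by auto
qed

lemma card_spokes: "card (spokes V0 Y B) = card Y * ((r - 1) * d)"
proof -
  let ?U = "\<lambda>v. \<Union>V\<in>P - {V0}. B v V"
  have box: "B v V \<subseteq> V" "finite (B v V)" "card (B v V) = d" if "v \<in> Y" "V \<in> P" for v V
    using boxD[OF bspec[OF B that(1)] that(2)] by auto
  have outside: "u \<notin> V0" if "v \<in> Y" "u \<in> ?U v" for u v
    using box[OF that(1)] that(2) same_part[OF V0(1)] by fastforce
  have U: "finite (?U v) \<and> card (?U v) = (r - 1) * d" if v: "v \<in> Y" for v
  proof -
    have "card (?U v) = (\<Sum>V\<in>P - {V0}. card (B v V))"
    proof (rule card_UN_disjoint)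
      show "\<forall>V\<in>P - {V0}. \<forall>W\<in>P - {V0}. V \<noteq> W \<longrightarrow> B v V \<inter> B v W = {}"
        using disjoint_box[OF bspec[OF B v]] by (auto simp: disjoint_family_on_def)
    qed (use finite_P box[OF v] in auto)
    then show ?thesis using box[OF v] V0(1) finite_P card_P by simp
  qed
  have "inj_on (\<lambda>(v, u). {v, u}) (SIGMA v:Y. ?U v)"
    using outside V0(2) by (fastforce simp: inj_on_def doubleton_eq_iff)
  then have "card (spokes V0 Y B) = card (SIGMA v:Y. ?U v)" unfolding spokes_def by (rule card_image)
  also have "\<dots> = (\<Sum>v\<in>Y. card (?U v))"
    using U V0 finite_part finite_subset by (intro card_SigmaI) blast+
  finally show ?thesis using U by simp
qed

end

definition box_gain :: "nat set \<Rightarrow> (nat \<Rightarrow> nat set \<Rightarrow> nat set) \<Rightarrow> real" where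
  "box_gain Y B = half_mean (greedy_family (sorted_list_of_set Y) B)"

definition sparse_maps :: "(nat \<Rightarrow> nat set) set" where
  "sparse_maps = {L\<in>star_maps. 0 < star_total L \<and> real (star_total L) \<le> \<delta> * real m \<and>
      prob (edge_clique_free (small_star_edges L)) \<le> exp (- ((1 - \<epsilon>) * small_gain L))}"

lemma finite_sparse_maps: "finite sparse_maps"
  using finite_star_maps by (simp add: sparse_maps_def)

lemma card_large_centres_le: "card (large_centres L) * d \<le> star_total L"
proof -
  have "card (large_centres L) * d = (\<Sum>v\<in>large_centres L. d)" by simp
  also have "\<dots> \<le> (\<Sum>v\<in>large_centres L. card (L v))" by (rule sum_mono) (auto simp: large_centres_def)
  also have "\<dots> \<le> star_total L" unfolding star_total_def by (rule sum_mono2) (auto simp: large_centres_def)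
  finally show ?thesis .
qed

definition code_graphs :: "(nat \<Rightarrow> nat set) \<Rightarrow> nat set \<Rightarrow> (nat \<Rightarrow> nat set \<Rightarrow> nat set) \<Rightarrow> nat set set set" where
  "code_graphs L V0 B = (let Y = large_centres L \<inter> V0 in
    {H. spokes V0 Y B \<subseteq> H \<and> H \<subseteq> E \<and> card H + star_total L = m \<and>
      edge_clique_free (small_star_edges L) H \<and> (\<forall>v\<in>Y. box_clique_free (B v) H)})"

definition box_factor :: "nat set \<Rightarrow> (nat \<Rightarrow> nat set \<Rightarrow> nat set) \<Rightarrow> real" where
  "box_factor Y B = z ^ (card Y * ((r - 1) * d)) * exp (- (\<epsilon> * box_gain Y B))"

lemma prob_code_clique_free_le:
  assumes L: "L \<in> sparse_maps" and Y: "finite Y" and B: "\<forall>v\<in>Y. B v \<in> boxes P d"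
  shows "prob (\<lambda>H. edge_clique_free (small_star_edges L) H \<and> (\<forall>v\<in>Y. box_clique_free (B v) H))
    \<le> exp (- ((1 - \<epsilon>)\<^sup>2 * small_gain L)) * exp (- (\<epsilon> * box_gain Y B))"
    (is "prob ?Q \<le> _")
proof -
  have "prob ?Q \<le> prob (edge_clique_free (small_star_edges L))" by (rule prob_random_subset_mono) auto
  then have stars: "prob ?Q \<le> exp (- ((1 - \<epsilon>) * small_gain L))" using L by (simp add: sparse_maps_def)
  have "prob ?Q \<le> prob (\<lambda>H. \<forall>v\<in>set (sorted_list_of_set Y). box_clique_free (B v) H)"
    using Y by (intro prob_random_subset_mono) auto
  also have "\<dots> \<le> exp (- box_gain Y B)"
    unfolding box_gain_def partition_graph_eq using B Y by (intro prob_boxes_clique_free_le) auto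
  finally have "prob ?Q \<le> exp (- box_gain Y B)" .
  from le_exp_convex_combination[OF stars this, of \<epsilon>] show ?thesis
    using \<epsilon> by (simp add: exp_add[symmetric] power2_eq_square mult.assoc)
qed

lemma card_spokes_le_star_total:
  assumes V0: "V0 \<in> P" and B: "\<forall>v\<in>large_centres L \<inter> V0. B v \<in> boxes P d"
  shows "card (spokes V0 (large_centres L \<inter> V0) B) \<le> r * star_total L"
proof -
  let ?Y = "large_centres L \<inter> V0"
  have "finite (large_centres L)" by (simp add: large_centres_def)
  then have "card ?Y * d \<le> card (large_centres L) * d" by (intro mult_le_mono card_mono) auto
  also have "\<dots> \<le> star_total L" by (rule card_large_centres_le)
  finally have "(r - 1) * (card ?Y * d) \<le> r * star_total L" by (intro mult_le_mono) auto
  then show ?thesis using card_spokes[OF V0 _ B] by (simp add: mult_ac)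
qed

lemma card_code_graphs_le:
  assumes L: "L \<in> sparse_maps" and V0: "V0 \<in> P" and B: "B \<in> PiE (large_centres L \<inter> V0) (\<lambda>_. boxes P d)"
  shows "\<eta> * real (card (code_graphs L V0 B))
    \<le> real (e_part P choose m) * (map_weight L * box_factor (large_centres L \<inter> V0) B)"
proof -
  define Y where "Y = large_centres L \<inter> V0"
  let ?Q = "\<lambda>H. edge_clique_free (small_star_edges L) H \<and> (\<forall>v\<in>Y. box_clique_free (B v) H)"
  let ?z = "z ^ (star_total L + card (spokes V0 Y B)) * real (e_part P choose m)"
  have Y: "finite Y" "Y \<subseteq> V0" by (auto simp: Y_def large_centres_def)
  have B: "\<forall>v\<in>Y. B v \<in> boxes P d" using B by (auto simp: Y_def)
  have total: "real (star_total L) \<le> \<delta> * real m" using L by (simp add: sparse_maps_def)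
  have "real (card (spokes V0 Y B)) \<le> real r * real (star_total L)"
    using card_spokes_le_star_total[OF V0] B unfolding Y_def by (metis of_nat_le_iff of_nat_mult)
  also have "\<dots> \<le> real r * (\<delta> * real m)" using total by (intro mult_left_mono) auto
  finally have few: "real (card (spokes V0 Y B)) \<le> real r * (\<delta> * real m)" .
  have Q: "antimono ?Q"
    using antimonoD[OF antimono_edge_clique_free] antimonoD[OF antimono_box_clique_free]
    by (intro antimonoI) (auto simp: le_bool_def)
  have "\<eta> * real (card (code_graphs L V0 B)) \<le> ?z * prob ?Q"
    using sparse_fibre[OF spokes_subset[OF V0 Y(2) B] total few Q] by (simp add: code_graphs_def Let_def Y_def)
  also have "\<dots> \<le> ?z * (exp (- ((1 - \<epsilon>)\<^sup>2 * small_gain L)) * exp (- (\<epsilon> * box_gain Y B)))"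
    using prob_code_clique_free_le[OF L Y(1) B] z_pos by (intro mult_left_mono) auto
  also have "\<dots> = real (e_part P choose m) * (map_weight L * box_factor Y B)"
    by (simp add: map_weight_eq box_factor_def card_spokes[OF V0 Y(2) B] power_add mult_ac)
  finally show ?thesis by (simp only: Y_def)
qed

definition rich_parts :: "nat set \<Rightarrow> nat set set" where
  "rich_parts X = {V\<in>P. card X \<le> r * card (X \<inter> V)}"

definition code_maps :: "nat set \<Rightarrow> nat set \<Rightarrow> (nat \<Rightarrow> nat set \<Rightarrow> nat set) \<Rightarrow> (nat \<Rightarrow> nat set) set" where
  "code_maps X V0 B = {L\<in>sparse_maps. large_centres L = X \<and> (\<forall>v\<in>X \<inter> V0. B v V0 \<subseteq> L v)}"

definition centre_sets :: "nat set set" where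
  "centre_sets = {X\<in>Pow {1..n}. real (card X) * real d \<le> \<delta> * real m}"

definition star_codes ::
  "(nat set \<times> nat set \<times> (nat \<Rightarrow> nat set \<Rightarrow> nat set) \<times> (nat \<Rightarrow> nat set)) set" where
  "star_codes = (SIGMA X:centre_sets. SIGMA V0:rich_parts X. SIGMA B:PiE (X \<inter> V0) (\<lambda>_. boxes P d). code_maps X V0 B)"

lemma leaves_in_sparse_maps:
  assumes G: "G \<in> F_star n m r \<delta> \<gamma> P" "G \<notin> F_large_gain" and c: "star_decomposition d (inner_edges G) c"
  shows "leaves (inner_edges G) c \<in> sparse_maps"
proof -
  let ?T = "inner_edges G"
  have T: "?T \<subseteq> nsets {1..n} 2" "\<forall>e\<in>?T. c e \<in> e"
    using inner_edges_finite(2) inner_pairs_subset c by (auto simp: star_decomposition_def inner_edges_def)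
  have "gain ?T c \<le> gain_cap" using G c by (auto simp: F_large_gain_def large_gain_def not_less)
  then have "prob (edge_clique_free (small_stars ?T c)) \<le> exp (- ((1 - \<epsilon>) * gain ?T c))"
    using prob_small_stars_clique_free_le[OF inner_edges_finite[OF G(1)] c] by (simp add: min_absorb1)
  moreover have "0 < card ?T"
    using inner_edges_nonempty[OF G(1)] inner_edges_finite(1)[OF G(1)] by (simp add: card_gt_0_iff)
  ultimately show ?thesis
    using leaves_in_star_maps[OF T] card_inner_edges_le[OF G(1)]
    by (simp add: sparse_maps_def small_star_edges_leaves[OF T] star_total_leaves[OF T] small_gain_leaves[OF T])
qed

lemma ex_leaf_boxes:
  fixes c
  assumes G: "G \<in> F_star n m r \<delta> \<gamma> P" and V0: "V0 \<in> P"
  defines "L \<equiv> leaves (inner_edges G) c"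
  shows "\<exists>B\<in>PiE (large_centres L \<inter> V0) (\<lambda>_. boxes P d).
    \<forall>v\<in>large_centres L \<inter> V0. B v V0 \<subseteq> L v \<and> (\<forall>V\<in>P. B v V \<subseteq> {u\<in>V. {v, u} \<in> G})"
proof -
  have "\<forall>v\<in>large_centres L \<inter> V0. \<exists>W. W \<in> boxes P d \<and> W V0 \<subseteq> L v \<and> (\<forall>V\<in>P. W V \<subseteq> {u\<in>V. {v, u} \<in> G})"
  proof
    fix v assume v: "v \<in> large_centres L \<inter> V0"
    have "L v \<subseteq> {u\<in>V0. {v, u} \<in> G}"
    proof
      fix u assume "u \<in> L v"
      then have e: "{v, u} \<in> inner_edges G" using v by (auto simp: L_def leaves_def large_centres_def)
      then obtain V where V: "V \<in> P" "{v, u} \<subseteq> V" by (auto simp: inner_edges_def inner_pairs_def nsets_def)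
      then have "V = V0" using same_part[OF V(1) V0, of v] v by auto
      then show "u \<in> {u\<in>V0. {v, u} \<in> G}" using V e by (auto simp: inner_edges_def)
    qed
    moreover have "d \<le> card (L v)" using v by (simp add: large_centres_def)
    ultimately show "\<exists>W. W \<in> boxes P d \<and> W V0 \<subseteq> L v \<and> (\<forall>V\<in>P. W V \<subseteq> {u\<in>V. {v, u} \<in> G})"
      using ex_neighbour_box[OF G V0, of v "L v" d] v by blast
  qed
  from bchoice[OF this] obtain B where "\<forall>v\<in>large_centres L \<inter> V0.
      B v \<in> boxes P d \<and> B v V0 \<subseteq> L v \<and> (\<forall>V\<in>P. B v V \<subseteq> {u\<in>V. {v, u} \<in> G})" ..
  then show ?thesis by (intro bexI[of _ "restrict B (large_centres L \<inter> V0)"]) auto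
qed

lemma in_code_graphs:
  assumes G: "G \<in> F_star n m r \<delta> \<gamma> P" and c: "\<forall>e\<in>inner_edges G. c e \<in> e" and V0: "V0 \<in> P"
  defines "L \<equiv> leaves (inner_edges G) c"
  assumes B: "\<forall>v\<in>large_centres L \<inter> V0. B v \<in> boxes P d \<and> (\<forall>V\<in>P. B v V \<subseteq> {u\<in>V. {v, u} \<in> G})"
  shows "G \<inter> E \<in> code_graphs L V0 B"
proof -
  have T: "inner_edges G \<subseteq> nsets {1..n} 2" using inner_edges_finite(2)[OF G] inner_pairs_subset by blast
  have "spokes V0 (large_centres L \<inter> V0) B \<subseteq> G" using B by (fastforce simp: spokes_def)
  moreover have "spokes V0 (large_centres L \<inter> V0) B \<subseteq> E" using B V0 by (intro spokes_subset) auto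
  moreover have "edge_clique_free (small_star_edges L) (G \<inter> E)"
    using inner_edges_clique_free[OF G] unfolding L_def small_star_edges_leaves[OF T c]
    by (auto simp: edge_clique_free_def small_stars_def)
  moreover have "box_clique_free (B v) (G \<inter> E)" if v: "v \<in> large_centres L \<inter> V0" for v
    using neighbourhood_clique_free[OF G, of v "B v"] B v by (auto simp: box_clique_free_def large_centres_def)
  moreover have "card (G \<inter> E) + star_total L = m"
    using card_cross_edges[OF G] by (simp add: L_def star_total_leaves[OF T c])
  ultimately show ?thesis by (simp add: code_graphs_def Let_def)
qed

lemma small_gain_decomposition:
  "F_star n m r \<delta> \<gamma> P - F_large_gain
    \<subseteq> (\<Union>(X, V0, B, L)\<in>star_codes. (\<lambda>H. star_edges L \<union> H) ` code_graphs L V0 B)"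
proof
  fix G assume "G \<in> F_star n m r \<delta> \<gamma> P - F_large_gain"
  then have G: "G \<in> F_star n m r \<delta> \<gamma> P" "G \<notin> F_large_gain" by auto
  let ?T = "inner_edges G"
  have T: "?T \<subseteq> nsets {1..n} 2" using inner_edges_finite(2)[OF G(1)] inner_pairs_subset by blast
  then obtain c where c: "star_decomposition d ?T c"
    using ex_star_decomposition[OF inner_edges_finite(1)[OF G(1)], of d] by (auto simp: nsets_def)
  then have centre: "\<forall>e\<in>?T. c e \<in> e" by (simp add: star_decomposition_def)
  define L where "L = leaves ?T c"
  define X where "X = large_centres L"
  have L: "L \<in> sparse_maps" unfolding L_def by (rule leaves_in_sparse_maps[OF G c])
  have X: "X \<subseteq> {1..n}" by (auto simp: X_def large_centres_def)
  then obtain V0 where V0: "V0 \<in> P" "card X \<le> r * card (X \<inter> V0)" using ex_rich_part by blast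
  obtain B where B: "B \<in> PiE (X \<inter> V0) (\<lambda>_. boxes P d)"
    "\<forall>v\<in>X \<inter> V0. B v V0 \<subseteq> L v \<and> (\<forall>V\<in>P. B v V \<subseteq> {u\<in>V. {v, u} \<in> G})"
    using ex_leaf_boxes[OF G(1) V0(1)] unfolding X_def L_def by blast
  have "real (card X * d) \<le> real (star_total L)"
    using card_large_centres_le[of L] unfolding X_def by (simp only: of_nat_le_iff)
  then have "X \<in> centre_sets" using X L by (simp add: centre_sets_def sparse_maps_def)
  then have code: "(X, V0, B, L) \<in> star_codes"
    using V0 B L by (simp add: star_codes_def rich_parts_def code_maps_def X_def)
  have "G \<inter> E \<in> code_graphs L V0 B"
    unfolding L_def by (rule in_code_graphs[OF G(1) centre V0(1)]) (use B in \<open>auto simp: X_def L_def\<close>)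
  moreover have "G = star_edges L \<union> (G \<inter> E)"
    unfolding L_def star_edges_leaves[OF T centre] by (rule G_split(1)[OF G(1)])
  ultimately show "G \<in> (\<Union>(X, V0, B, L)\<in>star_codes. (\<lambda>H. star_edges L \<union> H) ` code_graphs L V0 B)"
    using code by (intro UN_I[of "(X, V0, B, L)"]) auto
qed

lemma finite_rich_parts: "finite (rich_parts X)"
  using finite_P by (simp add: rich_parts_def)

lemma finite_code_maps: "finite (code_maps X V0 B)"
  using finite_sparse_maps by (simp add: code_maps_def)

lemma finite_box_choices: "X \<subseteq> {1..n} \<Longrightarrow> finite (PiE (X \<inter> V0) (\<lambda>_. boxes P d))"
  using finite_boxes[OF finite_P] finite_part by (intro finite_PiE) (auto intro: finite_subset)

lemma finite_centre_sets: "finite centre_sets"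
  by (simp add: centre_sets_def)

definition code_bound :: "nat set \<Rightarrow> real" where
  "code_bound X = (if X = {} then (1 + S) ^ n - 1 else (1 + S) ^ n * exp (- u) ^ card X)"

lemma code_bound_nonneg: "0 \<le> code_bound X"
  using S_nonneg one_le_power[of "1 + S" n] by (simp add: code_bound_def)

lemma sum_code_maps_le:
  assumes X: "X \<subseteq> {1..n}" and V0: "V0 \<in> P" and B: "B \<in> PiE (X \<inter> V0) (\<lambda>_. boxes P d)"
  shows "(\<Sum>L\<in>code_maps X V0 B. map_weight L)
    \<le> (if X = {} then (1 + S) ^ n - 1 else (1 + S) ^ n * exp (z * real n) ^ card X * (z ^ d) ^ card (X \<inter> V0))"
proof (cases "X = {}")
  case True
  have "(\<Sum>L\<in>code_maps X V0 B. map_weight L)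
      \<le> (\<Sum>L\<in>{L\<in>star_maps. large_centres L = {} \<and> 0 < star_total L}. map_weight L)"
    using finite_star_maps map_weight_nonneg
    by (intro sum_mono2) (auto simp: code_maps_def sparse_maps_def True)
  then show ?thesis using sum_nonempty_map_weights_le True by simp
next
  case False
  have box: "B v V0 \<subseteq> {1..n} \<and> card (B v V0) = d" if "v \<in> X \<inter> V0" for v
    using boxD(1,3)[of "B v" P d V0] B that V0 part_subset[OF V0] by blast
  have "(\<Sum>L\<in>code_maps X V0 B. map_weight L)
      \<le> (\<Sum>L\<in>{L\<in>star_maps. large_centres L = X \<and> (\<forall>v\<in>X \<inter> V0. B v V0 \<subseteq> L v)}. map_weight L)"
    using finite_star_maps map_weight_nonneg by (intro sum_mono2) (auto simp: code_maps_def sparse_maps_def)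
  also have "\<dots> \<le> (1 + S) ^ n * exp (z * real n) ^ card X * (z ^ d) ^ card (X \<inter> V0)"
    by (rule sum_map_weights_le[OF X _ box]) auto
  finally show ?thesis using False by simp
qed

lemma sum_box_factors_le:
  assumes "finite Y" "real (card Y) * real d \<le> \<delta> * real m"
  shows "(\<Sum>B\<in>PiE Y (\<lambda>_. boxes P d). box_factor Y B) \<le> (box_sum_bound \<epsilon> * z ^ ((r - 1) * d)) ^ card Y"
proof -
  have "(\<Sum>B\<in>PiE Y (\<lambda>_. boxes P d). exp (- (\<epsilon> * box_gain Y B))) \<le> box_sum_bound \<epsilon> ^ card Y"
    using sum_greedy_families_le[of "sorted_list_of_set Y" \<epsilon>] room[OF assms(2)] assms(1) \<epsilon>(1)
    by (simp add: box_gain_def)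
  then have "z ^ (card Y * ((r - 1) * d)) * (\<Sum>B\<in>PiE Y (\<lambda>_. boxes P d). exp (- (\<epsilon> * box_gain Y B)))
      \<le> z ^ (card Y * ((r - 1) * d)) * box_sum_bound \<epsilon> ^ card Y"
    using z_pos by (intro mult_left_mono) auto
  then show ?thesis
    unfolding sum_distrib_left box_factor_def
    by (simp add: power_mult_distrib power_mult[symmetric] mult_ac)
qed

text \<open>The part \<open>V0\<close> holds an \<open>r\<close>-th of the large centres \<open>X\<close>, so the saving from its boxes pays for all of \<open>X\<close>.\<close>

lemma box_saving:
  assumes "card X \<le> r * y"
  shows "exp (z * real n) ^ card X * (box_sum_bound \<epsilon> * z ^ (r * d)) ^ y \<le> exp (- u) ^ card X"
proof -
  have "(box_sum_bound \<epsilon> * z ^ (r * d)) ^ y \<le> exp (- (real r * (z * real n + u))) ^ y"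
    using box_sum z_pos box_sum_bound_nonneg by (intro power_mono) auto
  also have "\<dots> = exp (- ((z * real n + u) * (real r * real y)))"
    by (simp add: exp_of_nat_mult[symmetric] mult_ac)
  also have "\<dots> \<le> exp (- ((z * real n + u) * real (card X)))"
  proof -
    have "real (card X) \<le> real r * real y" using assms by (metis of_nat_le_iff of_nat_mult)
    then show ?thesis using z_pos u_nonneg by (simp add: mult_left_mono)
  qed
  finally have "exp (z * real n) ^ card X * (box_sum_bound \<epsilon> * z ^ (r * d)) ^ y
      \<le> exp (z * real n) ^ card X * exp (- ((z * real n + u) * real (card X)))"
    by (intro mult_left_mono) auto
  also have "\<dots> = exp (- u) ^ card X"
    by (simp add: exp_of_nat_mult[symmetric] exp_add[symmetric] algebra_simps)
  finally show ?thesis .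
qed

lemma sum_part_codes_le:
  assumes X: "X \<in> centre_sets" and V0: "V0 \<in> rich_parts X"
  shows "(\<Sum>B\<in>PiE (X \<inter> V0) (\<lambda>_. boxes P d). \<Sum>L\<in>code_maps X V0 B. map_weight L * box_factor (X \<inter> V0) B)
      \<le> code_bound X"
proof -
  define Y where "Y = X \<inter> V0"
  let ?boxes = "PiE Y (\<lambda>_. boxes P d)" and ?q = "box_sum_bound \<epsilon> * z ^ ((r - 1) * d)"
  let ?w = "if X = {} then (1 + S) ^ n - 1 else (1 + S) ^ n * exp (z * real n) ^ card X * (z ^ d) ^ card Y"
  have Xn: "X \<subseteq> {1..n}" "finite X" using X finite_subset by (auto simp: centre_sets_def)
  then have Y: "finite Y" "card Y \<le> card X" by (auto simp: Y_def intro: card_mono)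
  have w: "0 \<le> ?w" using S_nonneg one_le_power[of "1 + S" n] z_pos by simp
  have "real (card Y) * real d \<le> real (card X) * real d" using Y(2) by (intro mult_right_mono) auto
  then have "real (card Y) * real d \<le> \<delta> * real m" using X by (simp add: centre_sets_def)
  then have factors: "(\<Sum>B\<in>?boxes. box_factor Y B) \<le> ?q ^ card Y" by (rule sum_box_factors_le[OF Y(1)])
  have "(\<Sum>B\<in>?boxes. \<Sum>L\<in>code_maps X V0 B. map_weight L * box_factor Y B)
      = (\<Sum>B\<in>?boxes. (\<Sum>L\<in>code_maps X V0 B. map_weight L) * box_factor Y B)"
    by (simp only: sum_distrib_right)
  also have "\<dots> \<le> (\<Sum>B\<in>?boxes. ?w * box_factor Y B)"
  proof (intro sum_mono mult_right_mono)
    fix B assume "B \<in> ?boxes"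
    moreover have "V0 \<in> P" using V0 by (simp add: rich_parts_def)
    ultimately show "(\<Sum>L\<in>code_maps X V0 B. map_weight L) \<le> ?w"
      using sum_code_maps_le[OF Xn(1)] unfolding Y_def by blast
    show "0 \<le> box_factor Y B" using z_pos by (simp add: box_factor_def)
  qed
  also have "\<dots> = ?w * (\<Sum>B\<in>?boxes. box_factor Y B)" by (rule sum_distrib_left[symmetric])
  also have "\<dots> \<le> ?w * ?q ^ card Y" by (rule mult_left_mono[OF factors w])
  also have "\<dots> \<le> code_bound X"
  proof (cases "X = {}")
    case True
    then show ?thesis by (simp add: code_bound_def Y_def)
  next
    case False
    have "r * d = (r - 1) * d + d" using r_ge_2 by (cases r) auto
    then have "(z ^ d) ^ card Y * ?q ^ card Y = (box_sum_bound \<epsilon> * z ^ (r * d)) ^ card Y"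
      by (simp add: power_mult_distrib power_add mult_ac)
    then have "?w * ?q ^ card Y = (1 + S) ^ n
        * (exp (z * real n) ^ card X * (box_sum_bound \<epsilon> * z ^ (r * d)) ^ card Y)"
      using False by (simp only: if_False mult.assoc)
    also have "\<dots> \<le> (1 + S) ^ n * exp (- u) ^ card X"
      using V0 S_nonneg by (intro mult_left_mono box_saving) (auto simp: rich_parts_def Y_def)
    finally show ?thesis using False by (simp add: code_bound_def)
  qed
  finally show ?thesis by (simp only: Y_def)
qed

lemma sum_code_bounds: "(\<Sum>X\<in>Pow {1..n}. code_bound X) = ((1 + S) * (1 + exp (- u))) ^ n - 1"
proof -
  have "(\<Sum>X\<in>Pow {1..n}. code_bound X)
      = (\<Sum>X\<in>Pow {1..n}. (1 + S) ^ n * exp (- u) ^ card X - (if X = {} then 1 else 0))"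
    by (intro sum.cong) (auto simp: code_bound_def)
  also have "\<dots> = (1 + S) ^ n * (1 + exp (- u)) ^ n - 1"
    by (simp add: sum_subtractf sum_distrib_left[symmetric] sum_power_card_Pow)
  finally show ?thesis by (simp add: power_mult_distrib)
qed

lemma sum_star_codes:
  "(\<Sum>(X, V0, B, L)\<in>star_codes. f X V0 B L)
    = (\<Sum>X\<in>centre_sets. \<Sum>V0\<in>rich_parts X. \<Sum>B\<in>PiE (X \<inter> V0) (\<lambda>_. boxes P d). \<Sum>L\<in>code_maps X V0 B. f X V0 B L)"
  unfolding star_codes_def using finite_centre_sets finite_rich_parts finite_code_maps finite_box_choices
  by (simp add: sum.Sigma centre_sets_def split_def finite_SigmaI)

lemma finite_star_codes: "finite star_codes"
  unfolding star_codes_def using finite_centre_sets finite_rich_parts finite_code_maps finite_box_choices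
  by (intro finite_SigmaI) (auto simp: centre_sets_def)

lemma card_small_gain_le:
  "\<eta> * real (card (F_star n m r \<delta> \<gamma> P - F_large_gain))
    \<le> real (e_part P choose m) * (real r * (((1 + S) * (1 + exp (- u))) ^ n - 1))"
proof -
  let ?C = "real (e_part P choose m)"
  have "real (card (F_star n m r \<delta> \<gamma> P - F_large_gain))
      \<le> (\<Sum>i\<in>star_codes. real (card (case i of (X, V0, B, L) \<Rightarrow> code_graphs L V0 B)))"
    using small_gain_decomposition finite_E
    by (intro card_le_sum_fibres[OF finite_star_codes, where f = "\<lambda>(X, V0, B, L) H. star_edges L \<union> H"])
      (auto simp: split_def code_graphs_def Let_def)
  then have "\<eta> * real (card (F_star n m r \<delta> \<gamma> P - F_large_gain))
      \<le> \<eta> * (\<Sum>i\<in>star_codes. real (card (case i of (X, V0, B, L) \<Rightarrow> code_graphs L V0 B)))"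
    using \<eta>(1) by (intro mult_left_mono) auto
  also have "\<dots> \<le> (\<Sum>(X, V0, B, L)\<in>star_codes. ?C * (map_weight L * box_factor (X \<inter> V0) B))"
    unfolding sum_distrib_left using card_code_graphs_le
    by (intro sum_mono) (auto simp: star_codes_def code_maps_def rich_parts_def)
  also have "\<dots> = ?C * (\<Sum>X\<in>centre_sets. \<Sum>V0\<in>rich_parts X. \<Sum>B\<in>PiE (X \<inter> V0) (\<lambda>_. boxes P d).
      \<Sum>L\<in>code_maps X V0 B. map_weight L * box_factor (X \<inter> V0) B)"
    unfolding sum_star_codes by (simp only: sum_distrib_left)
  also have "\<dots> \<le> ?C * (\<Sum>X\<in>centre_sets. real r * code_bound X)"
  proof (intro mult_left_mono sum_mono)
    fix X assume X: "X \<in> centre_sets"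
    have "(\<Sum>V0\<in>rich_parts X. \<Sum>B\<in>PiE (X \<inter> V0) (\<lambda>_. boxes P d). \<Sum>L\<in>code_maps X V0 B. map_weight L
        * box_factor (X \<inter> V0) B)
        \<le> (\<Sum>V0\<in>rich_parts X. code_bound X)"
      by (intro sum_mono sum_part_codes_le[OF X])
    also have "\<dots> \<le> real r * code_bound X"
      using card_mono[OF finite_P, of "rich_parts X"] card_P code_bound_nonneg
      by (auto simp: rich_parts_def intro!: mult_right_mono)
    finally show "(\<Sum>V0\<in>rich_parts X. \<Sum>B\<in>PiE (X \<inter> V0) (\<lambda>_. boxes P d). \<Sum>L\<in>code_maps X V0 B. map_weight L
        * box_factor (X \<inter> V0) B)
        \<le> real r * code_bound X" .
  qed simp
  also have "\<dots> \<le> ?C * (\<Sum>X\<in>Pow {1..n}. real r * code_bound X)"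
    using code_bound_nonneg by (intro mult_left_mono sum_mono2) (auto simp: centre_sets_def)
  finally show ?thesis by (simp only: sum_distrib_left[symmetric] sum_code_bounds)
qed

theorem sparse_bound:
  assumes "0 < \<theta>" "\<theta> \<le> 1"
  shows "\<eta> * real (card (F_star n m r \<delta> \<gamma> P)) \<le> real (e_part P choose m) *
    (exp (- ((1 - \<epsilon>) * gain_cap) + (\<delta> * real m * ln (1 / \<theta>) + \<theta> * z * real n ^ 2))
      + real r * (((1 + S) * (1 + exp (- u))) ^ n - 1))"
proof -
  let ?F = "F_star n m r \<delta> \<gamma> P"
  have "?F = F_large_gain \<union> (?F - F_large_gain)" by (auto simp: F_large_gain_def)
  then have "card ?F \<le> card F_large_gain + card (?F - F_large_gain)" by (metis card_Un_le)
  then have "real (card ?F) \<le> real (card F_large_gain) + real (card (?F - F_large_gain))" by linarith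
  then have "\<eta> * real (card ?F) \<le> \<eta> * real (card F_large_gain) + \<eta> * real (card (?F - F_large_gain))"
    using \<eta>(1) by (simp add: distrib_left[symmetric])
  then show ?thesis using card_F_large_gain_le[OF assms] card_small_gain_le by (simp only: distrib_left)
qed

end

section \<open>The threshold density\<close>

lemma two_real_choose_two: "2 * real (j choose 2) = real j * (real j - 1)"
proof -
  have "even (j * (j - 1))" by (cases j) simp_all
  then have "2 * (j choose 2) = j * (j - 1)" unfolding choose_two by (rule dvd_mult_div_cancel)
  then have "real (2 * (j choose 2)) = real (j * (j - 1))" by (simp only:)
  then show ?thesis by (cases j) (auto simp: algebra_simps)
qed

definition threshold_exponent :: "nat \<Rightarrow> real" where
  "threshold_exponent r = (2 * real r + 2) / (real r + 2)"

lemma two_clique_minus_edge: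
  assumes "1 \<le> r"
  shows "2 * real ((Suc r choose 2) - 1) = (real r - 1) * (real r + 2)"
proof -
  have "1 \<le> (Suc r choose 2)" using assms by (simp add: Suc_leI)
  then have "real ((Suc r choose 2) - 1) = real (Suc r choose 2) - 1" by (simp add: of_nat_diff)
  then show ?thesis using two_real_choose_two[of "Suc r"] by (simp add: algebra_simps)
qed

text \<open>The number \<open>m_r r n\<close> is the value of \<open>p (r - 1) n\<^sup>2 / (2 r)\<close> at the density \<open>p\<close> for which
  \<open>(n / r) ^ (r - 1) p ^ ((Suc r choose 2) - 1)\<close>, the expected number of completions of an inner
  pair, equals \<open>threshold_exponent r * ln n\<close>.\<close>

lemma cliques_per_pair_threshold:
  assumes r: "2 \<le> r" and n: "2 \<le> n"
  shows "cliques_per_pair (real n) (m_r r n / ((real r - 1) / (2 * real r) * real n ^ 2)) (Suc r)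
    = real r ^ (r - 1) * threshold_exponent r * ln (real n)"
proof -
  define k where "k = (Suc r choose 2) - 1"
  define x where "x = real r * threshold_exponent r powr (1 / (real r - 1))"
  let ?a = "2 / (real r + 2)" and ?t = "(real r - 1) / (2 * real r)"
  have pos: "0 < real r - 1" "0 < threshold_exponent r" "0 < x" "1 < real n" "0 < ln (real n)"
    using r n by (auto simp: threshold_exponent_def x_def)
  have k2: "2 * real k = (real r - 1) * (real r + 2)" using two_clique_minus_edge[of r] r by (simp add: k_def)
  then have ak: "?a * real k = real r - 1" by (simp add: field_simps)
  have k: "0 < k" using k2 pos(1) by (intro gr0I) auto
  have k': "real ((r + 1) choose 2) - 1 = real k"
    using two_real_choose_two[of "r + 1"] k2 by (simp add: algebra_simps)
  have "m_r r n = ?t * (x powr ?a * real n powr (2 - ?a) * ln (real n) powr (1 / real k))"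
    unfolding m_r_def theta_def k' x_def threshold_exponent_def by simp
  also have "real n powr (2 - ?a) = real n ^ 2 * real n powr (- ?a)"
    using pos by (simp add: powr_diff powr_minus divide_inverse powr_numeral)
  finally have "m_r r n / (?t * real n ^ 2) = x powr ?a * real n powr (- ?a) * ln (real n) powr (1 / real k)"
    using pos by simp
  also have "\<dots> ^ k = (x powr ?a) ^ k * (real n powr (- ?a)) ^ k * (ln (real n) powr (1 / real k)) ^ k"
    by (simp only: power_mult_distrib)
  also have "(x powr ?a) ^ k = real r ^ (r - 1) * threshold_exponent r"
  proof -
    have "(x powr ?a) ^ k = x powr (real r - 1)" using pos ak by (simp add: powr_realpow[symmetric] powr_powr)
    also have "\<dots> = real r powr (real r - 1) * threshold_exponent r"
      using pos by (simp add: x_def powr_mult powr_powr)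
    also have "real r powr (real r - 1) = real r ^ (r - 1)"
      using r by (simp add: powr_realpow[symmetric] of_nat_diff)
    finally show ?thesis .
  qed
  also have "(real n powr (- ?a)) ^ k = 1 / real n ^ (r - 1)"
  proof -
    have "(real n powr (- ?a)) ^ k = real n powr (- (?a * real k))"
      using pos by (simp add: powr_realpow[symmetric] powr_powr)
    also have "\<dots> = 1 / real n powr real (r - 1)"
      unfolding ak powr_minus_divide using r by (simp add: of_nat_diff)
    also have "real n powr real (r - 1) = real n ^ (r - 1)" using pos by (simp only: powr_realpow)
    finally show ?thesis .
  qed
  also have "(ln (real n) powr (1 / real k)) ^ k = ln (real n)"
    using pos k by (simp add: powr_realpow[symmetric] powr_powr)
  finally show ?thesis using pos r by (simp add: cliques_per_pair_def k_def)
qed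

lemma (in vertex_partition) e_part_le: "real (e_part P) \<le> (real r - 1) / (2 * real r) * real n ^ 2"
proof -
  have r: "0 < real r" using r_ge_2 by simp
  have card_n: "(\<Sum>V\<in>P. real (card V)) = real n"
    using card_Union_disjoint[of P] disjoint_P finite_part
    by (simp add: Union_P disjoint_def pairwise_def disjnt_def flip: of_nat_sum)
  have "card inner_pairs = (\<Sum>V\<in>P. card (nsets V 2))"
    unfolding inner_pairs_def
  proof (rule card_UN_disjoint[OF finite_P])
    show "\<forall>V\<in>P. \<forall>W\<in>P. V \<noteq> W \<longrightarrow> nsets V 2 \<inter> nsets W 2 = {}"
      using same_part by (fastforce simp: nsets_def card_2_iff)
  qed (use finite_part in \<open>simp add: finite_imp_finite_nsets\<close>)
  moreover have "card (nsets {1..n} 2) = card inner_pairs + card E"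
    using pairs_split finite_E inner_pairs_subset
    by (metis card_Un_disjoint finite_Un finite_atLeastAtMost finite_imp_finite_nsets)
  ultimately have "(\<Sum>V\<in>P. card V choose 2) + e_part P = n choose 2" by (simp add: e_part_def)
  then have "(\<Sum>V\<in>P. real (card V choose 2)) + real (e_part P) = real (n choose 2)"
    by (simp only: of_nat_sum[symmetric] of_nat_add[symmetric])
  then have "(\<Sum>V\<in>P. 2 * real (card V choose 2)) + 2 * real (e_part P) = 2 * real (n choose 2)"
    by (simp add: sum_distrib_left[symmetric])
  then have "(\<Sum>V\<in>P. real (card V) ^ 2 - real (card V)) + 2 * real (e_part P) = real n ^ 2 - real n"
    by (simp add: two_real_choose_two right_diff_distrib power2_eq_square)
  then have e: "(\<Sum>V\<in>P. real (card V) ^ 2) + 2 * real (e_part P) = real n ^ 2"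
    by (simp add: sum_subtractf card_n)
  have "real n ^ 2 \<le> (\<Sum>V\<in>P. real (card V) ^ 2) * real r"
    using sum_squared_le_sum_of_squares[of "\<lambda>V. real (card V)" P] by (simp add: card_n card_P)
  then have "real n ^ 2 / real r \<le> (\<Sum>V\<in>P. real (card V) ^ 2)" using r by (simp add: pos_divide_le_eq)
  then have "2 * real (e_part P) \<le> real n ^ 2 - real n ^ 2 / real r" using e by linarith
  also have "\<dots> = 2 * ((real r - 1) / (2 * real r) * real n ^ 2)" using r by (simp add: field_simps)
  finally show ?thesis by linarith
qed

lemma cliques_per_pair_scale_density:
  assumes "0 \<le> n"
  shows "cliques_per_pair n (c * p) j = c ^ ((j choose 2) - 1) * cliques_per_pair n p j"
  by (simp add: cliques_per_pair_def power_mult_distrib)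

lemma cliques_per_pair_mono:
  assumes "0 \<le> n" "n \<le> n'" "0 \<le> p" "p \<le> p'"
  shows "cliques_per_pair n p j \<le> cliques_per_pair n' p' j"
  unfolding cliques_per_pair_def using assms by (intro mult_mono power_mono) auto

lemma cliques_per_pair_above_threshold:
  assumes r: "2 \<le> r" and n: "2 \<le> n" and e: "0 < e" "e \<le> (real r - 1) / (2 * real r) * real n ^ 2"
    and q: "0 < q" and \<kappa>: "0 < \<kappa>" and m: "(1 + \<kappa>) * m_r r n \<le> real m"
  shows "(q * (1 + \<kappa>)) ^ ((Suc r choose 2) - 1) * (real r ^ (r - 1) * threshold_exponent r * ln (real n))
    \<le> cliques_per_pair (real n) (q * real m / e) (Suc r)"
proof -
  let ?T = "(real r - 1) / (2 * real r) * real n ^ 2"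
  have T: "0 < ?T" using r n by simp
  have nonneg: "0 \<le> m_r r n" using r n by (simp add: m_r_def theta_def)
  have "q * (1 + \<kappa>) * (m_r r n / ?T) = q * ((1 + \<kappa>) * m_r r n) / ?T" by simp
  also have "\<dots> \<le> q * real m / e" using m q e T by (intro frac_le mult_left_mono) auto
  finally have "cliques_per_pair (real n) (q * (1 + \<kappa>) * (m_r r n / ?T)) (Suc r)
      \<le> cliques_per_pair (real n) (q * real m / e) (Suc r)"
    using q \<kappa> nonneg T by (intro cliques_per_pair_mono mult_nonneg_nonneg divide_nonneg_pos) auto
  then show ?thesis
    unfolding cliques_per_pair_scale_density[OF of_nat_0_le_iff] cliques_per_pair_threshold[OF r n] .
qed

lemma cliques_per_pair_square:
  assumes "2 \<le> j"
  shows "(cliques_per_pair n p j)\<^sup>2 = (n\<^sup>2 * p ^ (j + 1)) ^ (j - 2)"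
proof -
  obtain i where j: "j = i + 2" using assms by (metis add.commute le_Suc_ex)
  have "real (2 * (j choose 2)) = real ((i + 2) * (i + 1))"
    using two_real_choose_two[of j] j by (simp add: algebra_simps)
  then have "2 * (j choose 2) = (i + 2) * (i + 1)" by (simp only: of_nat_eq_iff)
  then have e: "((j choose 2) - 1) * 2 = (i + 3) * i" by (simp add: algebra_simps)
  have "(cliques_per_pair n p j)\<^sup>2 = n ^ (i * 2) * p ^ (((j choose 2) - 1) * 2)"
    by (simp add: cliques_per_pair_def j power_mult_distrib power_mult)
  also have "\<dots> = (n\<^sup>2) ^ i * (p ^ (i + 3)) ^ i"
    unfolding e by (simp only: power_mult[symmetric] mult.commute[of i 2])
  also have "\<dots> = (n\<^sup>2 * p ^ (i + 3)) ^ i" by (simp only: power_mult_distrib)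
  finally show ?thesis using j by (simp add: numeral_eq_Suc)
qed

lemma powr_root_le:
  fixes x y :: real
  assumes "0 \<le> x" "0 < y" "x \<le> y ^ k" "0 < k"
  shows "x powr (1 / real k) \<le> y"
proof -
  have "x powr (1 / real k) \<le> (y ^ k) powr (1 / real k)" using assms by (intro powr_mono2) auto
  also have "\<dots> = y" using assms by (simp add: powr_realpow[symmetric] powr_powr)
  finally show ?thesis .
qed

context
  fixes n p L :: real and r :: nat
  assumes n: "1 \<le> n" and p: "0 < p" "p \<le> 1" and L: "1 \<le> L" "L\<^sup>2 \<le> n\<^sup>2 * p ^ (r + 2)" and r: "1 \<le> r"
begin

lemma square_density_mono: "a \<le> b \<Longrightarrow> n\<^sup>2 * p ^ b \<le> n\<^sup>2 * p ^ a"
  using p n by (intro mult_left_mono power_decreasing) auto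

lemma square_density_ge_1: "j \<le> r + 2 \<Longrightarrow> 1 \<le> n\<^sup>2 * p ^ j"
  using square_density_mono[of j "r + 2"] L one_le_power[OF L(1), of 2] by linarith

lemma cliques_per_pair_ge_1:
  assumes "2 \<le> j" "j \<le> r"
  shows "1 \<le> cliques_per_pair n p j"
proof (rule power2_le_imp_le)
  show "1\<^sup>2 \<le> (cliques_per_pair n p j)\<^sup>2"
    unfolding cliques_per_pair_square[OF assms(1)] one_power2
    using assms by (intro one_le_power square_density_ge_1) auto
qed (use n p in \<open>simp add: cliques_per_pair_def\<close>)

lemma cliques_per_pair_Suc_ge:
  assumes "2 \<le> j" "j \<le> r"
  shows "L \<le> cliques_per_pair n p (Suc j)"
proof (rule power2_le_imp_le)
  have "L\<^sup>2 \<le> n\<^sup>2 * p ^ (Suc j + 1)"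
    using L(2) square_density_mono[of "Suc j + 1" "r + 2"] assms by linarith
  also have "\<dots> \<le> (n\<^sup>2 * p ^ (Suc j + 1)) ^ (Suc j - 2)"
    using square_density_ge_1[of "Suc j + 1"] assms by (intro self_le_power) auto
  also have "\<dots> = (cliques_per_pair n p (Suc j))\<^sup>2"
    using assms by (intro cliques_per_pair_square[symmetric]) auto
  finally show "L\<^sup>2 \<le> (cliques_per_pair n p (Suc j))\<^sup>2" .
qed (use n p in \<open>simp add: cliques_per_pair_def\<close>)

lemma root_le_mean_degree: "n powr (1 / real (r + 2)) \<le> p * n"
proof (rule powr_root_le)
  have "n \<le> n ^ r" using n r by (intro self_le_power) auto
  also have "\<dots> \<le> n ^ r * (n\<^sup>2 * p ^ (r + 2))"
    using mult_left_mono[OF square_density_ge_1[of "r + 2"], of "n ^ r"] n by simp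
  also have "\<dots> = (p * n) ^ (r + 2)" by (simp add: power_add power_mult_distrib power2_eq_square)
  finally show "n \<le> (p * n) ^ (r + 2)" .
qed (use n p in auto)

lemma root_le_cliques_per_pair:
  assumes "3 \<le> j" "j \<le> r"
  shows "n powr (1 / real (r + 2)) \<le> cliques_per_pair n p j"
proof (rule power2_le_imp_le)
  let ?Y = "n\<^sup>2 * p ^ (r + 2)"
  have "(n powr (1 / real (r + 2)))\<^sup>2 = (n\<^sup>2) powr (1 / real (r + 2))"
    unfolding power2_eq_square using n by (simp add: powr_mult)
  also have "\<dots> \<le> n\<^sup>2 * p ^ (r + 1)"
  proof (rule powr_root_le)
    have "n\<^sup>2 \<le> n\<^sup>2 * ?Y ^ (r + 1)"
      using mult_left_mono[OF one_le_power[OF square_density_ge_1[of "r + 2"], of "r + 1"], of "n\<^sup>2"] by simp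
    also have "\<dots> = (n\<^sup>2 * p ^ (r + 1)) ^ (r + 2)"
    proof -
      have "(p ^ (r + 2)) ^ (r + 1) = (p ^ (r + 1)) ^ (r + 2)"
        by (simp only: power_mult[symmetric] mult.commute)
      moreover have "(n\<^sup>2) ^ (r + 2) = n\<^sup>2 * (n\<^sup>2) ^ (r + 1)" by simp
      ultimately show ?thesis by (simp only: power_mult_distrib mult.assoc)
    qed
    finally show "n\<^sup>2 \<le> (n\<^sup>2 * p ^ (r + 1)) ^ (r + 2)" .
  qed (use n p in auto)
  also have "\<dots> \<le> n\<^sup>2 * p ^ (j + 1)" using square_density_mono[of "j + 1" "r + 1"] assms by simp
  also have "\<dots> \<le> (n\<^sup>2 * p ^ (j + 1)) ^ (j - 2)"
    using square_density_ge_1[of "j + 1"] assms by (intro self_le_power) auto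
  also have "\<dots> = (cliques_per_pair n p j)\<^sup>2" using assms by (intro cliques_per_pair_square[symmetric]) auto
  finally show "(n powr (1 / real (r + 2)))\<^sup>2 \<le> (cliques_per_pair n p j)\<^sup>2" .
qed (use n p in \<open>simp add: cliques_per_pair_def\<close>)

end

section \<open>Elementary estimates\<close>

lemma real_nat_floor_ge_half:
  fixes x :: real
  assumes "1 \<le> x"
  shows "x / 2 \<le> real (nat \<lfloor>x\<rfloor>)"
proof -
  have f: "1 \<le> \<lfloor>x\<rfloor>" using assms by (simp add: le_floor_iff)
  have "real (nat \<lfloor>x\<rfloor>) = real_of_int \<lfloor>x\<rfloor>" using f by simp
  then show ?thesis using f real_of_int_floor_gt_diff_one[of x] by linarith
qed

lemma real_nat_ceiling_le_double: "1 \<le> (x :: real) \<Longrightarrow> real (nat \<lceil>x\<rceil>) \<le> 2 * x"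
  by linarith

lemma power_div_fact_le_exp:
  fixes x :: real
  assumes "0 \<le> x"
  shows "x ^ k / fact k \<le> exp x"
proof -
  have s: "(\<lambda>n. x ^ n / fact n) sums exp x" using exp_converges[of x] by (simp add: field_simps)
  have "(\<Sum>n\<in>{k}. x ^ n / fact n) \<le> (\<Sum>n. x ^ n / fact n)"
    using sums_summable[OF s] assms by (intro sum_le_suminf) auto
  then show ?thesis using sums_unique[OF s] by simp
qed

lemma one_plus_power_minus_one_le:
  fixes x :: real
  assumes "0 \<le> x" "real n * x \<le> 1"
  shows "(1 + x) ^ n - 1 \<le> 2 * (real n * x)"
proof -
  have "(1 + x) ^ n \<le> exp x ^ n" using assms by (intro power_mono exp_ge_add_one_self) auto
  also have "\<dots> = exp (real n * x)" by (simp add: exp_of_nat_mult)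
  also have "\<dots> \<le> 1 + real n * x + (real n * x)\<^sup>2" using assms by (intro exp_bound) auto
  also have "(real n * x)\<^sup>2 \<le> real n * x" using assms by (simp add: power2_eq_square mult_left_le)
  finally show ?thesis by linarith
qed

lemma sum_subsets_by_card:
  fixes f :: "nat \<Rightarrow> real"
  assumes "finite A"
  shows "(\<Sum>B\<in>{B\<in>Pow A. card B \<le> d}. f (card B)) = (\<Sum>a\<le>d. real (card A choose a) * f a)"
proof -
  have "(\<Sum>B\<in>{B\<in>Pow A. card B \<le> d}. f (card B))
      = (\<Sum>a\<le>d. \<Sum>B\<in>{B\<in>{B\<in>Pow A. card B \<le> d}. card B = a}. f (card B))"
    using assms by (intro sum.group[symmetric]) auto
  also have "\<dots> = (\<Sum>a\<le>d. real (card A choose a) * f a)"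
  proof (intro sum.cong refl)
    fix a assume "a \<in> {..d}"
    then have "{B\<in>{B\<in>Pow A. card B \<le> d}. card B = a} = {B. B \<subseteq> A \<and> card B = a}" by auto
    then have "(\<Sum>B\<in>{B\<in>{B\<in>Pow A. card B \<le> d}. card B = a}. f (card B)) = (\<Sum>B\<in>{B. B \<subseteq> A \<and> card B = a}. f a)"
      by (simp add: sum.cong)
    then show "(\<Sum>B\<in>{B\<in>{B\<in>Pow A. card B \<le> d}. card B = a}. f (card B)) = real (card A choose a) * f a"
      using assms by (simp add: n_subsets)
  qed
  finally show ?thesis .
qed

context
  fixes n d :: nat and p C s M :: real
  assumes n: "1 \<le> n" and p: "0 < p" and C: "0 < C" and s: "3 / 4 \<le> s" and d: "d \<le> n"
    and log_le: "\<And>a. 1 \<le> a \<Longrightarrow> a \<le> d \<Longrightarrow>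
      ln (C * exp 1 * (p * real n / real a)) \<le> sqrt (p * real n / real a) / 4"
    and small: "C * p * real n * exp (- (s * M)) \<le> 1 / 2"
begin

lemma choose_mult_power_le:
  assumes "1 \<le> a"
  shows "real (n choose a) * (C * p) ^ a \<le> exp (real a * ln (C * exp 1 * (p * real n / real a)))"
proof -
  let ?x = "p * real n / real a"
  have a: "0 < real a" using assms by simp
  have x: "0 < ?x" using p n a by simp
  have "real (n choose a) * (C * p) ^ a \<le> (real n ^ a / fact a) * (C * p) ^ a"
    using binomial_le_power_div_fact[of n a] C p by (intro mult_right_mono) auto
  also have "\<dots> = (C * ?x) ^ a * (real a ^ a / fact a)"
    using a by (simp add: power_mult_distrib power_divide)
  also have "\<dots> \<le> (C * ?x) ^ a * exp 1 ^ a"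
  proof (rule mult_left_mono)
    show "real a ^ a / fact a \<le> exp 1 ^ a"
      using power_div_fact_le_exp[of "real a" a] by (simp add: exp_of_nat_mult[symmetric])
    show "0 \<le> (C * ?x) ^ a" using C x by (intro zero_le_power mult_nonneg_nonneg) linarith+
  qed
  also have "\<dots> = (C * exp 1 * ?x) ^ a" by (simp only: power_mult_distrib mult_ac)
  also have "\<dots> = exp (real a * ln (C * exp 1 * ?x))"
    using mult_pos_pos[OF mult_pos_pos[OF C exp_gt_zero] x] by (simp only: exp_of_nat_mult exp_ln)
  finally show ?thesis .
qed

lemma star_term_le_geometric:
  assumes a: "1 \<le> a" "a \<le> d" and M: "M \<le> sqrt (p * real n / real a)"
  shows "real (n choose a) * ((C * p) ^ a * exp (- (s * (real a * min M (sqrt (p * real n / real a))))))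
    \<le> C * p * real n * exp (- (s * M)) * (1 / 2) ^ (a - 1)"
proof -
  let ?\<zeta> = "C * p * real n * exp (- (s * M))"
  have \<zeta>: "0 \<le> ?\<zeta>" using C p by simp
  have "real (n choose a) \<le> real n ^ a"
    using binomial_le_pow[of a n] a d by (simp flip: of_nat_power)
  then have "real (n choose a) * ((C * p) ^ a * exp (- (s * (real a * M))))
      \<le> real n ^ a * ((C * p) ^ a * exp (- (s * (real a * M))))"
    using C p by (intro mult_right_mono) auto
  also have "\<dots> = ?\<zeta> * ?\<zeta> ^ (a - 1)"
    using a by (cases a) (simp_all add: power_mult_distrib exp_of_nat_mult[symmetric] exp_add[symmetric] algebra_simps)
  also have "\<dots> \<le> ?\<zeta> * (1 / 2) ^ (a - 1)" using small \<zeta> by (intro mult_left_mono power_mono) auto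
  finally show ?thesis using M by (simp add: min_absorb1)
qed

lemma star_term_le_exp:
  assumes a: "1 \<le> a" "a \<le> d" and M: "sqrt (p * real n / real a) \<le> M"
  shows "real (n choose a) * ((C * p) ^ a * exp (- (s * (real a * min M (sqrt (p * real n / real a))))))
    \<le> exp (- (1 / 2 * sqrt (p * real n)))"
proof -
  define x where "x = p * real n / real a"
  have a0: "0 < real a" and x: "0 < x" using a p n by (auto simp: x_def)
  have "real (n choose a) * ((C * p) ^ a * exp (- (s * (real a * sqrt x))))
      \<le> exp (real a * ln (C * exp 1 * x)) * exp (- (s * (real a * sqrt x)))"
    using choose_mult_power_le[OF a(1)] unfolding x_def mult.assoc[symmetric] by (intro mult_right_mono) auto
  also have "\<dots> = exp (real a * (ln (C * exp 1 * x) - s * sqrt x))"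
    by (simp add: exp_add[symmetric] algebra_simps)
  also have "\<dots> \<le> exp (real a * (- (1 / 2 * sqrt x)))"
  proof -
    have "3 / 4 * sqrt x \<le> s * sqrt x" using s x by (intro mult_right_mono) auto
    then have "ln (C * exp 1 * x) - s * sqrt x \<le> - (1 / 2 * sqrt x)" using log_le[OF a] by (simp add: x_def)
    then show ?thesis unfolding exp_le_cancel_iff using a0 by (intro mult_left_mono) auto
  qed
  also have "\<dots> \<le> exp (- (1 / 2 * sqrt (p * real n)))"
  proof -
    have "1 * sqrt (p * real n) \<le> sqrt (real a) * sqrt (p * real n)" using a p by (intro mult_right_mono) auto
    also have "\<dots> = real a * sqrt x" unfolding x_def real_sqrt_divide
      using a0 by (simp add: real_div_sqrt field_simps)
    finally show ?thesis by simp
  qed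
  finally show ?thesis using M by (simp add: x_def min_absorb2)
qed

lemma star_sum_le:
  "(\<Sum>A\<in>{A\<in>Pow {1..n}. card A \<le> d}. (C * p) ^ card A
      * exp (- (s * (real (card A) * min M (sqrt (p * real n / real (card A)))))))
    \<le> 1 + (2 * (C * p * real n * exp (- (s * M))) + real n * exp (- (1 / 2 * sqrt (p * real n))))"
proof -
  let ?\<zeta> = "C * p * real n * exp (- (s * M))" and ?e = "exp (- (1 / 2 * sqrt (p * real n)))"
  let ?f = "\<lambda>a. (C * p) ^ a * exp (- (s * (real a * min M (sqrt (p * real n / real a)))))"
  have \<zeta>: "0 \<le> ?\<zeta>" using C p by simp
  have "real (n choose a) * ?f a \<le> ?\<zeta> * (1 / 2) ^ (a - 1) + ?e" if "a \<in> {1..d}" for a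
    using star_term_le_geometric[of a] star_term_le_exp[of a] that \<zeta>
    by (cases "M \<le> sqrt (p * real n / real a)") (auto intro: add_increasing add_increasing2)
  then have "(\<Sum>a\<in>{1..d}. real (n choose a) * ?f a) \<le> (\<Sum>a\<in>{1..d}. ?\<zeta> * (1 / 2) ^ (a - 1) + ?e)"
    by (rule sum_mono)
  also have "\<dots> = ?\<zeta> * (\<Sum>a\<in>{1..d}. (1 / 2) ^ (a - 1)) + real d * ?e"
    by (simp add: sum.distrib sum_distrib_left)
  also have "\<dots> \<le> ?\<zeta> * 2 + real n * ?e"
  proof (intro add_mono mult_left_mono mult_right_mono \<zeta>)
    have "(\<Sum>a\<in>{1..d}. (1 / 2 :: real) ^ (a - 1)) = 2 - 2 * (1 / 2) ^ d" by (induction d) auto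
    then show "(\<Sum>a\<in>{1..d}. (1 / 2 :: real) ^ (a - 1)) \<le> 2" by simp
  qed (use d in auto)
  finally have "(\<Sum>a\<in>{1..d}. real (n choose a) * ?f a) \<le> 2 * ?\<zeta> + real n * ?e" by simp
  moreover have "{..d} = insert 0 {1..d}" by auto
  ultimately show ?thesis using sum_subsets_by_card[of "{1..n}" ?f d] by simp
qed

end

lemma ex_small_loss:
  fixes \<kappa> :: real
  assumes r: "2 \<le> r" and \<kappa>: "0 < \<kappa>" and k: "1 \<le> k"
  shows "\<exists>\<eta>. 0 < \<eta> \<and> \<eta> \<le> 1 / (2 * real r) \<and> 1 + \<kappa> / 2 \<le> (1 - real r * \<eta>) ^ (r - 1) * ((1 - \<eta>)\<^sup>2 * (1 + \<kappa>)) ^ k"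
proof -
  let ?f = "\<lambda>\<eta>. (1 - real r * \<eta>) ^ (r - 1) * ((1 - \<eta>)\<^sup>2 * (1 + \<kappa>)) ^ k"
  have "(?f \<longlongrightarrow> ?f 0) (at_right 0)" by (intro tendsto_intros)
  moreover have "1 + \<kappa> \<le> (1 + \<kappa>) ^ k" using \<kappa> k by (intro self_le_power) auto
  then have "1 + \<kappa> / 2 < ?f 0" using \<kappa> by simp
  ultimately have "eventually (\<lambda>\<eta>. 1 + \<kappa> / 2 < ?f \<eta>) (at_right 0)" by (rule order_tendstoD(1))
  moreover have "eventually (\<lambda>\<eta>. \<eta> \<in> {0<..<1 / (2 * real r)}) (at_right (0 :: real))"
    using r by (intro eventually_at_right_real) auto
  ultimately have "eventually (\<lambda>\<eta>. 0 < \<eta> \<and> \<eta> \<le> 1 / (2 * real r) \<and> 1 + \<kappa> / 2 \<le> ?f \<eta>) (at_right 0)"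
    by eventually_elim auto
  then show ?thesis using eventually_happens by force
qed

section \<open>Choice of the parameters\<close>

locale sparse_constants =
  fixes r :: nat and \<kappa> \<eta> :: real
  assumes two_le_r: "2 \<le> r" and \<kappa>_pos: "0 < \<kappa>" and \<eta>_pos: "0 < \<eta>" and \<eta>_le: "\<eta> \<le> 1 / (2 * real r)"
    and loss: "1 + \<kappa> / 2 \<le> (1 - real r * \<eta>) ^ (r - 1) * ((1 - \<eta>)\<^sup>2 * (1 + \<kappa>)) ^ ((Suc r choose 2) - 1)"
begin

text \<open>Graphs are compared with a random set of crossing pairs of density \<open>p = thinning * m / e\<close>, and
  \<open>odds_factor * p\<close> bounds \<open>m / (e - m)\<close>.  A star is small if it has at most \<open>d = \<beta> * p * n\<close> leaves;
  \<open>\<beta>\<close> is limited by the correlations (\<open>\<tau>\<close>) and by the number of leaf sets (\<open>log_cutoff\<close>).  The greedy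
  family gets \<open>box_mean * p * n\<close> expected cliques from each box, enough for a factor
  \<open>exp (- decay * p * n)\<close>, as long as \<open>\<delta> < \<delta>_max\<close> leaves room for all large centres.\<close>

definition thinning :: real where
  "thinning = (1 - \<eta>)\<^sup>2"

definition \<epsilon> :: real where
  "\<epsilon> = min (1 / 8) (\<kappa> / (8 + 4 * \<kappa>))"

definition s :: real where
  "s = (1 - \<epsilon>)\<^sup>2"

definition odds_factor :: real where
  "odds_factor = 1 / (dense_gap r * thinning)"

definition \<tau> :: real where
  "\<tau> = \<epsilon> / (2 ^ r * ((real r + 2) * (2 * real r) ^ r))"

definition log_cutoff :: real where
  "log_cutoff = (SOME x. 1 \<le> x \<and> (\<forall>y\<ge>x. ln (odds_factor * exp 1 * y) \<le> sqrt y / 4))"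

definition \<beta> :: real where
  "\<beta> = min (\<tau>\<^sup>2 / 4) (1 / log_cutoff)"

definition decay :: real where
  "decay = 2 * real r * odds_factor + real r"

definition box_mean :: real where
  "box_mean = 2 * (decay + 1) / \<epsilon>"

definition \<rho> :: real where
  "\<rho> = exp (- (2 * (decay + 1) / \<beta>))"

definition \<sigma> :: real where
  "\<sigma> = (SOME \<sigma>. 0 < \<sigma> \<and> (\<forall>(I :: nat set set) n. finite I \<longrightarrow> card I = r \<longrightarrow> disjoint I \<longrightarrow>
    (\<forall>V\<in>I. finite V \<and> real (card V) \<le> n) \<longrightarrow> 0 < n \<longrightarrow> rarely_dense I n (1 / 2) \<rho> \<sigma>))"

definition cliques_needed :: real where
  "cliques_needed = max 1 (2 ^ (2 * r + 3) * box_mean * (2 / \<beta>) ^ r)"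

definition \<theta> :: real where
  "\<theta> = min 1 (\<tau> / (4 * odds_factor))"

definition inner_scale :: real where
  "inner_scale = 2 ^ (2 * r + 4) * box_mean * (2 * real r) ^ r / (\<beta> * \<sigma>)"

definition \<delta>_max :: real where
  "\<delta>_max = min (\<eta> / (real r + 1)) (min (1 / inner_scale) (\<tau> / (8 * (ln (1 / \<theta>) + 1))))"

definition degree_exponent :: real where
  "degree_exponent = 1 / real (r + 2)"

definition rate :: real where
  "rate = min (\<kappa> * threshold_exponent r / 8) (1 / 2)"

definition tail :: "real \<Rightarrow> real" where
  "tail x = 2 * (2 * odds_factor * x powr (- rate) + x\<^sup>2 * exp (- (1 / 2 * sqrt (x powr degree_exponent))))
    + x * exp (- (x powr degree_exponent))"

definition large :: "real \<Rightarrow> bool" where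
  "large x \<longleftrightarrow> 2 \<le> x \<and> 1 \<le> ln x \<and> (cliques_needed\<^sup>2) ^ (r - 1) \<le> ln x ^ 2 \<and>
    4 * ln x / \<tau> \<le> x powr degree_exponent \<and> 1 \<le> \<beta> * x powr degree_exponent \<and>
    (4 * (2 * real r) ^ (r - 1) * ln x) powr (1 / real ((Suc r choose 2) - 1))
      * x powr (- (\<kappa> * threshold_exponent r / 4)) \<le> x powr (- rate) \<and>
    odds_factor * x powr (- rate) \<le> 1 / 2 \<and> tail x \<le> 1 \<and>
    1 / \<eta> * (exp (- (\<tau> / 4 * (x * x powr degree_exponent))) + real r * (2 * tail x)) \<le> x powr (- (rate / 2))"

lemma r_pos: "0 < real r" "1 \<le> real r" "1 \<le> r"
  using two_le_r by auto

lemma \<eta>_le_quarter: "\<eta> \<le> 1 / 4"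
proof -
  have "1 / (2 * real r) \<le> 1 / (2 * 2)" using two_le_r by (intro divide_left_mono) auto
  then show ?thesis using \<eta>_le by simp
qed

lemma thinning_bounds: "1 / 4 \<le> thinning" "thinning \<le> 1"
proof -
  have "(1 / 2)\<^sup>2 \<le> (1 - \<eta>)\<^sup>2" using \<eta>_le_quarter by (intro power_mono) auto
  then show "1 / 4 \<le> thinning" by (simp add: thinning_def power2_eq_square)
  show "thinning \<le> 1" unfolding thinning_def using \<eta>_pos \<eta>_le_quarter by (intro power_le_one) auto
qed

lemma \<epsilon>_pos: "0 < \<epsilon>"
  using \<kappa>_pos by (simp add: \<epsilon>_def)

lemma \<epsilon>_le: "\<epsilon> \<le> 1 / 8" "\<epsilon> * (8 + 4 * \<kappa>) \<le> \<kappa>"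
proof -
  show "\<epsilon> \<le> 1 / 8" unfolding \<epsilon>_def by (rule min.cobounded1)
  have "\<epsilon> \<le> \<kappa> / (8 + 4 * \<kappa>)" by (simp add: \<epsilon>_def)
  then show "\<epsilon> * (8 + 4 * \<kappa>) \<le> \<kappa>" using \<kappa>_pos by (simp add: pos_le_divide_eq)
qed

lemma s_bounds: "3 / 4 \<le> s" "1 + \<kappa> / 4 \<le> s * (1 + \<kappa> / 2)"
proof -
  have s_ge: "1 - 2 * \<epsilon> \<le> s" unfolding s_def by (simp add: power2_eq_square algebra_simps)
  then show "3 / 4 \<le> s" using \<epsilon>_le(1) by linarith
  have "(1 - 2 * \<epsilon>) * (1 + \<kappa> / 2) \<le> s * (1 + \<kappa> / 2)" using s_ge \<kappa>_pos by (intro mult_right_mono) auto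
  moreover have "1 + \<kappa> / 4 \<le> (1 - 2 * \<epsilon>) * (1 + \<kappa> / 2)" using \<epsilon>_le(2) by (simp add: algebra_simps)
  ultimately show "1 + \<kappa> / 4 \<le> s * (1 + \<kappa> / 2)" by linarith
qed

lemma dense_gap_bounds: "0 < dense_gap r" "dense_gap r \<le> 1"
  by (auto simp: dense_gap_def power_le_one)

lemma odds_factor_pos: "0 < odds_factor"
  using dense_gap_bounds thinning_bounds by (simp add: odds_factor_def)

lemma \<tau>_bounds: "0 < \<tau>" "2 ^ r * ((real r + 2) * (2 * real r) ^ r * \<tau>) \<le> \<epsilon>"
  using \<epsilon>_pos r_pos by (auto simp: \<tau>_def)

lemma log_cutoff_spec: "1 \<le> log_cutoff" "log_cutoff \<le> y \<Longrightarrow> ln (odds_factor * exp 1 * y) \<le> sqrt y / 4"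
proof -
  have "eventually (\<lambda>x. ln (odds_factor * exp 1 * x) \<le> sqrt x / 4) at_top"
    using odds_factor_pos by real_asymp
  then obtain X where "\<forall>x\<ge>X. ln (odds_factor * exp 1 * x) \<le> sqrt x / 4"
    unfolding eventually_at_top_linorder by blast
  then have "\<exists>x. 1 \<le> x \<and> (\<forall>y\<ge>x. ln (odds_factor * exp 1 * y) \<le> sqrt y / 4)"
    by (intro exI[of _ "max X 1"]) auto
  from someI_ex[OF this, folded log_cutoff_def]
  show "1 \<le> log_cutoff" "log_cutoff \<le> y \<Longrightarrow> ln (odds_factor * exp 1 * y) \<le> sqrt y / 4" by auto
qed

lemma \<beta>_bounds: "0 < \<beta>" "\<beta> \<le> \<tau>\<^sup>2 / 4" "\<beta> \<le> 1 / log_cutoff" "\<beta> \<le> 1"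
proof -
  show "0 < \<beta>" "\<beta> \<le> \<tau>\<^sup>2 / 4" "\<beta> \<le> 1 / log_cutoff" using \<tau>_bounds log_cutoff_spec(1) by (auto simp: \<beta>_def)
  moreover have "1 / log_cutoff \<le> 1" using log_cutoff_spec(1) by simp
  ultimately show "\<beta> \<le> 1" by linarith
qed

lemma decay_pos: "0 < decay"
  using r_pos odds_factor_pos by (simp add: decay_def add_pos_pos)

lemma box_mean_bounds: "1 \<le> box_mean" "\<epsilon> * (1 / 2 * box_mean) = decay + 1"
proof -
  have "\<epsilon> \<le> 1" using \<epsilon>_le(1) by (rule order_trans) simp
  also have "1 \<le> 2 * (decay + 1)" using decay_pos by simp
  finally have "\<epsilon> \<le> 2 * (decay + 1)" .
  then show "1 \<le> box_mean" using \<epsilon>_pos by (simp add: box_mean_def)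
  show "\<epsilon> * (1 / 2 * box_mean) = decay + 1" using \<epsilon>_pos by (simp add: box_mean_def)
qed

lemma \<rho>_pos: "0 < \<rho>"
  by (simp add: \<rho>_def)

lemma \<sigma>_spec: "0 < \<sigma>"
  "finite I \<Longrightarrow> card I = r \<Longrightarrow> disjoint I \<Longrightarrow> (\<And>V. V \<in> I \<Longrightarrow> finite V \<and> real (card V) \<le> n) \<Longrightarrow> 0 < n
    \<Longrightarrow> rarely_dense (I :: nat set set) n (1 / 2) \<rho> \<sigma>"
proof -
  have "\<exists>\<sigma>. 0 < \<sigma> \<and> (\<forall>(I :: nat set set) n. finite I \<longrightarrow> card I = r \<longrightarrow> disjoint I \<longrightarrow>
      (\<forall>V\<in>I. finite V \<and> real (card V) \<le> n) \<longrightarrow> 0 < n \<longrightarrow> rarely_dense I n (1 / 2) \<rho> \<sigma>)"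
    using ex_rarely_dense[of "1 / 2" \<rho> r, where 'a = nat] \<rho>_pos by simp
  from someI_ex[OF this, folded \<sigma>_def] show "0 < \<sigma>"
    "finite I \<Longrightarrow> card I = r \<Longrightarrow> disjoint I \<Longrightarrow> (\<And>V. V \<in> I \<Longrightarrow> finite V \<and> real (card V) \<le> n) \<Longrightarrow> 0 < n
      \<Longrightarrow> rarely_dense I n (1 / 2) \<rho> \<sigma>" by blast+
qed

lemma cliques_needed_ge: "1 \<le> cliques_needed" "2 ^ (2 * r + 3) * box_mean * (2 / \<beta>) ^ r \<le> cliques_needed"
  by (auto simp: cliques_needed_def)

lemma \<theta>_bounds: "0 < \<theta>" "\<theta> \<le> 1" "\<theta> * odds_factor \<le> \<tau> / 4" "0 \<le> ln (1 / \<theta>)"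
proof -
  show "0 < \<theta>" "\<theta> \<le> 1" using \<tau>_bounds odds_factor_pos by (auto simp: \<theta>_def)
  then show "0 \<le> ln (1 / \<theta>)" by simp
  have "\<theta> * odds_factor \<le> \<tau> / (4 * odds_factor) * odds_factor"
    using odds_factor_pos by (intro mult_right_mono) (auto simp: \<theta>_def)
  then show "\<theta> * odds_factor \<le> \<tau> / 4" using odds_factor_pos by simp
qed

lemma inner_scale_pos: "0 < inner_scale"
  unfolding inner_scale_def using box_mean_bounds \<beta>_bounds \<sigma>_spec(1) r_pos
  by (intro divide_pos_pos mult_pos_pos) auto

lemma \<delta>_max_pos: "0 < \<delta>_max"
  unfolding \<delta>_max_def using \<eta>_pos inner_scale_pos \<tau>_bounds \<theta>_bounds(4) by (auto intro!: divide_pos_pos)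

lemma threshold_exponent_facts: "1 \<le> threshold_exponent r" "threshold_exponent r = 2 - 2 / (real r + 2)"
  using r_pos by (auto simp: threshold_exponent_def field_simps)

lemma rate_bounds: "0 < rate" "rate < \<kappa> * threshold_exponent r / 4" "rate \<le> 1"
  using mult_pos_pos[OF \<kappa>_pos, of "threshold_exponent r"] threshold_exponent_facts(1) by (auto simp: rate_def)

lemma eventually_large: "eventually large at_top"
proof -
  let ?k = "real ((Suc r choose 2) - 1)"
  have "0 < 2 * ?k" unfolding two_clique_minus_edge[OF r_pos(3)] using two_le_r by simp
  then have k: "0 < 1 / ?k" by simp
  have A: "0 < 4 * (2 * real r) ^ (r - 1)" using r_pos by simp
  have a: "0 < degree_exponent" by (simp add: degree_exponent_def)
  note pos = \<tau>_bounds(1) \<beta>_bounds(1) odds_factor_pos a rate_bounds(1,2) \<eta>_pos r_pos(1)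
  have "eventually (\<lambda>x::real. 2 \<le> x) at_top" by real_asymp
  moreover have "eventually (\<lambda>x::real. 1 \<le> ln x) at_top" by real_asymp
  moreover have "eventually (\<lambda>x::real. (cliques_needed\<^sup>2) ^ (r - 1) \<le> ln x ^ 2) at_top" by real_asymp
  moreover have "eventually (\<lambda>x. 4 * ln x / \<tau> \<le> x powr degree_exponent) at_top" using pos by real_asymp
  moreover have "eventually (\<lambda>x. 1 \<le> \<beta> * x powr degree_exponent) at_top" using pos by real_asymp
  moreover have "eventually (\<lambda>x. (4 * (2 * real r) ^ (r - 1) * ln x) powr (1 / ?k)
      * x powr (- (\<kappa> * threshold_exponent r / 4)) \<le> x powr (- rate)) at_top"
    using pos k A by real_asymp
  moreover have "eventually (\<lambda>x. odds_factor * x powr (- rate) \<le> 1 / 2) at_top" using pos by real_asymp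
  moreover have "eventually (\<lambda>x. tail x \<le> 1) at_top" unfolding tail_def using pos by real_asymp
  moreover have "eventually (\<lambda>x. 1 / \<eta> * (exp (- (\<tau> / 4 * (x * x powr degree_exponent))) + real r * (2 * tail x))
      \<le> x powr (- (rate / 2))) at_top"
    unfolding tail_def using pos by real_asymp
  ultimately show ?thesis unfolding large_def by eventually_elim blast
qed

end

locale sparse_instance = sparse_constants r \<kappa> \<eta> + vertex_partition n r P
  for r \<kappa> \<eta> n P +
  fixes m :: nat and \<delta> :: real
  assumes large_n: "large (real n)" and \<delta>: "0 < \<delta>" "\<delta> < \<delta>_max"
    and m_ge: "(1 + \<kappa>) * m_r r n \<le> real m" and balanced: "P \<in> balanced_partitions n r \<eta>"
    and sparse: "real m < (1 - dense_gap r) * real (e_part P)"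
begin

definition p :: real where
  "p = thinning * real m / real (e_part P)"

definition d :: nat where
  "d = nat \<lfloor>\<beta> * (p * real n)\<rfloor>"

definition N :: nat where
  "N = nat \<lceil>box_mean * (p * real n) / p ^ (r choose 2)\<rceil>"

definition min_completions :: real where
  "min_completions = cliques_per_pair ((1 / real r - \<eta>) * real n) p (Suc r)"

definition M :: real where
  "M = min min_completions (4 * ln (real n))"

definition z :: real where
  "z = odds_factor * p"

definition S :: real where
  "S = 2 * (z * real n * exp (- (s * M))) + real n * exp (- (1 / 2 * sqrt (p * real n)))"

lemma n_ge: "2 \<le> n" "2 \<le> real n" "1 \<le> real n" "0 < real n" "1 \<le> ln (real n)"
  using large_n by (auto simp: large_def)

lemma m_less: "real m < real (e_part P)" "0 < real (e_part P)"
proof -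
  have "(1 - dense_gap r) * real (e_part P) \<le> 1 * real (e_part P)"
    using dense_gap_bounds by (intro mult_right_mono) auto
  then show "real m < real (e_part P)" using sparse by simp
  then show "0 < real (e_part P)" by (meson of_nat_0_le_iff order_le_less_trans)
qed

lemma p_pos: "0 < p"
proof -
  have "0 < (1 + \<kappa>) * m_r r n" using n_ge \<kappa>_pos two_le_r by (simp add: m_r_def theta_def)
  then have "0 < real m" using m_ge by (rule order_less_le_trans)
  then show ?thesis using m_less(2) thinning_bounds by (simp add: p_def)
qed

lemma p_le_1: "p \<le> 1"
proof -
  have "thinning * real m \<le> 1 * real (e_part P)" using thinning_bounds m_less by (intro mult_mono) auto
  then show ?thesis unfolding p_def using m_less(2) by (simp add: divide_le_eq)
qed

lemma e_part_mult_p: "real (e_part P) * p = thinning * real m"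
  using m_less(2) by (simp add: p_def)

lemma share_ge: "1 / (2 * real r) \<le> 1 / real r - \<eta>"
  using \<eta>_le r_pos by (simp add: field_simps)

lemma share_nonneg: "0 \<le> (1 / real r - \<eta>) * real n"
  using order_trans[OF _ share_ge, of 0] by simp

lemma min_completions_ge: "(1 + \<kappa> / 2) * threshold_exponent r * ln (real n) \<le> min_completions"
proof -
  let ?k = "(Suc r choose 2) - 1" and ?t = "threshold_exponent r * ln (real n)"
  have t: "0 \<le> ?t" using threshold_exponent_facts(1) n_ge by simp
  have "(thinning * (1 + \<kappa>)) ^ ?k * (real r ^ (r - 1) * threshold_exponent r * ln (real n))
      \<le> cliques_per_pair (real n) p (Suc r)"
    unfolding p_def using thinning_bounds m_less e_part_le \<kappa>_pos m_ge n_ge two_le_r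
    by (intro cliques_per_pair_above_threshold) auto
  then have "(1 / real r - \<eta>) ^ (r - 1) * ((thinning * (1 + \<kappa>)) ^ ?k * (real r ^ (r - 1) * ?t))
      \<le> (1 / real r - \<eta>) ^ (r - 1) * cliques_per_pair (real n) p (Suc r)"
    using share_ge r_pos order_trans[OF _ share_ge, of 0]
    by (intro mult_left_mono zero_le_power) (auto simp: mult.assoc)
  also have "\<dots> = min_completions" by (simp add: min_completions_def cliques_per_pair_def power_mult_distrib)
  finally have "((1 / real r - \<eta>) ^ (r - 1) * real r ^ (r - 1)) * (thinning * (1 + \<kappa>)) ^ ?k * ?t
      \<le> min_completions"
    by (simp only: mult_ac)
  also have "(1 / real r - \<eta>) ^ (r - 1) * real r ^ (r - 1) = (1 - real r * \<eta>) ^ (r - 1)"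
    using r_pos by (simp add: power_mult_distrib[symmetric] algebra_simps)
  finally have "(1 - real r * \<eta>) ^ (r - 1) * (thinning * (1 + \<kappa>)) ^ ?k * ?t \<le> min_completions" .
  moreover have "(1 + \<kappa> / 2) * ?t \<le> (1 - real r * \<eta>) ^ (r - 1) * (thinning * (1 + \<kappa>)) ^ ?k * ?t"
    using loss t unfolding thinning_def by (intro mult_right_mono) auto
  ultimately show ?thesis by (simp add: mult.assoc)
qed

lemma cliques_le_min_completions:
  "cliques_per_pair (real n) p (Suc r) \<le> (2 * real r) ^ (r - 1) * min_completions"
proof -
  have "1 \<le> 2 * real r * (1 / real r - \<eta>)" using share_ge r_pos by (simp add: field_simps)
  then have "1 \<le> (2 * real r * (1 / real r - \<eta>)) ^ (r - 1)" by (rule one_le_power)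
  then have "cliques_per_pair (real n) p (Suc r)
      \<le> (2 * real r * (1 / real r - \<eta>)) ^ (r - 1) * cliques_per_pair (real n) p (Suc r)"
    using mult_right_mono[of 1 _ "cliques_per_pair (real n) p (Suc r)"] p_pos
    by (simp add: cliques_per_pair_def)
  then show ?thesis
    unfolding min_completions_def cliques_per_pair_def
    by (simp only: power_mult_distrib mult_ac diff_Suc_Suc numeral_2_eq_2 One_nat_def)
qed

lemma ln_le_min_completions: "ln (real n) \<le> min_completions"
proof -
  have "1 * 1 \<le> (1 + \<kappa> / 2) * threshold_exponent r"
    using \<kappa>_pos threshold_exponent_facts by (intro mult_mono) auto
  then have "ln (real n) \<le> (1 + \<kappa> / 2) * threshold_exponent r * ln (real n)"
    using mult_right_mono[of 1 "(1 + \<kappa> / 2) * threshold_exponent r" "ln (real n)"] n_ge by simp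
  then show ?thesis using min_completions_ge by linarith
qed

lemma square_density: "cliques_needed\<^sup>2 \<le> (real n)\<^sup>2 * p ^ (r + 2)"
proof (rule ccontr)
  assume "\<not> ?thesis"
  then have "((real n)\<^sup>2 * p ^ (r + 2)) ^ (r - 1) < (cliques_needed\<^sup>2) ^ (r - 1)"
    using p_pos two_le_r by (intro power_strict_mono) auto
  also have "\<dots> \<le> ln (real n) ^ 2" using large_n by (simp add: large_def)
  also have "\<dots> \<le> (cliques_per_pair (real n) p (Suc r))\<^sup>2"
  proof (rule power_mono)
    have "(1 / real r - \<eta>) * real n \<le> 1 * real n"
    proof (rule mult_right_mono)
      have "1 / real r \<le> 1" using r_pos by simp
      then show "1 / real r - \<eta> \<le> 1" using \<eta>_pos by linarith
    qed simp
    then have "min_completions \<le> cliques_per_pair (real n) p (Suc r)"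
      unfolding min_completions_def using share_nonneg p_pos by (intro cliques_per_pair_mono) auto
    then show "ln (real n) \<le> cliques_per_pair (real n) p (Suc r)" using ln_le_min_completions by linarith
  qed (use n_ge in simp)
  also have "\<dots> = ((real n)\<^sup>2 * p ^ (r + 2)) ^ (r - 1)"
    using cliques_per_pair_square[of "Suc r" "real n" p] two_le_r by simp
  finally show False by simp
qed

lemma cliques_ge:
  "2 \<le> j \<Longrightarrow> j \<le> r \<Longrightarrow> 1 \<le> cliques_per_pair (real n) p j"
  "2 \<le> j \<Longrightarrow> j \<le> r \<Longrightarrow> cliques_needed \<le> cliques_per_pair (real n) p (Suc j)"
  "3 \<le> j \<Longrightarrow> j \<le> r \<Longrightarrow> real n powr degree_exponent \<le> cliques_per_pair (real n) p j"
  unfolding degree_exponent_def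
  using cliques_per_pair_ge_1 cliques_per_pair_Suc_ge root_le_cliques_per_pair
    n_ge(3) p_pos p_le_1 cliques_needed_ge(1) square_density r_pos(3) by blast+

lemma mean_degree: "real n powr degree_exponent \<le> p * real n" "1 \<le> \<beta> * (p * real n)" "1 \<le> p * real n"
proof -
  show "real n powr degree_exponent \<le> p * real n"
    unfolding degree_exponent_def
    by (rule root_le_mean_degree[OF n_ge(3) p_pos p_le_1 cliques_needed_ge(1) square_density r_pos(3)])
  then have "\<beta> * real n powr degree_exponent \<le> \<beta> * (p * real n)" using \<beta>_bounds by (intro mult_left_mono) auto
  moreover have "1 \<le> \<beta> * real n powr degree_exponent" using large_n by (simp add: large_def)
  ultimately show "1 \<le> \<beta> * (p * real n)" by linarith
  moreover have "\<beta> * (p * real n) \<le> 1 * (p * real n)" using \<beta>_bounds p_pos by (intro mult_right_mono) auto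
  ultimately show "1 \<le> p * real n" by linarith
qed

lemma d_bounds: "real d \<le> \<beta> * (p * real n)" "\<beta> * (p * real n) / 2 \<le> real d" "1 \<le> d" "d \<le> n"
proof -
  show le: "real d \<le> \<beta> * (p * real n)" unfolding d_def using mean_degree(2) by (simp add: of_nat_floor)
  show "\<beta> * (p * real n) / 2 \<le> real d" unfolding d_def by (rule real_nat_floor_ge_half[OF mean_degree(2)])
  show "1 \<le> d" unfolding d_def using mean_degree(2) by (simp add: le_nat_iff le_floor_iff)
  have "\<beta> * (p * real n) \<le> 1 * (1 * real n)" using \<beta>_bounds p_pos p_le_1 by (intro mult_mono) auto
  then show "d \<le> n" using le by linarith
qed

lemma N_bounds: "box_mean * (p * real n) \<le> real N * p ^ (r choose 2)"
  "real N * p ^ (r choose 2) \<le> 2 * box_mean * (p * real n)"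
proof -
  let ?c = "p ^ (r choose 2)"
  have c: "0 < ?c" "?c \<le> 1" using p_pos p_le_1 by (auto simp: power_le_one)
  have "box_mean * (p * real n) / ?c \<le> real N" unfolding N_def by (rule real_nat_ceiling_ge)
  then show "box_mean * (p * real n) \<le> real N * ?c" using c by (simp add: pos_divide_le_eq)
  have "1 * 1 \<le> box_mean * (p * real n)" using box_mean_bounds mean_degree by (intro mult_mono) auto
  then have "1 \<le> box_mean * (p * real n) / ?c" using c by (simp add: pos_le_divide_eq)
  then have "real N \<le> 2 * (box_mean * (p * real n) / ?c)" unfolding N_def by (rule real_nat_ceiling_le_double)
  then have "real N * ?c \<le> 2 * (box_mean * (p * real n) / ?c) * ?c" using c by (intro mult_right_mono) auto
  then show "real N * ?c \<le> 2 * box_mean * (p * real n)" using p_pos by simp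
qed

lemma m_le_twice_density: "real m \<le> 2 * (p * real n ^ 2)"
proof -
  have "1 / 4 * real m \<le> thinning * real m" using thinning_bounds by (intro mult_right_mono) auto
  also have "\<dots> = p * real (e_part P)" using e_part_mult_p by (simp add: mult.commute)
  also have "\<dots> \<le> p * (real n ^ 2 / 2)"
    using card_pairs_le[OF E_subset] p_pos by (intro mult_left_mono) (auto simp: e_part_def)
  finally show ?thesis by simp
qed

lemma power_mean_degree: "p ^ (j choose 2) * (p * real n) ^ j
    = p * real n * cliques_per_pair (real n) p (Suc j)"
  if "1 \<le> j"
proof -
  have "Suc j choose 2 = (j choose 2) + j" by (simp add: numeral_2_eq_2)
  then show ?thesis
    using power_mult_cliques_per_pair(2)[of "Suc j" "real n" p] that
    by (simp add: power_mult_distrib power_add mult_ac)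
qed

lemma room_in_box:
  assumes j: "2 \<le> j" "j \<le> r"
  shows "2 ^ Suc r * real N \<le> 1 / 2 * (codegree_cap r p j * real d ^ j)"
proof -
  let ?c = "p ^ (j choose 2)" and ?m = "p * real n" and ?K = "2 ^ (2 * r + 3) * box_mean"
  have m: "0 < ?m" using p_pos n_ge by simp
  have "(\<beta> / 2) ^ r * ?m ^ j \<le> (\<beta> / 2) ^ j * ?m ^ j"
    using \<beta>_bounds m j by (intro mult_right_mono power_decreasing) auto
  also have "\<dots> = (\<beta> * ?m / 2) ^ j" by (simp add: power_mult_distrib power_divide)
  also have "\<dots> \<le> real d ^ j" using d_bounds(2) \<beta>_bounds m by (intro power_mono) auto
  finally have dj: "(\<beta> / 2) ^ r * ?m ^ j \<le> real d ^ j" .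
  have "(\<beta> / 2) ^ r * (2 / \<beta>) ^ r = 1" using \<beta>_bounds by (simp flip: power_mult_distrib)
  then have "?K * ?m = (\<beta> / 2) ^ r * (?m * (?K * (2 / \<beta>) ^ r))" by (simp add: mult_ac)
  also have "\<dots> \<le> (\<beta> / 2) ^ r * (?m * cliques_per_pair (real n) p (Suc j))"
    using cliques_needed_ge(2) cliques_ge(2)[OF j] \<beta>_bounds m by (intro mult_left_mono) auto
  also have "\<dots> = ?c * ((\<beta> / 2) ^ r * ?m ^ j)" using power_mean_degree[of j] j by (simp add: mult_ac)
  also have "\<dots> \<le> ?c * real d ^ j" using dj p_pos by (intro mult_left_mono) auto
  finally have room: "?K * ?m \<le> ?c * real d ^ j" .
  have "2 ^ Suc r * real N * (2 ^ Suc r * p ^ (r choose 2))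
      = 2 ^ Suc r * 2 ^ Suc r * (real N * p ^ (r choose 2))" by simp
  also have "\<dots> \<le> 2 ^ Suc r * 2 ^ Suc r * (2 * box_mean * ?m)" using N_bounds(2) by (intro mult_left_mono) auto
  also have "\<dots> = ?K * ?m" by (simp add: power_add power_mult power2_eq_square power_mult_distrib[symmetric])
  finally have "2 ^ Suc r * real N * (2 ^ Suc r * p ^ (r choose 2)) \<le> ?c * real d ^ j" using room by linarith
  then have "2 ^ Suc r * real N \<le> ?c * real d ^ j / (2 ^ Suc r * p ^ (r choose 2))"
    using p_pos by (simp add: pos_le_divide_eq)
  then show ?thesis by (simp add: codegree_cap_def mult_ac)
qed

sublocale greedy_transversals P r "real n" p \<rho> \<sigma> d N
proof
  show le: "real (card V) \<le> real n" if "V \<in> P" for V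
    using card_mono[OF _ part_subset[OF that]] by simp
  show "real n / (2 * real r) \<le> real (card V)" if "V \<in> P" for V
    by (rule part_ge_of_balanced[OF balanced \<eta>_le that])
  show "rarely_dense P (real n) (1 / 2) \<rho> \<sigma>"
    by (rule \<sigma>_spec(2)) (use finite_P card_P disjoint_P finite_part le n_ge in auto)
qed (use n_ge p_pos p_le_1 d_bounds \<rho>_pos \<sigma>_spec(1) room_in_box in auto)

lemma few_centres:
  assumes "real y * real d \<le> \<delta> * real m"
  shows "\<beta> * real y \<le> 4 * \<delta> * real n"
proof -
  have "real y * (\<beta> * (p * real n) / 2) \<le> real y * real d" using d_bounds(2) by (intro mult_left_mono) auto
  also have "\<dots> \<le> \<delta> * (2 * (p * real n ^ 2))"
    using assms \<delta> mult_left_mono[OF m_le_twice_density, of \<delta>] by linarith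
  finally have "(\<beta> * real y) * (p * real n) \<le> (4 * \<delta> * real n) * (p * real n)"
    by (simp add: power2_eq_square mult_ac)
  then show ?thesis using mean_degree(3) by (simp add: mult_le_cancel_right)
qed

lemma room_for_centres:
  assumes y: "real y * real d \<le> \<delta> * real m"
  shows "room_for y"
  unfolding room_for_def
proof (intro allI impI)
  fix j :: nat assume j: "2 \<le> j" "j \<le> r"
  let ?c = "p ^ (j choose 2)" and ?pr = "p ^ (r choose 2)" and ?K = "2 ^ (2 * r + 4) * box_mean"
  have cliques: "real n ^ 2 * p \<le> real n ^ j * ?c"
    using power_mult_cliques_per_pair(1)[OF j(1), of "real n" p] p_pos
      mult_left_mono[OF cliques_ge(1)[OF j], of "real n ^ 2 * p"] by simp
  have "\<delta> \<le> 1 / inner_scale" using \<delta>(2) by (simp add: \<delta>_max_def)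
  then have scale: "\<delta> * inner_scale \<le> 1" using inner_scale_pos by (simp add: pos_le_divide_eq)
  have "\<beta> * (2 ^ Suc r * (real y * real N) * (2 ^ r * ?pr))
      = 2 ^ Suc r * 2 ^ r * ((\<beta> * real y) * (real N * ?pr))"
    by simp
  also have "\<dots> \<le> 2 ^ Suc r * 2 ^ r * ((4 * \<delta> * real n) * (2 * box_mean * (p * real n)))"
    by (rule mult_left_mono[OF mult_mono[OF few_centres[OF y] N_bounds(2)]]) (use \<delta> p_pos in auto)
  also have "\<dots> = ?K * \<delta> * (real n ^ 2 * p)"
    by (simp add: power_add power_mult power2_eq_square power_mult_distrib[symmetric] mult_ac)
  also have "\<dots> \<le> ?K * \<delta> * (real n ^ j * ?c)" using cliques box_mean_bounds \<delta> by (intro mult_left_mono) auto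
  also have "\<dots> = (\<delta> * inner_scale) * (\<beta> * (\<sigma> * (?c * (real n ^ j / (2 * real r) ^ r))))"
    unfolding inner_scale_def using \<beta>_bounds \<sigma>_spec(1) r_pos by (simp add: field_simps)
  also have "\<dots> \<le> 1 * (\<beta> * (\<sigma> * (?c * (real n ^ j / (2 * real r) ^ r))))"
    using scale \<beta>_bounds \<sigma>_spec(1) p_pos by (intro mult_right_mono) auto
  also have "\<dots> \<le> 1 * (\<beta> * (\<sigma> * (?c * (real n / (2 * real r)) ^ j)))"
  proof -
    have "(2 * real r) ^ j \<le> (2 * real r) ^ r" using j r_pos by (intro power_increasing) auto
    then have "real n ^ j / (2 * real r) ^ r \<le> real n ^ j / (2 * real r) ^ j"
      using r_pos by (intro divide_left_mono) auto
    then show ?thesis using \<beta>_bounds \<sigma>_spec(1) p_pos unfolding power_divide by (intro mult_left_mono) auto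
  qed
  finally have "2 ^ Suc r * (real y * real N) * (2 ^ r * ?pr) \<le> \<sigma> * (?c * (real n / (2 * real r)) ^ j)"
    using \<beta>_bounds by simp
  then have "2 ^ Suc r * (real y * real N) \<le> \<sigma> * (?c * (real n / (2 * real r)) ^ j) / (2 ^ r * ?pr)"
    using p_pos by (simp add: pos_le_divide_eq)
  then show "2 ^ Suc r * (real y * real N) \<le> \<sigma> * (codegree_cap r p j * (real n / (2 * real r)) ^ j)"
    by (simp add: codegree_cap_def mult_ac)
qed

lemma M_bounds: "0 \<le> M" "M \<le> min_completions" "M \<le> 4 * ln (real n)"
  using ln_le_min_completions n_ge by (auto simp: M_def)

lemma M_le_expected_completions:
  assumes "V \<in> P"
  shows "M \<le> expected_completions p V"
proof -
  have "(\<Prod>W\<in>P - {V}. (1 / real r - \<eta>) * real n) \<le> (\<Prod>W\<in>P - {V}. real (card W))"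
    using share_nonneg balanced by (intro prod_mono) (auto simp: balanced_partitions_def)
  moreover have "card (P - {V}) = r - 1" using assms finite_P card_P by simp
  ultimately have "((1 / real r - \<eta>) * real n) ^ (r - 1) \<le> (\<Prod>W\<in>P - {V}. real (card W))" by simp
  then have "min_completions \<le> expected_completions p V"
    unfolding min_completions_def cliques_per_pair_def expected_completions_def
    using p_pos by (auto intro!: mult_right_mono)
  then show ?thesis using M_bounds(2) by linarith
qed

lemma p_le_if_few_completions:
  assumes "min_completions \<le> 4 * ln (real n)"
  shows "real n powr (2 / (real r + 2)) * p
    \<le> (4 * (2 * real r) ^ (r - 1) * ln (real n)) powr (1 / real ((Suc r choose 2) - 1))"
proof -
  define k where "k = (Suc r choose 2) - 1"
  have k2: "2 * real k = (real r - 1) * (real r + 2)"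
    using two_clique_minus_edge[of r] r_pos by (simp add: k_def)
  then have k: "0 < k" using two_le_r by (intro gr0I) auto
  have "cliques_per_pair (real n) p (Suc r) \<le> (2 * real r) ^ (r - 1) * (4 * ln (real n))"
    using cliques_le_min_completions by (rule order_trans) (intro mult_left_mono assms, simp)
  also have "cliques_per_pair (real n) p (Suc r) = real n powr (real r - 1) * p powr real k"
    using n_ge p_pos two_le_r by (simp add: cliques_per_pair_def k_def powr_realpow[symmetric] of_nat_diff)
  finally have "(real n powr (real r - 1) * p powr real k) powr (1 / real k)
      \<le> (4 * (2 * real r) ^ (r - 1) * ln (real n)) powr (1 / real k)"
    using n_ge p_pos by (intro powr_mono2) (auto simp: mult_ac)
  moreover have "(real n powr (real r - 1) * p powr real k) powr (1 / real k)
      = real n powr ((real r - 1) / real k) * p"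
    using n_ge p_pos k by (simp add: powr_mult powr_powr)
  moreover have "(real r - 1) / real k = 2 / (real r + 2)" using k2 k by (simp add: field_simps)
  ultimately show ?thesis by (simp add: k_def)
qed

text \<open>The expected number of inner pairs that close no clique is a negative power of \<open>n\<close>; this is where
  the constant in the definition of \<open>m_r\<close> enters.\<close>

lemma expected_inner_edges_le: "p * (real n)\<^sup>2 * exp (- (s * M)) \<le> real n powr (- rate)"
proof (cases "4 * ln (real n) \<le> min_completions")
  case True
  have "3 * ln (real n) \<le> s * M"
    using True s_bounds(1) n_ge mult_right_mono[OF s_bounds(1), of "4 * ln (real n)"]
    by (simp add: M_def min_absorb2)
  then have "exp (- (s * M)) \<le> exp (- (3 * ln (real n)))" by simp
  also have "\<dots> = real n powr (- 3)" using n_ge by (simp add: powr_def)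
  finally have "p * (real n)\<^sup>2 * exp (- (s * M)) \<le> 1 * (real n)\<^sup>2 * real n powr (- 3)"
    using p_pos p_le_1 by (intro mult_mono) auto
  also have "\<dots> = real n powr 2 * real n powr (- 3)" using n_ge by (simp only: mult_1 powr_numeral)
  also have "\<dots> = real n powr (- 1)" by (simp only: powr_add[symmetric]) simp
  also have "\<dots> \<le> real n powr (- rate)" using rate_bounds n_ge by (intro powr_mono) auto
  finally show ?thesis .
next
  case False
  let ?t = "threshold_exponent r"
  have "(1 + \<kappa> / 4) * (?t * ln (real n)) \<le> s * (1 + \<kappa> / 2) * (?t * ln (real n))"
    using s_bounds(2) threshold_exponent_facts(1) n_ge by (intro mult_right_mono) auto
  also have "\<dots> = s * ((1 + \<kappa> / 2) * ?t * ln (real n))" by simp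
  also have "\<dots> \<le> s * M" using False min_completions_ge s_bounds(1) by (intro mult_left_mono) (auto simp: M_def)
  finally have "exp (- (s * M)) \<le> real n powr (- ((1 + \<kappa> / 4) * ?t))"
    using n_ge by (simp add: powr_def mult.assoc)
  then have "p * (real n)\<^sup>2 * exp (- (s * M)) \<le> p * (real n)\<^sup>2 * real n powr (- ((1 + \<kappa> / 4) * ?t))"
    using p_pos by (intro mult_left_mono) auto
  also have "\<dots> = p * real n powr 2 * real n powr (- ((1 + \<kappa> / 4) * ?t))"
    using n_ge by (simp add: powr_numeral)
  also have "p * real n powr 2 * real n powr (- ((1 + \<kappa> / 4) * ?t))
      = p * real n powr (2 + - ((1 + \<kappa> / 4) * ?t))"
    by (simp only: powr_add mult.assoc)
  also have "2 + - ((1 + \<kappa> / 4) * ?t) = (2 - ?t) + - (\<kappa> * ?t / 4)" by (simp add: algebra_simps)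
  also have "2 - ?t = 2 / (real r + 2)" using threshold_exponent_facts(2) by linarith
  also have "p * real n powr (2 / (real r + 2) + - (\<kappa> * ?t / 4))
      = real n powr (2 / (real r + 2)) * p * real n powr (- (\<kappa> * ?t / 4))"
    by (simp only: powr_add mult_ac)
  also have "\<dots> \<le> (4 * (2 * real r) ^ (r - 1) * ln (real n)) powr (1 / real ((Suc r choose 2) - 1))
      * real n powr (- (\<kappa> * ?t / 4))"
    using False by (intro mult_right_mono p_le_if_few_completions) auto
  also have "\<dots> \<le> real n powr (- rate)" using large_n by (simp add: large_def)
  finally show ?thesis .
qed

lemma single_leaf_weight: "z * real n * exp (- (s * M)) * real n \<le> odds_factor * real n powr (- rate)"
  "z * real n * exp (- (s * M)) \<le> 1 / 2"
proof -
  show le: "z * real n * exp (- (s * M)) * real n \<le> odds_factor * real n powr (- rate)"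
    using mult_left_mono[OF expected_inner_edges_le, of odds_factor] odds_factor_pos
    by (simp add: z_def power2_eq_square mult_ac)
  have "z * real n * exp (- (s * M)) * 1 \<le> z * real n * exp (- (s * M)) * real n"
    using odds_factor_pos p_pos n_ge by (intro mult_left_mono) (auto simp: z_def)
  also have "\<dots> \<le> odds_factor * real n powr (- rate)" by (rule le)
  also have "odds_factor * real n powr (- rate) \<le> 1 / 2" using large_n by (simp add: large_def)
  finally show "z * real n * exp (- (s * M)) \<le> 1 / 2" by simp
qed

lemma star_sum:
  "(\<Sum>A\<in>{A\<in>Pow {1..n}. card A \<le> d}.
    z ^ card A * exp (- ((1 - \<epsilon>)\<^sup>2 * (real (card A) * min M (sqrt (p * real n / real (card A))))))) \<le> 1 + S"
  unfolding S_def z_def s_def[symmetric]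
proof (rule star_sum_le[OF _ p_pos odds_factor_pos s_bounds(1) d_bounds(4)])
  fix b assume b: "1 \<le> b" "b \<le> d"
  have "real b \<le> 1 / log_cutoff * (p * real n)"
    using b(2) d_bounds(1) mult_right_mono[OF \<beta>_bounds(3), of "p * real n"] p_pos by simp
  then have "log_cutoff * real b \<le> p * real n" using log_cutoff_spec(1) by (simp add: field_simps)
  then have "log_cutoff \<le> p * real n / real b" using b(1) by (simp add: pos_le_divide_eq)
  then show "ln (odds_factor * exp 1 * (p * real n / real b)) \<le> sqrt (p * real n / real b) / 4"
    by (rule log_cutoff_spec(2))
qed (use n_ge single_leaf_weight(2) in \<open>auto simp: z_def\<close>)

lemma box_deficit_le:
  "\<rho> ^ d + exp (- (\<epsilon> * (1 / 2 * (real N * p ^ (r choose 2))))) \<le> exp (- (decay * (p * real n)))"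
proof -
  let ?m = "p * real n"
  have "2 * (decay + 1) / \<beta> * (\<beta> * ?m / 2) \<le> 2 * (decay + 1) / \<beta> * real d"
    using d_bounds(2) decay_pos \<beta>_bounds by (intro mult_left_mono) auto
  moreover have "2 * (decay + 1) / \<beta> * (\<beta> * ?m / 2) = (decay + 1) * ?m" using \<beta>_bounds(1) by simp
  ultimately have "(decay + 1) * ?m \<le> 2 * (decay + 1) / \<beta> * real d" by (simp only:)
  then have "\<rho> ^ d \<le> exp (- ((decay + 1) * ?m))"
    unfolding \<rho>_def by (simp add: exp_of_nat_mult[symmetric] mult.commute)
  moreover have "exp (- (\<epsilon> * (1 / 2 * (real N * p ^ (r choose 2))))) \<le> exp (- ((decay + 1) * ?m))"
  proof -
    have "\<epsilon> * (1 / 2 * (box_mean * ?m)) \<le> \<epsilon> * (1 / 2 * (real N * p ^ (r choose 2)))"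
      using N_bounds(1) \<epsilon>_pos by (intro mult_left_mono) auto
    then show ?thesis unfolding box_mean_bounds(2)[symmetric] by (simp add: mult.assoc)
  qed
  moreover have "exp (- ((decay + 1) * ?m)) \<le> exp (- (decay * ?m)) * (1 / 2)"
  proof -
    have "exp (- ?m) \<le> exp (- 1)" using mean_degree(3) by simp
    also have "\<dots> \<le> 1 / 2" using exp_ge_add_one_self[of 1] by (simp add: exp_minus field_simps)
    finally have "exp (- (decay * ?m)) * exp (- ?m) \<le> exp (- (decay * ?m)) * (1 / 2)"
      by (intro mult_left_mono) auto
    then show ?thesis by (simp add: exp_add[symmetric] algebra_simps)
  qed
  ultimately show ?thesis by linarith
qed

lemma box_sum: "box_sum_bound \<epsilon> * z ^ (r * d) \<le> exp (- (real r * (z * real n + p * real n)))"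
proof -
  have z: "0 < z" using odds_factor_pos p_pos by (simp add: z_def)
  have "(real n ^ d / fact d) ^ r * z ^ (r * d) = ((z * real n) ^ d / fact d) ^ r"
    by (simp add: power_mult_distrib power_divide power_mult[symmetric] mult_ac)
  also have "\<dots> \<le> exp (z * real n) ^ r" using z by (intro power_mono power_div_fact_le_exp) auto
  also have "\<dots> = exp (real r * (z * real n))" by (simp add: exp_of_nat_mult)
  finally have "box_sum_bound \<epsilon> * z ^ (r * d) \<le> exp (- (decay * (p * real n))) * exp (real r * (z * real n))"
    unfolding box_sum_bound_def mult.assoc using box_deficit_le z by (intro mult_mono) auto
  also have "\<dots> = exp (- (decay * (p * real n)) + real r * (z * real n))" by (rule exp_add[symmetric])
  also have "- (decay * (p * real n)) + real r * (z * real n) = - (real r * (z * real n + p * real n))"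
    unfolding decay_def z_def by (simp add: algebra_simps)
  finally show ?thesis .
qed

lemma odds_bound: "real m \<le> z * real (e_part P - m)"
proof -
  have "dense_gap r * real (e_part P) \<le> real (e_part P - m)"
    using sparse m_less by (simp add: of_nat_diff algebra_simps)
  then have "z * (dense_gap r * real (e_part P)) \<le> z * real (e_part P - m)"
    using odds_factor_pos p_pos by (intro mult_left_mono) (auto simp: z_def)
  moreover have "z * (dense_gap r * real (e_part P)) = real m"
    unfolding z_def odds_factor_def p_def using dense_gap_bounds thinning_bounds m_less by simp
  ultimately show ?thesis by (simp only:)
qed

lemma mean_bound: "real (e_part P) * p \<le> (1 - \<eta>) * ((1 - (real r + 1) * \<delta>) * real m)"
proof -
  have "\<delta> \<le> \<eta> / (real r + 1)" using \<delta>(2) by (simp add: \<delta>_max_def)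
  then have "(real r + 1) * \<delta> \<le> \<eta>" using r_pos by (simp add: pos_le_divide_eq mult.commute)
  then have "(1 - \<eta>) * ((1 - \<eta>) * real m) \<le> (1 - \<eta>) * ((1 - (real r + 1) * \<delta>) * real m)"
    using \<eta>_le_quarter by (intro mult_left_mono mult_right_mono) auto
  then show ?thesis by (simp add: e_part_mult_p thinning_def power2_eq_square)
qed

lemma sqrt_d_le: "2 * sqrt (real d) \<le> \<tau> * sqrt (p * real n)"
proof -
  have "\<beta> * (p * real n) \<le> (\<tau>\<^sup>2 / 4) * (p * real n)" using \<beta>_bounds(2) p_pos by (intro mult_right_mono) auto
  then have "real d \<le> (\<tau>\<^sup>2 / 4) * (p * real n)" using d_bounds(1) by linarith
  then have "sqrt (real d) \<le> sqrt ((\<tau>\<^sup>2 / 4) * (p * real n))" by simp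
  also have "\<dots> = \<tau> / 2 * sqrt (p * real n)" using \<tau>_bounds by (simp add: real_sqrt_mult real_sqrt_divide)
  finally show ?thesis by simp
qed

sublocale sparse_range n r P p \<rho> \<sigma> d N m \<delta> \<eta> \<eta> z \<tau> "4 * ln (real n) / \<tau>" \<epsilon> M "p * real n" S
proof
  show "4 * ln (real n) / \<tau> \<le> cliques_per_pair (real n) p j" if "3 \<le> j" "j \<le> r" for j
    using cliques_ge(3)[OF that] large_n by (auto simp: large_def)
  show "0 < z" "0 \<le> p * real n" "0 < 4 * ln (real n) / \<tau>"
    using odds_factor_pos p_pos n_ge \<tau>_bounds by (auto simp: z_def)
  show "M \<le> \<tau> * (4 * ln (real n) / \<tau>)" using M_bounds(3) \<tau>_bounds by simp
  show "\<eta> \<le> 1" using \<eta>_le_quarter by simp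
  show "\<epsilon> \<le> 1" using \<epsilon>_le(1) by (rule order_trans) simp
qed (use \<eta>_pos \<delta> \<epsilon>_pos \<tau>_bounds m_less cliques_ge(1) M_bounds(1) M_le_expected_completions odds_bound mean_bound
    sqrt_d_le room_for_centres box_sum star_sum in auto)

lemma large_gain_tail:
  "exp (- ((1 - \<epsilon>) * gain_cap) + (\<delta> * real m * ln (1 / \<theta>) + \<theta> * z * real n ^ 2))
    \<le> exp (- (\<tau> / 4 * (real n * real n powr degree_exponent)))"
proof -
  have cap: "0 \<le> gain_cap" using \<tau>_bounds p_pos by (simp add: gain_cap_def)
  have "\<theta> * z * real n ^ 2 = (\<theta> * odds_factor) * (real n ^ 2 * p)" by (simp add: z_def)
  also have "\<dots> \<le> \<tau> / 4 * (real n ^ 2 * p)" using \<theta>_bounds(3) p_pos by (intro mult_right_mono) auto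
  finally have inner: "\<theta> * z * real n ^ 2 \<le> gain_cap / 4" by (simp add: gain_cap_def)
  have "\<delta> \<le> \<tau> / (8 * (ln (1 / \<theta>) + 1))" using \<delta>(2) by (simp add: \<delta>_max_def)
  then have "\<delta> * (8 * (ln (1 / \<theta>) + 1)) \<le> \<tau>" using \<theta>_bounds(4) by (simp add: pos_le_divide_eq)
  then have "\<delta> * ln (1 / \<theta>) * 8 \<le> \<tau>" using \<delta> by (simp add: algebra_simps)
  then have "\<delta> * ln (1 / \<theta>) * (2 * (p * real n ^ 2)) \<le> \<tau> / 8 * (2 * (p * real n ^ 2))"
    using p_pos by (intro mult_right_mono) auto
  moreover have "\<delta> * ln (1 / \<theta>) * real m \<le> \<delta> * ln (1 / \<theta>) * (2 * (p * real n ^ 2))"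
    using m_le_twice_density \<delta> \<theta>_bounds(4) by (intro mult_left_mono) auto
  ultimately have "\<delta> * real m * ln (1 / \<theta>) \<le> gain_cap / 4" by (simp add: gain_cap_def mult_ac)
  moreover have "7 / 8 * gain_cap \<le> (1 - \<epsilon>) * gain_cap" using \<epsilon>_le(1) cap by (intro mult_right_mono) auto
  moreover have "\<tau> / 4 * (real n * real n powr degree_exponent) \<le> gain_cap / 4"
  proof -
    have "\<tau> / 4 * (real n * real n powr degree_exponent) \<le> \<tau> / 4 * (real n * (p * real n))"
      using mean_degree(1) \<tau>_bounds by (intro mult_left_mono) auto
    then show ?thesis by (simp add: gain_cap_def power2_eq_square mult_ac)
  qed
  ultimately show ?thesis unfolding exp_le_cancel_iff using inner cap by linarith
qed

lemma small_gain_tail: "((1 + S) * (1 + exp (- (p * real n)))) ^ n - 1 \<le> 2 * tail (real n)"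
proof -
  let ?w = "exp (- (p * real n))" and ?x = "real n powr degree_exponent"
  have S: "0 \<le> S" by (rule S_nonneg)
  have w: "0 \<le> ?w" "?w \<le> 1" using p_pos by auto
  have "real n * S = 2 * (z * real n * exp (- (s * M)) * real n)
      + (real n)\<^sup>2 * exp (- (1 / 2 * sqrt (p * real n)))"
    unfolding S_def by (simp add: power2_eq_square algebra_simps)
  also have "\<dots> \<le> 2 * (odds_factor * real n powr (- rate)) + (real n)\<^sup>2 * exp (- (1 / 2 * sqrt ?x))"
    using single_leaf_weight(1) mean_degree(1) by (intro add_mono mult_left_mono) auto
  finally have "real n * S \<le> 2 * odds_factor * real n powr (- rate) + (real n)\<^sup>2 * exp (- (1 / 2 * sqrt ?x))"
    by simp
  moreover have "real n * ?w \<le> real n * exp (- ?x)" using mean_degree(1) by (intro mult_left_mono) auto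
  ultimately have le: "real n * (2 * S + ?w) \<le> tail (real n)" unfolding tail_def by (simp add: distrib_left)
  have "tail (real n) \<le> 1" using large_n by (simp add: large_def)
  then have "(1 + (2 * S + ?w)) ^ n - 1 \<le> 2 * (real n * (2 * S + ?w))"
    using le S w by (intro one_plus_power_minus_one_le) auto
  moreover have "(1 + S) * (1 + ?w) \<le> 1 + (2 * S + ?w)"
    using mult_left_mono[OF w(2) S] by (simp add: algebra_simps)
  then have "((1 + S) * (1 + ?w)) ^ n \<le> (1 + (2 * S + ?w)) ^ n" using S w by (intro power_mono) auto
  ultimately show ?thesis using le by linarith
qed

theorem card_F_star_le: "real (card (F_star n m r \<delta> \<eta> P))
    \<le> real n powr (- (rate / 2)) * real (e_part P choose m)"
proof -
  let ?C = "real (e_part P choose m)"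
  let ?t = "exp (- (\<tau> / 4 * (real n * real n powr degree_exponent))) + real r * (2 * tail (real n))"
  have "\<eta> * real (card (F_star n m r \<delta> \<eta> P)) \<le> ?C * ?t"
    using sparse_bound[OF \<theta>_bounds(1,2)]
    by (rule order_trans) (intro mult_left_mono add_mono large_gain_tail small_gain_tail, simp_all)
  then have "1 / \<eta> * (\<eta> * real (card (F_star n m r \<delta> \<eta> P))) \<le> 1 / \<eta> * (?C * ?t)"
    using \<eta>_pos by (intro mult_left_mono) auto
  then have "real (card (F_star n m r \<delta> \<eta> P)) \<le> ?C * (1 / \<eta> * ?t)" using \<eta>_pos by (simp add: mult_ac)
  also have "\<dots> \<le> ?C * real n powr (- (rate / 2))" using large_n by (intro mult_left_mono) (auto simp: large_def)
  finally show ?thesis by (simp add: mult.commute)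
qed

end

section \<open>All ranges together\<close>

lemma ex_sparse_bound_eventually:
  fixes \<kappa> :: real
  assumes "2 \<le> r" "0 < \<kappa>"
  shows "\<exists>\<gamma> c \<delta>0. 0 < \<gamma> \<and> \<gamma> \<le> 1 / (2 * real r) \<and> 0 < c \<and> 0 < \<delta>0 \<and>
    (\<forall>\<^sub>F n in sequentially. \<forall>m \<delta>. \<forall>P\<in>balanced_partitions n r \<gamma>.
      0 < \<delta> \<longrightarrow> \<delta> < \<delta>0 \<longrightarrow> (1 + \<kappa>) * m_r r n \<le> real m \<longrightarrow> real m < (1 - dense_gap r) * real (e_part P) \<longrightarrow>
      real (card (F_star n m r \<delta> \<gamma> P)) \<le> real n powr (- c) * real (e_part P choose m))"
proof -
  have "0 < 2 * real ((Suc r choose 2) - 1)" using two_clique_minus_edge[of r] assms by simp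
  then have "1 \<le> (Suc r choose 2) - 1" by linarith
  then obtain \<eta> where "0 < \<eta>" "\<eta> \<le> 1 / (2 * real r)"
    "1 + \<kappa> / 2 \<le> (1 - real r * \<eta>) ^ (r - 1) * ((1 - \<eta>)\<^sup>2 * (1 + \<kappa>)) ^ ((Suc r choose 2) - 1)"
    using ex_small_loss[OF assms] by blast
  then interpret sparse_constants r \<kappa> \<eta> using assms by unfold_locales
  have "\<forall>\<^sub>F n in sequentially. large (real n)"
    using eventually_large filterlim_real_sequentially by (rule eventually_compose_filterlim)
  then have "\<forall>\<^sub>F n in sequentially. \<forall>m \<delta>. \<forall>P\<in>balanced_partitions n r \<eta>.
      0 < \<delta> \<longrightarrow> \<delta> < \<delta>_max \<longrightarrow> (1 + \<kappa>) * m_r r n \<le> real m \<longrightarrow> real m < (1 - dense_gap r) * real (e_part P) \<longrightarrow>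
      real (card (F_star n m r \<delta> \<eta> P)) \<le> real n powr (- (rate / 2)) * real (e_part P choose m)"
  proof eventually_elim
    case (elim n)
    have "real (card (F_star n m r \<delta> \<eta> P)) \<le> real n powr (- (rate / 2)) * real (e_part P choose m)"
      if "P \<in> balanced_partitions n r \<eta>" "0 < \<delta>" "\<delta> < \<delta>_max" "(1 + \<kappa>) * m_r r n \<le> real m"
        "real m < (1 - dense_gap r) * real (e_part P)" for m \<delta> P
    proof -
      interpret sparse_instance r \<kappa> \<eta> n P m \<delta>
        using elim that assms by unfold_locales (auto simp: balanced_partitions_def)
      show ?thesis by (rule card_F_star_le)
    qed
    then show ?case by blast
  qed
  then show ?thesis
    using \<eta>_pos \<eta>_le rate_bounds(1) \<delta>_max_pos by (intro exI[of _ \<eta>] exI[of _ "rate / 2"] exI[of _ \<delta>_max]) simp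
qed

lemma dense_bound_eventually:
  assumes r: "2 \<le> r" and \<gamma>: "\<gamma> \<le> 1 / (2 * real r)" and c: "0 < c"
  shows "\<forall>\<^sub>F n in sequentially. \<forall>m \<delta>. \<forall>P\<in>balanced_partitions n r \<gamma>.
    \<delta> \<le> 1 / (2 ^ 13 * real r ^ 2) \<longrightarrow> (1 - dense_gap r) * real (e_part P) \<le> real m \<longrightarrow>
    real (card (F_star n m r \<delta> \<gamma> P)) \<le> real n powr (- c) * real (e_part P choose m)"
proof -
  have "\<forall>\<^sub>F n in sequentially. real n * (1 / 4) ^ n \<le> 1" by real_asymp
  moreover have "\<forall>\<^sub>F n in sequentially. 2 * (real n * (1 / 4) ^ n) \<le> real n powr (- c)" using c by real_asymp
  moreover have "\<forall>\<^sub>F n :: nat in sequentially. 0 < n" by (rule eventually_gt_at_top)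
  ultimately show ?thesis
  proof eventually_elim
    case (elim n)
    have "(1 + (1 / 4 :: real) ^ n) ^ n - 1 \<le> 2 * (real n * (1 / 4) ^ n)"
      using elim by (intro one_plus_power_minus_one_le) auto
    then have tail: "(1 + (1 / 4) ^ n) ^ n - 1 \<le> real n powr (- c)" using elim by linarith
    show ?case
    proof (intro allI ballI impI)
      fix m \<delta> P assume balanced: "P \<in> balanced_partitions n r \<gamma>" and \<delta>: "\<delta> \<le> 1 / (2 ^ 13 * real r ^ 2)"
        and m: "(1 - dense_gap r) * real (e_part P) \<le> real m"
      interpret vertex_partition n r P using balanced r by unfold_locales (auto simp: balanced_partitions_def)
      have "real (card (F_star n m r \<delta> \<gamma> P)) \<le> ((1 + (1 / 4) ^ n) ^ n - 1) * real (e_part P choose m)"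
        using dense_bound[OF elim(3) _ m \<delta>] part_ge_of_balanced[OF balanced \<gamma>] by blast
      also have "\<dots> \<le> real n powr (- c) * real (e_part P choose m)" using tail by (rule mult_right_mono) simp
      finally show "real (card (F_star n m r \<delta> \<gamma> P)) \<le> real n powr (- c) * real (e_part P choose m)" .
    qed
  qed
qed

lemma ex_card_F_star_bound:
  fixes \<kappa> :: real
  assumes r: "2 \<le> r" and "0 < \<kappa>"
  shows "\<exists>\<gamma> c \<delta>0. 0 < \<gamma> \<and> 0 < c \<and> 0 < \<delta>0 \<and> (\<forall>n m \<delta>. \<forall>P\<in>balanced_partitions n r \<gamma>.
    0 < \<delta> \<longrightarrow> \<delta> < \<delta>0 \<longrightarrow> (1 + \<kappa>) * m_r r n \<le> real m \<longrightarrow>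
    real (card (F_star n m r \<delta> \<gamma> P)) \<le> real n powr (- c) * real (e_part P choose m))"
proof -
  let ?bound = "\<lambda>n m \<delta> \<gamma> c P. real (card (F_star n m r \<delta> \<gamma> P)) \<le> real n powr (- c) * real (e_part P choose m)"
  obtain \<gamma> c \<delta>0 where \<gamma>: "0 < \<gamma>" "\<gamma> \<le> 1 / (2 * real r)" and c: "0 < c" and \<delta>0: "0 < \<delta>0"
    and sparse: "\<forall>\<^sub>F n in sequentially. \<forall>m \<delta>. \<forall>P\<in>balanced_partitions n r \<gamma>. 0 < \<delta> \<longrightarrow> \<delta> < \<delta>0 \<longrightarrow>
      (1 + \<kappa>) * m_r r n \<le> real m \<longrightarrow> real m < (1 - dense_gap r) * real (e_part P) \<longrightarrow> ?bound n m \<delta> \<gamma> c P"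
    using ex_sparse_bound_eventually[OF assms] by blast
  have "\<forall>\<^sub>F n in sequentially. \<forall>m \<delta>. \<forall>P\<in>balanced_partitions n r \<gamma>. 0 < \<delta> \<longrightarrow> \<delta> < \<delta>0 \<longrightarrow>
      \<delta> \<le> 1 / (2 ^ 13 * real r ^ 2) \<longrightarrow> (1 + \<kappa>) * m_r r n \<le> real m \<longrightarrow> ?bound n m \<delta> \<gamma> c P"
    using sparse dense_bound_eventually[OF r \<gamma>(2) c]
  proof eventually_elim
    case (elim n)
    show ?case
    proof (intro allI ballI impI)
      fix m \<delta> P assume "P \<in> balanced_partitions n r \<gamma>" "0 < \<delta>" "\<delta> < \<delta>0" "\<delta> \<le> 1 / (2 ^ 13 * real r ^ 2)"
        "(1 + \<kappa>) * m_r r n \<le> real m"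
      then show "?bound n m \<delta> \<gamma> c P"
        using elim by (cases "real m < (1 - dense_gap r) * real (e_part P)") (simp_all add: not_less)
    qed
  qed
  then obtain n0 where n0: "\<And>n m \<delta> P. n0 \<le> n \<Longrightarrow> P \<in> balanced_partitions n r \<gamma> \<Longrightarrow> 0 < \<delta> \<Longrightarrow> \<delta> < \<delta>0 \<Longrightarrow>
      \<delta> \<le> 1 / (2 ^ 13 * real r ^ 2) \<Longrightarrow> (1 + \<kappa>) * m_r r n \<le> real m \<Longrightarrow> ?bound n m \<delta> \<gamma> c P"
    unfolding eventually_sequentially by blast
  define \<delta>1 where "\<delta>1 = min \<delta>0 (min (1 / (2 ^ 13 * real r ^ 2)) (1 / real (Suc n0) ^ 2))"
  have bound: "?bound n m \<delta> \<gamma> c P" if balanced: "P \<in> balanced_partitions n r \<gamma>" and \<delta>: "0 < \<delta>" "\<delta> < \<delta>1"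
    and m: "(1 + \<kappa>) * m_r r n \<le> real m" for n m \<delta> P
  proof (cases "n0 \<le> n")
    case True
    then show ?thesis using n0[OF True balanced \<delta>(1)] \<delta>(2) m by (simp add: \<delta>1_def)
  next
    case False
    interpret vertex_partition n r P using balanced r by unfold_locales (auto simp: balanced_partitions_def)
    have "\<delta> * real n ^ 2 \<le> 1 / real (Suc n0) ^ 2 * real (Suc n0) ^ 2"
      using False \<delta> by (intro mult_mono power_mono) (auto simp: \<delta>1_def)
    then show ?thesis using F_star_empty[of \<delta> m \<gamma>] \<delta>(1) by simp
  qed
  have "0 < \<delta>1" using \<delta>0 r by (simp add: \<delta>1_def)
  with \<gamma>(1) c show ?thesis
    by (intro exI[of _ \<gamma>] exI[of _ c] exI[of _ \<delta>1] conjI allI ballI impI) (assumption | rule bound)+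
qed

theorem theorem6p3:
  fixes r :: nat and \<epsilon> :: real
  assumes "r \<ge> 2" and "\<epsilon> > 0"
  shows "\<exists>\<gamma>::real. \<gamma> > 0 \<and> (\<exists>\<omega>::nat \<Rightarrow> real. filterlim \<omega> at_top sequentially \<and>
           (\<exists>\<delta>0::real. \<delta>0 > 0 \<and> (\<forall>\<delta>. 0 < \<delta> \<and> \<delta> < \<delta>0 \<longrightarrow>
              (\<forall>n m. real m \<ge> (1 + \<epsilon>) * m_r r n \<longrightarrow>
                 (\<forall>P\<in>balanced_partitions n r \<gamma>.
                    real (card (F_star n m r \<delta> \<gamma> P)) \<le> (1 / \<omega> n) * real (e_part P choose m))))))"
proof -
  obtain \<gamma> c \<delta>0 where \<gamma>: "0 < \<gamma>" and c: "0 < c" and \<delta>0: "0 < \<delta>0"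
    and bound: "\<forall>n m \<delta>. \<forall>P\<in>balanced_partitions n r \<gamma>. 0 < \<delta> \<longrightarrow> \<delta> < \<delta>0 \<longrightarrow> (1 + \<epsilon>) * m_r r n \<le> real m \<longrightarrow>
      real (card (F_star n m r \<delta> \<gamma> P)) \<le> real n powr (- c) * real (e_part P choose m)"
    using ex_card_F_star_bound[OF assms] by blast
  moreover have "real n powr (- c) = 1 / real n powr c" for n by (rule powr_minus_divide)
  moreover have "filterlim (\<lambda>n. real n powr c) at_top sequentially" using c by real_asymp
  ultimately show ?thesis
    by (intro exI[of _ \<gamma>] conjI exI[of _ "\<lambda>n. real n powr c"] exI[of _ \<delta>0]) auto
qed

end
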